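(* For $1\le m\le M$, $(m-1)T<t\le mT$ and $1\le j\le K$ define $$\epsilon_{2t-1}^j=K^{-m+1}\sum_{\mathbf k\in\mathsf Z^m:\,A_{m,t-1}^{k(m)}=j}\big[f_t(\widetilde{\mathbf X}_t^{\mathbf k})-f_{t-1}(\mathbf X_{t-1}^{\mathbf k})\big]H_{t-1}^{\mathbf k},$$ $$\epsilon_{2t}^j=K^{-m+1}\sum_{\mathbf k\in\mathsf Z^m:\,A_{m,t-1}^{k(m)}=j}\big(\#_t^{k(m)}-KW_t^{k(m)}\big)f_t(\widetilde{\mathbf X}_t^{\mathbf k})\,\widetilde H_t^{\mathbf k}.$$ Then for each $1\le j\le K$ and $1\le m\le M$, $\{\epsilon_u^j,\mathcal F_u: 2(m-1)T<u\le 2mT\}$ is a martingale difference sequence, and $$K(\widehat\psi_U-\psi_U)=\sum_{m=1}^M\sum_{j=1}^K\big(\epsilon_{2(m-1)T+1}^j+\cdots+\epsilon_{2mT}^j\big).$$ Therefore $E_K\widehat\psi_U=\psi_U$, where $E_K$ denotes expectation with respect to the algorithm with $K$ sample paths in each particle filter.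
   Context: Model. Let $M,T\ge1$ be integers and $U=MT>1$. A hidden Markov model has latent states $X_t$ in a space $\mathsf X$ with dominating measure (written $dx$), initial density $p_\theta(x_1)$ (also written $p_\theta(x_t|x_{t-1})$ for $t=1$), transition density $p_\theta(x_t|x_{t-1})$, and observation density $g_\theta(Y_t|x_t)$. The parameter $\theta$ and the observations $\mathbf Y_U=(Y_1,\dots,Y_U)$ are fixed. Write $\mathbf x_t=(x_1,\dots,x_t)$ and, for $(m-1)T<t\le mT$, $\mathbf x_{m,t}=(x_{(m-1)T+1},\dots,x_t)$ (and $\mathbf x_{m,(m-1)T}$ is empty); similarly for capital letters. Let $$p_\theta(\mathbf x_U|\mathbf Y_U)=\prod_{t=1}^U[p_\theta(x_t|x_{t-1})g_\theta(Y_t|x_t)]\big/\lambda(\theta),$$ where $\lambda(\theta)\in(0,\infty)$ is the normalizing constant (likelihood). Let $\psi:\mathsf X^U\to\mathbb R$ be measurable with $\psi_U:=E_p[\psi(\mathbf X_U)|\mathbf Y_U]=\int\psi(\mathbf x_U)p_\theta(\mathbf x_U|\mathbf Y_U)\,d\mathbf x_U$ existing and finite. Importance densities and weights. For each $t$, $q_t(\cdot|\mathbf x_{t-1})$ is a probability density on $\mathsf X$ with $q_t(x_t|\mathbf x_{t-1})>0$ whenever $p_\theta(x_t|x_{t-1})>0$, and $w_t(\mathbf x_t)>0$ is a resampling weight. For $(m-1)T<t\le mT$, neither depends on $\mathbf x_{(m-1)T}$, so we write $q_t(\cdot|\mathbf x_{m,t-1})$ and $w_t(\mathbf x_{m,t})$.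 $E_q$ denotes expectation when $\mathbf X_U$ has density $\prod_{t=1}^Uq_t(x_t|\mathbf x_{t-1})$ (no resampling). Assume $\eta_t:=E_q[\prod_{u=1}^tw_u(\mathbf X_u)]<\infty$ for $1\le t\le U$. Algorithm. Let $K\ge 1$. The $M$ particle filters are run independently. Filter $m$, at stages $t=(m-1)T+1,\dots,mT$: (1) for $1\le k\le K$ sample (independently given the past) $\widetilde X_t^k\sim q_t(\cdot|\mathbf X_{m,t-1}^k)$ and put $\widetilde{\mathbf X}_{m,t}^k=(\mathbf X_{m,t-1}^k,\widetilde X_t^k)$ (just $\widetilde X_t^k$ if $t=(m-1)T+1$); (2) let $\bar w_t=K^{-1}\sum_kw_t(\widetilde{\mathbf X}_{m,t}^k)$, $W_t^j=w_t(\widetilde{\mathbf X}_{m,t}^j)/(K\bar w_t)$, and generate conditionally i.i.d. $B_t^1,\dots,B_t^K$ with $P\{B_t^1=j\}=W_t^j$; (3) with $B(k)=B_t^k$ set $(\mathbf X_{m,t}^k,A_{m,t}^k)=(\widetilde{\mathbf X}_{m,t}^{B(k)},A_{m,t-1}^{B(k)})$, $\widetilde H_{m,t}^j=H_{m,t-1}^j/(KW_t^j)$, $H_{m,t}^k=\widetilde H_{m,t}^{B(k)}$, with initial conventions $A_{m,(m-1)T}^k=k$, $H_{m,(m-1)T}^k=1$. Let $\#_t^k$ be the number of $i$ with $B_t^i=k$. Joined paths. $\mathsf Z^m=\{1,\dots,K\}^m$, $\mathbf k=(k(1),\dots,k(m))$. For $(m-1)T<t\le mT$ and $\mathbf k\in\mathsf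 Z^m$: $\mathbf X_t^{\mathbf k}=(\mathbf X_{1,T}^{k(1)},\dots,\mathbf X_{m-1,(m-1)T}^{k(m-1)},\mathbf X_{m,t}^{k(m)})$, $H_t^{\mathbf k}=\big(\prod_{n=1}^{m-1}H_{n,nT}^{k(n)}\big)H_{m,t}^{k(m)}$; and $\widetilde{\mathbf X}_t^{\mathbf k},\widetilde H_t^{\mathbf k}$ are the same with the last factors replaced by $\widetilde{\mathbf X}_{m,t}^{k(m)}$, $\widetilde H_{m,t}^{k(m)}$. When $t-1=(m-1)T$ and $\mathbf k\in\mathsf Z^m$, $\mathbf X_{t-1}^{\mathbf k}$ and $H_{t-1}^{\mathbf k}$ mean $(\mathbf X_{1,T}^{k(1)},\dots,\mathbf X_{m-1,(m-1)T}^{k(m-1)})$ and $\prod_{n=1}^{m-1}H_{n,nT}^{k(n)}$ (empty product $=1$). Estimator and filtration. $L(\mathbf x_U)=p_\theta(\mathbf x_U|\mathbf Y_U)/\prod_{t=1}^Uq_t(x_t|\mathbf x_{t-1})$, $\widehat\psi_U=K^{-M}\sum_{\mathbf k\in\mathsf Z^M}L(\mathbf X_U^{\mathbf k})\psi(\mathbf X_U^{\mathbf k})H_U^{\mathbf k}$. Let $f_0=\psi_U$ (a constant) and $f_t(\mathbf x_t)=E_q[\psi(\mathbf X_U)L(\mathbf X_U)|\mathbf X_t=\mathbf x_t]$, $1\le t\le U$. $\mathcal F_{2t-1}$ and $\mathcal F_{2t}$ are the $\sigma$-algebras generated by all random variables of the algorithm just before, respectively just after, resampling at stage $t$; for $(m-1)T<t\le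 mT$ they include all random variables generated by filters $1,\dots,m-1$. $\mathcal F_0$ is trivial. *)

theory Defs
  imports "HOL-Probability.Probability"
begin

section \<open>Hidden Markov model and importance sampling\<close>

text \<open>
  A path \<open>(x\<^sub>1, \<dots>, x\<^sub>t)\<close> is an extensional function on \<open>{1..t}\<close>, and the part of a path inside the
  \<open>m\<close>-th time block is an extensional function on \<open>{(m - 1) * T<..t}\<close>, the empty path being
  \<open>\<lambda>_. undefined\<close>. Conditional densities take the conditioning argument first: \<open>p x' x\<close> stands for
  \<open>p(x | x')\<close>, \<open>g x y\<close> for \<open>g(y | x)\<close> and \<open>q t h x\<close> for \<open>q\<^sub>t(x | h)\<close>.
\<close>

definition prob_density :: "'a measure \<Rightarrow> ('a \<Rightarrow> real) \<Rightarrow> bool" where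
  "prob_density M f \<longleftrightarrow>
     f \<in> borel_measurable M \<and> (\<forall>x\<in>space M. 0 \<le> f x) \<and> (\<integral>\<^sup>+x. ennreal (f x) \<partial>M) = 1"

text \<open>For \<open>t \<ge> 1\<close>, \<open>filt T t\<close> is the \<open>m\<close> with \<open>(m - 1) * T < t \<le> m * T\<close>, and \<open>start T t\<close> is \<open>(m - 1) * T\<close>.\<close>

definition filt :: "nat \<Rightarrow> nat \<Rightarrow> nat" where
  "filt T t = (t - 1) div T + 1"

definition start :: "nat \<Rightarrow> nat \<Rightarrow> nat" where
  "start T t = (filt T t - 1) * T"

abbreviation path_space :: "'a measure \<Rightarrow> nat set \<Rightarrow> (nat \<Rightarrow> 'a) measure" where
  "path_space \<mu> I \<equiv> Pi\<^sub>M I (\<lambda>_. \<mu>)"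

definition step_dens :: "('a \<Rightarrow> real) \<Rightarrow> ('a \<Rightarrow> 'a \<Rightarrow> real) \<Rightarrow> nat \<Rightarrow> (nat \<Rightarrow> 'a) \<Rightarrow> real" where
  "step_dens p1 p t x = (if t = 1 then p1 (x 1) else p (x (t - 1)) (x t))"

definition joint_dens ::
  "('a \<Rightarrow> real) \<Rightarrow> ('a \<Rightarrow> 'a \<Rightarrow> real) \<Rightarrow> ('a \<Rightarrow> 'y \<Rightarrow> real) \<Rightarrow> (nat \<Rightarrow> 'y) \<Rightarrow> nat \<Rightarrow> (nat \<Rightarrow> 'a) \<Rightarrow> real" where
  "joint_dens p1 p g Y U x = (\<Prod>t=1..U. step_dens p1 p t x * g (x t) (Y t))"

definition likelihood ::
  "'a measure \<Rightarrow> ('a \<Rightarrow> real) \<Rightarrow> ('a \<Rightarrow> 'a \<Rightarrow> real) \<Rightarrow> ('a \<Rightarrow> 'y \<Rightarrow> real) \<Rightarrow> (nat \<Rightarrow> 'y) \<Rightarrow> nat \<Rightarrow> ennreal" where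
  "likelihood \<mu> p1 p g Y U = (\<integral>\<^sup>+x. ennreal (joint_dens p1 p g Y U x) \<partial>path_space \<mu> {1..U})"

definition post_dens ::
  "'a measure \<Rightarrow> ('a \<Rightarrow> real) \<Rightarrow> ('a \<Rightarrow> 'a \<Rightarrow> real) \<Rightarrow> ('a \<Rightarrow> 'y \<Rightarrow> real) \<Rightarrow> (nat \<Rightarrow> 'y) \<Rightarrow> nat \<Rightarrow>
    (nat \<Rightarrow> 'a) \<Rightarrow> real" where
  "post_dens \<mu> p1 p g Y U x = joint_dens p1 p g Y U x / enn2real (likelihood \<mu> p1 p g Y U)"

definition post_mean ::
  "'a measure \<Rightarrow> ('a \<Rightarrow> real) \<Rightarrow> ('a \<Rightarrow> 'a \<Rightarrow> real) \<Rightarrow> ('a \<Rightarrow> 'y \<Rightarrow> real) \<Rightarrow> (nat \<Rightarrow> 'y) \<Rightarrow> nat \<Rightarrow>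
    ((nat \<Rightarrow> 'a) \<Rightarrow> real) \<Rightarrow> real" where
  "post_mean \<mu> p1 p g Y U \<psi> =
     (\<integral>x. \<psi> x * post_dens \<mu> p1 p g Y U x \<partial>path_space \<mu> {1..U})"

definition imp_dens :: "nat \<Rightarrow> nat \<Rightarrow> (nat \<Rightarrow> (nat \<Rightarrow> 'a) \<Rightarrow> 'a \<Rightarrow> real) \<Rightarrow> (nat \<Rightarrow> 'a) \<Rightarrow> real" where
  "imp_dens T U q x = (\<Prod>t=1..U. q t (restrict x {start T t<..<t}) (x t))"

definition imp_measure ::
  "'a measure \<Rightarrow> nat \<Rightarrow> nat \<Rightarrow> (nat \<Rightarrow> (nat \<Rightarrow> 'a) \<Rightarrow> 'a \<Rightarrow> real) \<Rightarrow> (nat \<Rightarrow> 'a) measure" where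
  "imp_measure \<mu> T U q = density (path_space \<mu> {1..U}) (\<lambda>x. ennreal (imp_dens T U q x))"

definition lik_ratio ::
  "'a measure \<Rightarrow> ('a \<Rightarrow> real) \<Rightarrow> ('a \<Rightarrow> 'a \<Rightarrow> real) \<Rightarrow> ('a \<Rightarrow> 'y \<Rightarrow> real) \<Rightarrow> (nat \<Rightarrow> 'y) \<Rightarrow> nat \<Rightarrow> nat \<Rightarrow>
    (nat \<Rightarrow> (nat \<Rightarrow> 'a) \<Rightarrow> 'a \<Rightarrow> real) \<Rightarrow> (nat \<Rightarrow> 'a) \<Rightarrow> real" where
  "lik_ratio \<mu> p1 p g Y T U q x = post_dens \<mu> p1 p g Y U x / imp_dens T U q x"

definition path_sigma :: "'a measure \<Rightarrow> nat \<Rightarrow> nat \<Rightarrow> (nat \<Rightarrow> 'a) measure" where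
  "path_sigma \<mu> U t =
     vimage_algebra (space (path_space \<mu> {1..U})) (\<lambda>x. restrict x {1..t}) (path_space \<mu> {1..t})"

text \<open>
  A function \<open>f t\<close> with \<open>f t (x\<^sub>1, \<dots>, x\<^sub>t) = E\<^sub>q[\<psi> L | X\<^sub>1 = x\<^sub>1, \<dots>, X\<^sub>t = x\<^sub>t]\<close> is determined only up to a
  null set, so this is a predicate satisfied by every choice of versions.
\<close>

definition cond_mean_versions ::
  "'a measure \<Rightarrow> ('a \<Rightarrow> real) \<Rightarrow> ('a \<Rightarrow> 'a \<Rightarrow> real) \<Rightarrow> ('a \<Rightarrow> 'y \<Rightarrow> real) \<Rightarrow> (nat \<Rightarrow> 'y) \<Rightarrow> nat \<Rightarrow> nat \<Rightarrow>
    (nat \<Rightarrow> (nat \<Rightarrow> 'a) \<Rightarrow> 'a \<Rightarrow> real) \<Rightarrow> ((nat \<Rightarrow> 'a) \<Rightarrow> real) \<Rightarrow> (nat \<Rightarrow> (nat \<Rightarrow> 'a) \<Rightarrow> real) \<Rightarrow> bool" where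
  "cond_mean_versions \<mu> p1 p g Y T U q \<psi> f \<longleftrightarrow>
     f 0 = (\<lambda>_. post_mean \<mu> p1 p g Y U \<psi>) \<and>
     (\<forall>t\<in>{1..U}.
        f t \<in> borel_measurable (path_space \<mu> {1..t}) \<and>
        (AE x in imp_measure \<mu> T U q.
           f t (restrict x {1..t}) =
           real_cond_exp (imp_measure \<mu> T U q) (path_sigma \<mu> U t)
             (\<lambda>x. \<psi> x * lik_ratio \<mu> p1 p g Y T U q x) x))"

locale hmm =
  fixes \<mu> :: "'a measure" and \<nu> :: "'y measure"
    and p1 :: "'a \<Rightarrow> real" and p :: "'a \<Rightarrow> 'a \<Rightarrow> real" and g :: "'a \<Rightarrow> 'y \<Rightarrow> real"
    and Y :: "nat \<Rightarrow> 'y" and M T :: nat and \<psi> :: "(nat \<Rightarrow> 'a) \<Rightarrow> real"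
  assumes M_pos: "1 \<le> M" and T_pos: "1 \<le> T" and U_gt_1: "1 < M * T"
    and sigma_finite: "sigma_finite_measure \<mu>"
    and init_density: "prob_density \<mu> p1"
    and trans_measurable: "(\<lambda>(x', x). p x' x) \<in> borel_measurable (\<mu> \<Otimes>\<^sub>M \<mu>)"
    and trans_density: "\<And>x'. x' \<in> space \<mu> \<Longrightarrow> prob_density \<mu> (p x')"
    and obs_measurable: "(\<lambda>(x, y). g x y) \<in> borel_measurable (\<mu> \<Otimes>\<^sub>M \<nu>)"
    and obs_density: "\<And>x. x \<in> space \<mu> \<Longrightarrow> prob_density \<nu> (g x)"
    and obs_space: "\<And>t. t \<in> {1..M * T} \<Longrightarrow> Y t \<in> space \<nu>"
    and likelihood_pos: "0 < likelihood \<mu> p1 p g Y (M * T)"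
    and likelihood_finite: "likelihood \<mu> p1 p g Y (M * T) < \<infinity>"
    and psi_measurable: "\<psi> \<in> borel_measurable (path_space \<mu> {1..M * T})"
    and psi_integrable:
      "integrable (path_space \<mu> {1..M * T}) (\<lambda>x. \<psi> x * post_dens \<mu> p1 p g Y (M * T) x)"

text \<open>
  That \<open>q t\<close> and \<open>w t\<close> do not depend on states before the current block is expressed by the domains of
  their path arguments.
\<close>

locale hmm_importance = hmm \<mu> \<nu> p1 p g Y M T \<psi>
  for \<mu> :: "'a measure" and \<nu> :: "'y measure"
    and p1 :: "'a \<Rightarrow> real" and p :: "'a \<Rightarrow> 'a \<Rightarrow> real" and g :: "'a \<Rightarrow> 'y \<Rightarrow> real"
    and Y :: "nat \<Rightarrow> 'y" and M T :: nat and \<psi> :: "(nat \<Rightarrow> 'a) \<Rightarrow> real" +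
  fixes q :: "nat \<Rightarrow> (nat \<Rightarrow> 'a) \<Rightarrow> 'a \<Rightarrow> real" and w :: "nat \<Rightarrow> (nat \<Rightarrow> 'a) \<Rightarrow> real"
  assumes q_measurable: "\<And>t. t \<in> {1..M * T} \<Longrightarrow>
      (\<lambda>(h, x). q t h x) \<in> borel_measurable (path_space \<mu> {start T t<..<t} \<Otimes>\<^sub>M \<mu>)"
    and q_density: "\<And>t h. t \<in> {1..M * T} \<Longrightarrow> h \<in> space (path_space \<mu> {start T t<..<t}) \<Longrightarrow>
      prob_density \<mu> (q t h)"
    and q_support: "\<And>t x. t \<in> {1..M * T} \<Longrightarrow> x \<in> space (path_space \<mu> {1..t}) \<Longrightarrow>
      0 < step_dens p1 p t x \<Longrightarrow> 0 < q t (restrict x {start T t<..<t}) (x t)"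
    and w_measurable: "\<And>t. t \<in> {1..M * T} \<Longrightarrow>
      w t \<in> borel_measurable (path_space \<mu> {start T t<..t})"
    and w_pos: "\<And>t h. t \<in> {1..M * T} \<Longrightarrow> h \<in> space (path_space \<mu> {start T t<..t}) \<Longrightarrow> 0 < w t h"
    and eta_finite: "\<And>t. t \<in> {1..M * T} \<Longrightarrow>
      (\<integral>\<^sup>+x. ennreal (\<Prod>u=1..t. w u (restrict x {start T u<..u})) \<partial>imp_measure \<mu> T (M * T) q) < \<infinity>"

section \<open>The particle filters\<close>

text \<open>
  The primitive random variables are the sampled states \<open>Xt t k\<close> and the resampling indices \<open>B t k\<close>
  for \<open>t \<in> {1..M * T}\<close> and \<open>k \<in> {1..K}\<close>. In filter \<open>m\<close> at time \<open>t\<close>, \<open>X_res\<close>, \<open>A_res\<close>, \<open>H_res\<close> are the path,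
  ancestor index and weight of particle \<open>k\<close> after resampling, \<open>X_prop\<close> and \<open>H_prop\<close> those before
  resampling. The values of \<open>X_res\<close>, \<open>A_res\<close>, \<open>H_res\<close> at \<open>t \<le> (m - 1) * T\<close> are the initial conventions of
  filter \<open>m\<close>.
\<close>

primrec X_res ::
  "nat \<Rightarrow> (nat \<Rightarrow> nat \<Rightarrow> 'w \<Rightarrow> 'a) \<Rightarrow> (nat \<Rightarrow> nat \<Rightarrow> 'w \<Rightarrow> nat) \<Rightarrow> nat \<Rightarrow> nat \<Rightarrow> nat \<Rightarrow> 'w \<Rightarrow> nat \<Rightarrow> 'a" where
  "X_res T Xt B m 0 k \<omega> = (\<lambda>_. undefined)"
| "X_res T Xt B m (Suc s) k \<omega> =
     (if s < (m - 1) * T then (\<lambda>_. undefined)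
      else let j = B (Suc s) k \<omega> in (X_res T Xt B m s j \<omega>)(Suc s := Xt (Suc s) j \<omega>))"

definition X_prop ::
  "nat \<Rightarrow> (nat \<Rightarrow> nat \<Rightarrow> 'w \<Rightarrow> 'a) \<Rightarrow> (nat \<Rightarrow> nat \<Rightarrow> 'w \<Rightarrow> nat) \<Rightarrow> nat \<Rightarrow> nat \<Rightarrow> nat \<Rightarrow> 'w \<Rightarrow> nat \<Rightarrow> 'a" where
  "X_prop T Xt B m t k \<omega> = (X_res T Xt B m (t - 1) k \<omega>)(t := Xt t k \<omega>)"

primrec A_res :: "nat \<Rightarrow> (nat \<Rightarrow> nat \<Rightarrow> 'w \<Rightarrow> nat) \<Rightarrow> nat \<Rightarrow> nat \<Rightarrow> nat \<Rightarrow> 'w \<Rightarrow> nat" where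
  "A_res T B m 0 k \<omega> = k"
| "A_res T B m (Suc s) k \<omega> =
     (if s < (m - 1) * T then k else A_res T B m s (B (Suc s) k \<omega>) \<omega>)"

definition w_bar ::
  "nat \<Rightarrow> nat \<Rightarrow> (nat \<Rightarrow> (nat \<Rightarrow> 'a) \<Rightarrow> real) \<Rightarrow> (nat \<Rightarrow> nat \<Rightarrow> 'w \<Rightarrow> 'a) \<Rightarrow> (nat \<Rightarrow> nat \<Rightarrow> 'w \<Rightarrow> nat) \<Rightarrow>
    nat \<Rightarrow> nat \<Rightarrow> 'w \<Rightarrow> real" where
  "w_bar T K w Xt B m t \<omega> = (\<Sum>k=1..K. w t (X_prop T Xt B m t k \<omega>)) / real K"

definition W_norm ::
  "nat \<Rightarrow> nat \<Rightarrow> (nat \<Rightarrow> (nat \<Rightarrow> 'a) \<Rightarrow> real) \<Rightarrow> (nat \<Rightarrow> nat \<Rightarrow> 'w \<Rightarrow> 'a) \<Rightarrow> (nat \<Rightarrow> nat \<Rightarrow> 'w \<Rightarrow> nat) \<Rightarrow>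
    nat \<Rightarrow> nat \<Rightarrow> nat \<Rightarrow> 'w \<Rightarrow> real" where
  "W_norm T K w Xt B m t j \<omega> =
     w t (X_prop T Xt B m t j \<omega>) / (real K * w_bar T K w Xt B m t \<omega>)"

primrec H_res ::
  "nat \<Rightarrow> nat \<Rightarrow> (nat \<Rightarrow> (nat \<Rightarrow> 'a) \<Rightarrow> real) \<Rightarrow> (nat \<Rightarrow> nat \<Rightarrow> 'w \<Rightarrow> 'a) \<Rightarrow> (nat \<Rightarrow> nat \<Rightarrow> 'w \<Rightarrow> nat) \<Rightarrow>
    nat \<Rightarrow> nat \<Rightarrow> nat \<Rightarrow> 'w \<Rightarrow> real" where
  "H_res T K w Xt B m 0 k \<omega> = 1"
| "H_res T K w Xt B m (Suc s) k \<omega> =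
     (if s < (m - 1) * T then 1
      else let j = B (Suc s) k \<omega> in
        H_res T K w Xt B m s j \<omega> / (real K * W_norm T K w Xt B m (Suc s) j \<omega>))"

definition H_prop ::
  "nat \<Rightarrow> nat \<Rightarrow> (nat \<Rightarrow> (nat \<Rightarrow> 'a) \<Rightarrow> real) \<Rightarrow> (nat \<Rightarrow> nat \<Rightarrow> 'w \<Rightarrow> 'a) \<Rightarrow> (nat \<Rightarrow> nat \<Rightarrow> 'w \<Rightarrow> nat) \<Rightarrow>
    nat \<Rightarrow> nat \<Rightarrow> nat \<Rightarrow> 'w \<Rightarrow> real" where
  "H_prop T K w Xt B m t j \<omega> =
     H_res T K w Xt B m (t - 1) j \<omega> / (real K * W_norm T K w Xt B m t j \<omega>)"

lemma res_eq_prop: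
  assumes "(m - 1) * T < t"
  shows "X_res T Xt B m t k \<omega> = X_prop T Xt B m t (B t k \<omega>) \<omega>"
    and "A_res T B m t k \<omega> = A_res T B m (t - 1) (B t k \<omega>) \<omega>"
    and "H_res T K w Xt B m t k \<omega> = H_prop T K w Xt B m t (B t k \<omega>) \<omega>"
  using assms by (cases t; simp add: X_prop_def H_prop_def Let_def)+

definition offspring :: "nat \<Rightarrow> (nat \<Rightarrow> nat \<Rightarrow> 'w \<Rightarrow> nat) \<Rightarrow> nat \<Rightarrow> nat \<Rightarrow> 'w \<Rightarrow> nat" where
  "offspring K B t k \<omega> = card {i \<in> {1..K}. B t i \<omega> = k}"

text \<open>
  \<open>history P \<mu> K Xt B r u\<close> is generated by the primitive variables of stages after \<open>r\<close> and up to step \<open>u\<close>,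
  where step \<open>2 * t - 1\<close> is the sampling and step \<open>2 * t\<close> the resampling of stage \<open>t\<close>; all other variables
  of the algorithm are functions of the primitive ones. With \<open>r = 0\<close> this is the filtration of the whole
  algorithm, with \<open>r = (m - 1) * T\<close> it is the past of filter \<open>m\<close> alone.
\<close>

definition history ::
  "'w measure \<Rightarrow> 'a measure \<Rightarrow> nat \<Rightarrow> (nat \<Rightarrow> nat \<Rightarrow> 'w \<Rightarrow> 'a) \<Rightarrow> (nat \<Rightarrow> nat \<Rightarrow> 'w \<Rightarrow> nat) \<Rightarrow>
    nat \<Rightarrow> nat \<Rightarrow> 'w measure" where
  "history P \<mu> K Xt B r u = sigma (space P)
     ({Xt s k -` S \<inter> space P | s k S. r < s \<and> 2 * s - 1 \<le> u \<and> k \<in> {1..K} \<and> S \<in> sets \<mu>} \<union>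
      {B s k -` {i} \<inter> space P | s k i. r < s \<and> 2 * s \<le> u \<and> k \<in> {1..K} \<and> i \<in> {1..K}})"

abbreviation filtr ::
  "'w measure \<Rightarrow> 'a measure \<Rightarrow> nat \<Rightarrow> (nat \<Rightarrow> nat \<Rightarrow> 'w \<Rightarrow> 'a) \<Rightarrow> (nat \<Rightarrow> nat \<Rightarrow> 'w \<Rightarrow> nat) \<Rightarrow>
    nat \<Rightarrow> 'w measure" where
  "filtr P \<mu> K Xt B u \<equiv> history P \<mu> K Xt B 0 u"

locale particle_filters = hmm_importance \<mu> \<nu> p1 p g Y M T \<psi> q w + prob_space P
  for \<mu> :: "'a measure" and \<nu> :: "'y measure"
    and p1 :: "'a \<Rightarrow> real" and p :: "'a \<Rightarrow> 'a \<Rightarrow> real" and g :: "'a \<Rightarrow> 'y \<Rightarrow> real"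
    and Y :: "nat \<Rightarrow> 'y" and M T :: nat and \<psi> :: "(nat \<Rightarrow> 'a) \<Rightarrow> real"
    and q :: "nat \<Rightarrow> (nat \<Rightarrow> 'a) \<Rightarrow> 'a \<Rightarrow> real" and w :: "nat \<Rightarrow> (nat \<Rightarrow> 'a) \<Rightarrow> real"
    and P :: "'w measure" +
  fixes K :: nat and Xt :: "nat \<Rightarrow> nat \<Rightarrow> 'w \<Rightarrow> 'a" and B :: "nat \<Rightarrow> nat \<Rightarrow> 'w \<Rightarrow> nat"
  assumes K_pos: "1 \<le> K"
    and Xt_measurable: "\<And>t k. t \<in> {1..M * T} \<Longrightarrow> k \<in> {1..K} \<Longrightarrow> Xt t k \<in> measurable P \<mu>"
    and B_measurable: "\<And>t k. t \<in> {1..M * T} \<Longrightarrow> k \<in> {1..K} \<Longrightarrow>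
      B t k \<in> measurable P (count_space {1..K})"
    and filters_indep: "indep_sets (\<lambda>m. sets (history P \<mu> K Xt B ((m - 1) * T) (2 * m * T))) {1..M}"
    and sampling: "\<And>m t S. m \<in> {1..M} \<Longrightarrow> t \<in> {(m - 1) * T<..m * T} \<Longrightarrow>
      (\<And>k. k \<in> {1..K} \<Longrightarrow> S k \<in> sets \<mu>) \<Longrightarrow>
      AE \<omega> in P.
        real_cond_exp P (history P \<mu> K Xt B ((m - 1) * T) (2 * t - 2))
          (indicator {\<omega> \<in> space P. \<forall>k\<in>{1..K}. Xt t k \<omega> \<in> S k}) \<omega> =
        (\<Prod>k=1..K. measure (density \<mu> (\<lambda>x. ennreal (q t (X_res T Xt B m (t - 1) k \<omega>) x))) (S k))"
    and resampling: "\<And>m t b. m \<in> {1..M} \<Longrightarrow> t \<in> {(m - 1) * T<..m * T} \<Longrightarrow>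
      (\<And>k. k \<in> {1..K} \<Longrightarrow> b k \<in> {1..K}) \<Longrightarrow>
      AE \<omega> in P.
        real_cond_exp P (history P \<mu> K Xt B ((m - 1) * T) (2 * t - 1))
          (indicator {\<omega> \<in> space P. \<forall>k\<in>{1..K}. B t k \<omega> = b k}) \<omega> =
        (\<Prod>k=1..K. W_norm T K w Xt B m t (b k) \<omega>)"

section \<open>Joined paths, estimator and martingale differences\<close>

abbreviation Z_set :: "nat \<Rightarrow> nat \<Rightarrow> (nat \<Rightarrow> nat) set" where
  "Z_set K m \<equiv> {1..m} \<rightarrow>\<^sub>E {1..K}"

definition join_paths ::
  "nat \<Rightarrow> (nat \<Rightarrow> nat \<Rightarrow> 'w \<Rightarrow> 'a) \<Rightarrow> (nat \<Rightarrow> nat \<Rightarrow> 'w \<Rightarrow> nat) \<Rightarrow> nat \<Rightarrow> nat \<Rightarrow> (nat \<Rightarrow> nat) \<Rightarrow> 'w \<Rightarrow>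
    (nat \<Rightarrow> 'a) \<Rightarrow> nat \<Rightarrow> 'a" where
  "join_paths T Xt B m t k \<omega> x =
     (\<lambda>u\<in>{1..t}. if u \<le> (m - 1) * T then X_res T Xt B (filt T u) (filt T u * T) (k (filt T u)) \<omega> u
                 else x u)"

text \<open>For \<open>t = (m - 1) * T\<close>, \<open>X_join\<close> and \<open>H_join\<close> only involve the filters before \<open>m\<close>.\<close>

definition X_join ::
  "nat \<Rightarrow> (nat \<Rightarrow> nat \<Rightarrow> 'w \<Rightarrow> 'a) \<Rightarrow> (nat \<Rightarrow> nat \<Rightarrow> 'w \<Rightarrow> nat) \<Rightarrow> nat \<Rightarrow> nat \<Rightarrow> (nat \<Rightarrow> nat) \<Rightarrow> 'w \<Rightarrow>
    nat \<Rightarrow> 'a" where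
  "X_join T Xt B m t k \<omega> = join_paths T Xt B m t k \<omega> (X_res T Xt B m t (k m) \<omega>)"

definition X_join_prop ::
  "nat \<Rightarrow> (nat \<Rightarrow> nat \<Rightarrow> 'w \<Rightarrow> 'a) \<Rightarrow> (nat \<Rightarrow> nat \<Rightarrow> 'w \<Rightarrow> nat) \<Rightarrow> nat \<Rightarrow> nat \<Rightarrow> (nat \<Rightarrow> nat) \<Rightarrow> 'w \<Rightarrow>
    nat \<Rightarrow> 'a" where
  "X_join_prop T Xt B m t k \<omega> = join_paths T Xt B m t k \<omega> (X_prop T Xt B m t (k m) \<omega>)"

definition H_join ::
  "nat \<Rightarrow> nat \<Rightarrow> (nat \<Rightarrow> (nat \<Rightarrow> 'a) \<Rightarrow> real) \<Rightarrow> (nat \<Rightarrow> nat \<Rightarrow> 'w \<Rightarrow> 'a) \<Rightarrow> (nat \<Rightarrow> nat \<Rightarrow> 'w \<Rightarrow> nat) \<Rightarrow>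
    nat \<Rightarrow> nat \<Rightarrow> (nat \<Rightarrow> nat) \<Rightarrow> 'w \<Rightarrow> real" where
  "H_join T K w Xt B m t k \<omega> =
     (\<Prod>n=1..m - 1. H_res T K w Xt B n (n * T) (k n) \<omega>) * H_res T K w Xt B m t (k m) \<omega>"

definition H_join_prop ::
  "nat \<Rightarrow> nat \<Rightarrow> (nat \<Rightarrow> (nat \<Rightarrow> 'a) \<Rightarrow> real) \<Rightarrow> (nat \<Rightarrow> nat \<Rightarrow> 'w \<Rightarrow> 'a) \<Rightarrow> (nat \<Rightarrow> nat \<Rightarrow> 'w \<Rightarrow> nat) \<Rightarrow>
    nat \<Rightarrow> nat \<Rightarrow> (nat \<Rightarrow> nat) \<Rightarrow> 'w \<Rightarrow> real" where
  "H_join_prop T K w Xt B m t k \<omega> =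
     (\<Prod>n=1..m - 1. H_res T K w Xt B n (n * T) (k n) \<omega>) * H_prop T K w Xt B m t (k m) \<omega>"

definition psi_hat ::
  "'a measure \<Rightarrow> ('a \<Rightarrow> real) \<Rightarrow> ('a \<Rightarrow> 'a \<Rightarrow> real) \<Rightarrow> ('a \<Rightarrow> 'y \<Rightarrow> real) \<Rightarrow> (nat \<Rightarrow> 'y) \<Rightarrow> nat \<Rightarrow> nat \<Rightarrow>
    ((nat \<Rightarrow> 'a) \<Rightarrow> real) \<Rightarrow> (nat \<Rightarrow> (nat \<Rightarrow> 'a) \<Rightarrow> 'a \<Rightarrow> real) \<Rightarrow> (nat \<Rightarrow> (nat \<Rightarrow> 'a) \<Rightarrow> real) \<Rightarrow>
    nat \<Rightarrow> (nat \<Rightarrow> nat \<Rightarrow> 'w \<Rightarrow> 'a) \<Rightarrow> (nat \<Rightarrow> nat \<Rightarrow> 'w \<Rightarrow> nat) \<Rightarrow> 'w \<Rightarrow> real" where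
  "psi_hat \<mu> p1 p g Y M T \<psi> q w K Xt B \<omega> =
     (\<Sum>k\<in>Z_set K M.
        lik_ratio \<mu> p1 p g Y T (M * T) q (X_join T Xt B M (M * T) k \<omega>)
        * \<psi> (X_join T Xt B M (M * T) k \<omega>) * H_join T K w Xt B M (M * T) k \<omega>) / real K ^ M"

definition eps_sample ::
  "nat \<Rightarrow> nat \<Rightarrow> (nat \<Rightarrow> (nat \<Rightarrow> 'a) \<Rightarrow> real) \<Rightarrow> (nat \<Rightarrow> nat \<Rightarrow> 'w \<Rightarrow> 'a) \<Rightarrow> (nat \<Rightarrow> nat \<Rightarrow> 'w \<Rightarrow> nat) \<Rightarrow>
    (nat \<Rightarrow> (nat \<Rightarrow> 'a) \<Rightarrow> real) \<Rightarrow> nat \<Rightarrow> nat \<Rightarrow> nat \<Rightarrow> 'w \<Rightarrow> real" where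
  "eps_sample T K w Xt B f m j t \<omega> =
     (\<Sum>k\<in>{k \<in> Z_set K m. A_res T B m (t - 1) (k m) \<omega> = j}.
        (f t (X_join_prop T Xt B m t k \<omega>) - f (t - 1) (X_join T Xt B m (t - 1) k \<omega>))
        * H_join T K w Xt B m (t - 1) k \<omega>) / real K ^ (m - 1)"

definition eps_resample ::
  "nat \<Rightarrow> nat \<Rightarrow> (nat \<Rightarrow> (nat \<Rightarrow> 'a) \<Rightarrow> real) \<Rightarrow> (nat \<Rightarrow> nat \<Rightarrow> 'w \<Rightarrow> 'a) \<Rightarrow> (nat \<Rightarrow> nat \<Rightarrow> 'w \<Rightarrow> nat) \<Rightarrow>
    (nat \<Rightarrow> (nat \<Rightarrow> 'a) \<Rightarrow> real) \<Rightarrow> nat \<Rightarrow> nat \<Rightarrow> nat \<Rightarrow> 'w \<Rightarrow> real" where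
  "eps_resample T K w Xt B f m j t \<omega> =
     (\<Sum>k\<in>{k \<in> Z_set K m. A_res T B m (t - 1) (k m) \<omega> = j}.
        (real (offspring K B t (k m) \<omega>) - real K * W_norm T K w Xt B m t (k m) \<omega>)
        * f t (X_join_prop T Xt B m t k \<omega>) * H_join_prop T K w Xt B m t k \<omega>) / real K ^ (m - 1)"

definition eps ::
  "nat \<Rightarrow> nat \<Rightarrow> (nat \<Rightarrow> (nat \<Rightarrow> 'a) \<Rightarrow> real) \<Rightarrow> (nat \<Rightarrow> nat \<Rightarrow> 'w \<Rightarrow> 'a) \<Rightarrow> (nat \<Rightarrow> nat \<Rightarrow> 'w \<Rightarrow> nat) \<Rightarrow>
    (nat \<Rightarrow> (nat \<Rightarrow> 'a) \<Rightarrow> real) \<Rightarrow> nat \<Rightarrow> nat \<Rightarrow> nat \<Rightarrow> 'w \<Rightarrow> real" where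
  "eps T K w Xt B f m j u =
     (if odd u then eps_sample T K w Xt B f m j ((u + 1) div 2)
      else eps_resample T K w Xt B f m j (u div 2))"

text \<open>
  The condition at the first index \<open>u\<close> of \<open>I\<close> refers to the \<open>\<sigma>\<close>-algebra \<open>F (u - 1)\<close>, so that all members of
  the sequence, including the first, are centred.
\<close>

definition martingale_differences ::
  "'w measure \<Rightarrow> (nat \<Rightarrow> 'w measure) \<Rightarrow> nat set \<Rightarrow> (nat \<Rightarrow> 'w \<Rightarrow> real) \<Rightarrow> bool" where
  "martingale_differences P F I Z \<longleftrightarrow>
     (\<forall>u\<in>I. subalgebra P (F u) \<and> subalgebra (F u) (F (u - 1)) \<and>
        Z u \<in> borel_measurable (F u) \<and> integrable P (Z u) \<and>
        (AE \<omega> in P. real_cond_exp P (F (u - 1)) (Z u) \<omega> = 0))"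

end

theory Submission
  imports Defs
begin

text \<open>
  Fix one multi-index \<open>k\<close>. Sampling replaces a function of the path by its average under \<open>q\<close>, and
  resampling with the weights \<open>W\<close> is undone by the factors \<open>1 / (K * W)\<close> in \<open>H\<close>; hence by induction over
  the stages \<open>E[\<phi>(X) * H] = E\<^sub>q[\<phi>]\<close> for every nonnegative \<open>\<phi>\<close>. This change of measure makes all terms
  integrable although \<open>H\<close> is unbounded, and, as \<open>H > 0\<close>, it carries almost sure identities between the
  versions \<open>f t\<close> from the importance law to the joined paths. Conditionally on the past,
  sampling turns \<open>f t\<close> into \<open>f (t - 1)\<close>, and the expected number of offspring is \<open>K * W\<close>; so both kinds of
  increments are centred. Summed over the ancestors \<open>j\<close> they telescope, since weighting by the number of
  offspring is the same as summing over the resampled indices.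
\<close>

text \<open>The sampling and resampling hypotheses condition a filter on its own past only, whereas
  the filtration also contains all earlier filters. Independence of the filters closes this gap on
  the level of events, in \<open>real_cond_exp_indep_join\<close>. The second obstacle is that the
  integrands depend jointly on the past and on the new state, so the conditional probabilities of
  the events \<open>Xt t k \<omega> \<in> S\<close> do not suffice as they stand. A \<pi>-system
  argument upgrades them to the joint law of past and new state, a density on a product space, and
  Fubini then does the work of a regular conditional distribution. The third is a threatening
  circle: centring needs integrability, but integrability of a term with factor \<open>H\<close>
  comes out of the change of measure. The latter is therefore proved for
  \<open>ennreal\<close>-valued functions, where nothing has to be integrable beforehand.\<close>

declare One_nat_def[simp del]

section \<open>Sums over joined indices\<close>

text \<open>Splits off the last coordinate, the one that belongs to the current filter; resampling
  changes this coordinate only.\<close>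

lemma sum_Z_set_Suc:
  fixes h :: "(nat \<Rightarrow> nat) \<Rightarrow> 'b::comm_monoid_add"
  shows "(\<Sum>k\<in>Z_set K (Suc n). h k) = (\<Sum>k\<in>Z_set K n. \<Sum>i=1..K. h (k(Suc n := i)))"
proof -
  have "{1..Suc n} = insert (Suc n) {1..n}" by auto
  then have "(\<Sum>k\<in>Z_set K (Suc n). h k) = (\<Sum>k\<in>(\<lambda>(y, g). g(Suc n := y)) ` ({1..K} \<times> Z_set K n). h k)"
    by (simp only: PiE_insert_eq)
  also have "\<dots> = (\<Sum>(i, k)\<in>{1..K} \<times> Z_set K n. h (k(Suc n := i)))"
    by (subst sum.reindex[OF inj_combinator]) (auto simp: case_prod_beta)
  also have "\<dots> = (\<Sum>i=1..K. \<Sum>k\<in>Z_set K n. h (k(Suc n := i)))"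
    by (simp add: sum.cartesian_product)
  also have "\<dots> = (\<Sum>k\<in>Z_set K n. \<Sum>i=1..K. h (k(Suc n := i)))"
    by (rule sum.swap)
  finally show ?thesis .
qed

text \<open>Each index \<open>j\<close> is the image under \<open>b\<close> of as many
  \<open>i\<close> as its fibre has elements. With \<open>b = (\<lambda>i. B t i \<omega>)\<close>
  these cardinalities are the offspring numbers.\<close>

lemma sum_Z_set_resample:
  fixes a :: "(nat \<Rightarrow> nat) \<Rightarrow> 'b::comm_semiring_1"
  assumes "1 \<le> m" and b: "\<And>i. i \<in> {1..K} \<Longrightarrow> b i \<in> {1..K}"
  shows "(\<Sum>k\<in>Z_set K m. a (k(m := b (k m)))) =
    (\<Sum>k\<in>Z_set K m. of_nat (card {i \<in> {1..K}. b i = k m}) * a k)"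
proof -
  obtain n where m: "m = Suc n" using assms(1) by (cases m) auto
  have "(\<Sum>i=1..K. a (k(Suc n := b i))) =
      (\<Sum>j=1..K. of_nat (card {i \<in> {1..K}. b i = j}) * a (k(Suc n := j)))" for k
    by (rule sum_fun_comp[where f = "\<lambda>j. a (k(Suc n := j))"]) (use b in auto)
  then show ?thesis
    unfolding m sum_Z_set_Suc by simp
qed

text \<open>Used with the ancestor index as label \<open>l\<close>: summing over all ancestors
  \<open>j\<close> removes the restriction on \<open>k\<close>.\<close>

lemma sum_partition_label:
  fixes h :: "'b \<Rightarrow> real"
  assumes "finite A" and "\<And>k. k \<in> A \<Longrightarrow> l k \<in> {1..K::nat}"
  shows "(\<Sum>j=1..K. \<Sum>k\<in>{k \<in> A. l k = j}. h k) = (\<Sum>k\<in>A. h k)"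
  by (rule sum.group) (use assms in auto)

section \<open>Conditioning in the presence of independent information\<close>

text \<open>Information in \<open>G1\<close> that is independent of \<open>H\<close> does not change
  the conditional probability of an event of \<open>H\<close>. On sets \<open>A1 \<inter> A2\<close>
  with \<open>A1\<close> in \<open>G1\<close> and \<open>A2\<close> in \<open>G2\<close> the factor
  for \<open>A1\<close> splits off by independence, and a \<pi>-\<lambda> argument extends the
  integral identity to \<open>G\<close>.\<close>

lemma (in prob_space) real_cond_exp_indep_join:
  assumes G: "subalgebra M G" "sets G \<subseteq> sigma_sets (space M) (sets G1 \<union> sets G2)"
    and G2: "subalgebra G G2" "sets G2 \<subseteq> sets H"
    and G1: "space G1 = space M"
    and indep: "indep_set (sets G1) (sets H)"
    and E: "E \<in> sets H"
  shows "AE x in M. real_cond_exp M G (indicator E) x = real_cond_exp M G2 (indicator E) x"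
proof -
  have MG2: "subalgebra M G2" using G G2 by (auto simp: subalgebra_def)
  interpret sG: finite_measure_subalgebra M G by unfold_locales (rule G)
  interpret sG2: finite_measure_subalgebra M G2 by unfold_locales (rule MG2)
  have G1M: "sets G1 \<subseteq> sets M" and HM: "sets H \<subseteq> sets M"
    using indep_setD_ev1[OF indep] indep_setD_ev2[OF indep] by auto
  have spG2: "space G2 = space M" using MG2 by (simp add: subalgebra_def)
  have EM[measurable]: "E \<in> sets M" using E HM by auto
  define h where "h = real_cond_exp M G2 (indicator E)"
  have iE: "integrable M (indicator E :: 'a \<Rightarrow> real)"
    by (simp add: integrable_indicator_iff less_top[symmetric])
  have ih[simp]: "integrable M h" unfolding h_def by (rule sG2.real_cond_exp_int(1)[OF iE])
  have hG2[measurable]: "h \<in> borel_measurable G2" unfolding h_def by simp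
  \<comment> \<open>The union of \<open>G1\<close> and \<open>G2\<close> need not be closed under
    intersection; the intersections are, and they still contain both.\<close>
  define C where "C = {A \<inter> A' | A A'. A \<in> sets G1 \<and> A' \<in> sets G2}"
  have Int_stable: "Int_stable C"
  proof (rule Int_stableI)
    fix a b assume "a \<in> C" "b \<in> C"
    then obtain A1 A2 B1 B2 where "a = A1 \<inter> A2" "b = B1 \<inter> B2" "A1 \<in> sets G1" "B1 \<in> sets G1"
      "A2 \<in> sets G2" "B2 \<in> sets G2" unfolding C_def by auto
    moreover from this have "a \<inter> b = (A1 \<inter> B1) \<inter> (A2 \<inter> B2)" by auto
    ultimately show "a \<inter> b \<in> C" unfolding C_def by blast
  qed
  have CM: "C \<subseteq> sets M" using G1M MG2 unfolding C_def subalgebra_def by auto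
  then have Cpow: "C \<subseteq> Pow (space M)" using sets.sets_into_space by blast
  have "sets G1 \<union> sets G2 \<subseteq> C"
  proof
    fix A assume "A \<in> sets G1 \<union> sets G2"
    then show "A \<in> C"
    proof
      assume "A \<in> sets G1"
      moreover from this have "A = A \<inter> space G2" using sets.sets_into_space[of A G1] spG2 G1 by auto
      ultimately show ?thesis unfolding C_def by blast
    next
      assume "A \<in> sets G2"
      moreover from this have "A = space G1 \<inter> A" using sets.sets_into_space[of A G2] spG2 G1 by auto
      ultimately show ?thesis unfolding C_def by blast
    qed
  qed
  then have sG: "sets G \<subseteq> sigma_sets (space M) C"
    using G(2) sigma_sets_mono'[of "sets G1 \<union> sets G2" C "space M"] by auto
  have base: "(\<integral>x\<in>A. indicator E x \<partial>M) = (\<integral>x\<in>A. h x \<partial>M)" if AC: "A \<in> C" for A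
  proof -
    obtain A1 A2 where A: "A = A1 \<inter> A2" and A1: "A1 \<in> sets G1" and A2: "A2 \<in> sets G2"
      using AC unfolding C_def by auto
    have [measurable]: "A1 \<in> sets M" "A2 \<in> sets M"
      using A1 A2 G1M G2(2) HM by auto
    have A2H: "A2 \<inter> E \<in> sets H" using A2 E G2(2) by auto
    have hA: "(\<lambda>x. indicator A2 x * h x) \<in> borel_measurable G2"
      using A2 by measurable
    \<comment> \<open>The second variable is \<open>G2\<close>-measurable, hence
      \<open>H\<close>-measurable, although it involves both \<open>A2\<close> and the conditional
      probability \<open>h\<close>.\<close>
    have "indep_var borel (indicator A1 :: 'a \<Rightarrow> real) borel (\<lambda>x. indicator A2 x * h x)"
    proof -
      have "sigma_sets (space M) {(indicator A1 :: 'a \<Rightarrow> real) -` S \<inter> space M |S. S \<in> sets borel} \<subseteq> sets G1"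
      proof (subst G1[symmetric], rule sets.sigma_sets_subset, safe)
        fix S :: "real set" assume S: "S \<in> sets borel"
        have "(indicator A1 :: 'a \<Rightarrow> real) \<in> borel_measurable G1" using A1 by measurable
        from measurable_sets[OF this S] show "indicator A1 -` S \<inter> space M \<in> sets G1" by (simp add: G1)
      qed
      moreover have "sigma_sets (space M) {(\<lambda>x. indicator A2 x * h x) -` S \<inter> space M |S. S \<in> sets borel} \<subseteq> sets H"
      proof -
        have "sigma_sets (space M) {(\<lambda>x. indicator A2 x * h x) -` S \<inter> space M |S. S \<in> sets borel} \<subseteq> sets G2"
          using measurable_sets[OF hA]
          by (subst spG2[symmetric], intro sets.sigma_sets_subset) (auto simp: spG2)
        then show ?thesis using G2(2) by auto
      qed
      ultimately have "indep_set (sigma_sets (space M) {(indicator A1 :: 'a \<Rightarrow> real) -` S \<inter> space M |S. S \<in> sets borel})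
         (sigma_sets (space M) {(\<lambda>x. indicator A2 x * h x) -` S \<inter> space M |S. S \<in> sets borel})"
        using indep unfolding indep_set_def
        by (elim indep_sets_mono_sets) (auto split: bool.split)
      then show ?thesis
        unfolding indep_var_eq using measurable_from_subalg[OF MG2 hA] by auto
    qed
    then have "(\<integral>x. indicator A1 x * (indicator A2 x * h x) \<partial>M) =
        (\<integral>x. indicator A1 x \<partial>M) * (\<integral>x. indicator A2 x * h x \<partial>M)"
      by (rule indep_var_lebesgue_integral)
         (auto intro: integrable_mult_indicator[where 'b = real, simplified] simp: integrable_indicator_iff less_top[symmetric])
    also have "(\<integral>x. indicator A2 x * h x \<partial>M) = (\<integral>x\<in>A2. h x \<partial>M)"
      by (simp add: set_lebesgue_integral_def)
    also have "\<dots> = (\<integral>x\<in>A2. indicator E x \<partial>M)"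
      unfolding h_def by (rule sG2.real_cond_exp_intA[OF iE A2, symmetric])
    also have "\<dots> = prob (A2 \<inter> E)"
      unfolding set_lebesgue_integral_def by (simp flip: indicator_inter_arith)
    also have "(\<integral>x. indicator A1 x \<partial>M) = prob A1" by simp
    also have "prob A1 * prob (A2 \<inter> E) = prob (A1 \<inter> (A2 \<inter> E))"
      by (rule indep_setD[OF indep A1 A2H, symmetric])
    also have "\<dots> = (\<integral>x\<in>A. indicator E x \<partial>M)"
      unfolding set_lebesgue_integral_def A by (simp flip: indicator_inter_arith add: Int_assoc)
    finally show ?thesis
      unfolding set_lebesgue_integral_def A by (simp add: indicator_inter_arith mult.assoc)
  qed
  have total: "(\<integral>x. indicator E x \<partial>M) = (\<integral>x. h x \<partial>M)"
    unfolding h_def by (rule sG2.real_cond_exp_int(2)[OF iE, symmetric])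
  have CsM: "A \<in> sets M" if "A \<in> sigma_sets (space M) C" for A
    using that sets.sigma_sets_subset[OF CM] by auto
  have si: "set_integrable M A u" if "A \<in> sigma_sets (space M) C" "integrable M u" for A and u :: "'a \<Rightarrow> real"
    unfolding set_integrable_def using integrable_mult_indicator[OF CsM[OF that(1)] that(2)] by simp
  have all: "(\<integral>x\<in>A. indicator E x \<partial>M) = (\<integral>x\<in>A. h x \<partial>M)" if "A \<in> sigma_sets (space M) C" for A
    using Int_stable Cpow that
  proof (induction rule: sigma_sets_induct_disjoint)
    case (basic A) then show ?case by (rule base)
  next
    case empty then show ?case by (simp add: set_lebesgue_integral_def)
  next
    case (compl A)
    have *: "(\<integral>x\<in>space M - A. u x \<partial>M) = (\<integral>x. u x \<partial>M) - (\<integral>x\<in>A. u x \<partial>M)"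
      if u: "integrable M u" for u :: "'a \<Rightarrow> real"
    proof -
      have "(\<integral>x\<in>space M - A. u x \<partial>M) = (\<integral>x. u x - indicator A x * u x \<partial>M)"
        unfolding set_lebesgue_integral_def
        by (intro Bochner_Integration.integral_cong) (auto simp: indicator_def)
      also have "\<dots> = (\<integral>x. u x \<partial>M) - (\<integral>x\<in>A. u x \<partial>M)"
        using si[OF compl(1) u] u unfolding set_lebesgue_integral_def set_integrable_def
        by (simp add: Bochner_Integration.integral_diff)
      finally show ?thesis .
    qed
    show ?case by (simp only: *[OF iE] *[OF ih] total compl)
  next
    case (union A)
    have *: "(\<integral>x\<in>(\<Union>i. A i). u x \<partial>M) = (\<Sum>i. \<integral>x\<in>A i. u x \<partial>M)" if u: "integrable M u" for u :: "'a \<Rightarrow> real"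
    proof (rule lebesgue_integral_countable_add)
      show "A i \<in> sets M" for i using union(2) CsM by auto
      show "i \<noteq> j \<Longrightarrow> A i \<inter> A j = {}" for i j using union(1) by (auto simp: disjoint_family_on_def)
      show "set_integrable M (\<Union> (range A)) u"
        using union(2) by (intro si u sigma_sets.Union) auto
    qed
    show ?case by (simp only: *[OF iE] *[OF ih] union)
  qed
  have "AE x in M. real_cond_exp M G (indicator E) x = h x"
  proof (rule sG.real_cond_exp_charact)
    show "(\<integral>x\<in>A. indicator E x \<partial>M) = (\<integral>x\<in>A. h x \<partial>M)" if "A \<in> sets G" for A
      using all sG that by blast
    show "h \<in> borel_measurable G" by (rule measurable_from_subalg[OF G2(1) hG2])
  qed (use iE in auto)
  then show ?thesis unfolding h_def .
qed

section \<open>The importance law of a path\<close>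

context hmm_importance
begin

abbreviation U :: nat where "U \<equiv> M * T"

abbreviation paths :: "nat \<Rightarrow> (nat \<Rightarrow> 'a) measure" where "paths t \<equiv> path_space \<mu> {1..t}"

text \<open>Built with horizon \<open>t\<close> and its own density, not as a marginal of the law of
  the full path; \<open>distr_law\<close> shows that the two agree.\<close>

abbreviation law :: "nat \<Rightarrow> (nat \<Rightarrow> 'a) measure" where "law t \<equiv> imp_measure \<mu> T t q"

text \<open>The next importance density as a kernel on whole paths of length \<open>t\<close>. The
  restriction forgets earlier blocks, so recursions over \<open>t\<close> can ignore block
  boundaries; at the first stage of a block it leaves the empty path.\<close>

definition q_step :: "nat \<Rightarrow> (nat \<Rightarrow> 'a) \<Rightarrow> 'a \<Rightarrow> real" where
  "q_step t h x = q (Suc t) (restrict h {start T (Suc t)<..<Suc t}) x"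

sublocale \<mu>: sigma_finite_measure \<mu> by (rule sigma_finite)

sublocale prod_\<mu>: product_sigma_finite "\<lambda>_::nat. \<mu>" by unfold_locales

lemma q_step_measurable[measurable]:
  assumes "Suc t \<le> U"
  shows "(\<lambda>(h, x). q_step t h x) \<in> borel_measurable (paths t \<Otimes>\<^sub>M \<mu>)"
proof -
  have [measurable]: "(\<lambda>(h, x). q (Suc t) h x) \<in>
      borel_measurable (path_space \<mu> {start T (Suc t)<..<Suc t} \<Otimes>\<^sub>M \<mu>)"
    by (rule q_measurable) (use assms in auto)
  have [measurable]: "(\<lambda>h. restrict h {start T (Suc t)<..<Suc t}) \<in>
      measurable (paths t) (path_space \<mu> {start T (Suc t)<..<Suc t})"
    by (rule measurable_restrict_subset) auto
  show ?thesis unfolding q_step_def by measurable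
qed

lemma restrict_in_past:
  "h \<in> space (paths t) \<Longrightarrow>
    restrict h {start T (Suc t)<..<Suc t} \<in> space (path_space \<mu> {start T (Suc t)<..<Suc t})"
  by (auto simp: space_PiM)

lemma q_step_density:
  assumes "Suc t \<le> U" "h \<in> space (paths t)"
  shows "prob_density \<mu> (q_step t h)"
  unfolding q_step_def[abs_def]
  by (rule q_density) (use assms restrict_in_past in auto)

lemma q_step_nonneg: "Suc t \<le> U \<Longrightarrow> h \<in> space (paths t) \<Longrightarrow> x \<in> space \<mu> \<Longrightarrow> 0 \<le> q_step t h x"
  using q_step_density unfolding prob_density_def by auto

lemma q_step_mass: "Suc t \<le> U \<Longrightarrow> h \<in> space (paths t) \<Longrightarrow> (\<integral>\<^sup>+x. ennreal (q_step t h x) \<partial>\<mu>) = 1"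
  using q_step_density unfolding prob_density_def by auto

lemma upd_in_paths: "h \<in> space (paths t) \<Longrightarrow> x \<in> space \<mu> \<Longrightarrow> h(Suc t := x) \<in> space (paths (Suc t))"
  by (auto simp: space_PiM PiE_iff extensional_def)

lemma upd_measurable[measurable]:
  "(\<lambda>(h, x). h(Suc t := x)) \<in> measurable (paths t \<Otimes>\<^sub>M \<mu>) (paths (Suc t))"
proof -
  have "{1..Suc t} = insert (Suc t) {1..t}" by auto
  then show ?thesis using measurable_add_dim[of "Suc t" "{1..t}" "\<lambda>_. \<mu>"] by simp
qed

lemma imp_dens_upd: "imp_dens T (Suc t) q (h(Suc t := x)) = imp_dens T t q h * q_step t h x"
proof -
  have "(\<Prod>s=1..t. q s (restrict (h(Suc t := x)) {start T s<..<s}) ((h(Suc t := x)) s)) =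
      (\<Prod>s=1..t. q s (restrict h {start T s<..<s}) (h s))"
    by (rule prod.cong) (auto intro!: arg_cong2[where f = "q _"])
  moreover have "restrict (h(Suc t := x)) {start T (Suc t)<..<Suc t} =
      restrict h {start T (Suc t)<..<Suc t}"
    by auto
  ultimately show ?thesis
    unfolding imp_dens_def q_step_def by simp
qed

lemma imp_dens_factor_measurable:
  assumes "s \<in> {1..t}" "t \<le> U"
  shows "(\<lambda>x. q s (restrict x {start T s<..<s}) (x s)) \<in> borel_measurable (paths t)"
proof -
  have [measurable]: "(\<lambda>(h, x). q s h x) \<in>
      borel_measurable (path_space \<mu> {start T s<..<s} \<Otimes>\<^sub>M \<mu>)"
    by (rule q_measurable) (use assms in auto)
  have [measurable]: "(\<lambda>h. restrict h {start T s<..<s}) \<in>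
      measurable (paths t) (path_space \<mu> {start T s<..<s})"
    by (rule measurable_restrict_subset) (use assms in auto)
  have [measurable]: "(\<lambda>h. h s) \<in> measurable (paths t) \<mu>"
    by (rule measurable_component_singleton) (rule assms)
  show ?thesis by measurable
qed

lemma imp_dens_measurable[measurable]: "t \<le> U \<Longrightarrow> imp_dens T t q \<in> borel_measurable (paths t)"
  unfolding imp_dens_def[abs_def] by (intro borel_measurable_prod imp_dens_factor_measurable) auto

lemma imp_dens_nonneg:
  assumes "t \<le> U" "x \<in> space (paths t)"
  shows "0 \<le> imp_dens T t q x"
  unfolding imp_dens_def
proof (rule prod_nonneg)
  fix s assume s: "s \<in> {1..t}"
  have "prob_density \<mu> (q s (restrict x {start T s<..<s}))"
    by (rule q_density) (use s assms in \<open>auto simp: space_PiM PiE_iff\<close>)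
  moreover have "x s \<in> space \<mu>" using s assms by (auto simp: space_PiM)
  ultimately show "0 \<le> q s (restrict x {start T s<..<s}) (x s)"
    by (auto simp: prob_density_def)
qed

lemma space_law[simp]: "space (law t) = space (paths t)"
  by (simp add: imp_measure_def)

lemma sets_law[simp, measurable_cong]: "sets (law t) = sets (paths t)"
  by (simp add: imp_measure_def)

text \<open>Tonelli in the last coordinate, since the density factors by
  \<open>imp_dens_upd\<close>. The particle system is later shown to follow the same
  recursion.\<close>

lemma nn_integral_law_Suc:
  assumes t: "Suc t \<le> U" and \<phi>[measurable]: "\<phi> \<in> borel_measurable (paths (Suc t))"
  shows "(\<integral>\<^sup>+x. \<phi> x \<partial>law (Suc t)) =
    (\<integral>\<^sup>+h. (\<integral>\<^sup>+x. ennreal (q_step t h x) * \<phi> (h(Suc t := x)) \<partial>\<mu>) \<partial>law t)"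
proof -
  note [measurable] = q_step_measurable[OF t] imp_dens_measurable[OF t] imp_dens_measurable[of t]
  have tU: "t \<le> U" using t by simp
  note [measurable] = imp_dens_measurable[OF this]
  have ins: "{1..Suc t} = insert (Suc t) {1..t}" by auto
  have "(\<integral>\<^sup>+x. \<phi> x \<partial>law (Suc t)) = (\<integral>\<^sup>+x. ennreal (imp_dens T (Suc t) q x) * \<phi> x \<partial>paths (Suc t))"
    unfolding imp_measure_def by (rule nn_integral_density) auto
  also have "\<dots> = (\<integral>\<^sup>+h. (\<integral>\<^sup>+x. ennreal (imp_dens T (Suc t) q (h(Suc t := x))) * \<phi> (h(Suc t := x)) \<partial>\<mu>) \<partial>paths t)"
    unfolding ins by (rule prod_\<mu>.product_nn_integral_insert) (simp_all flip: ins)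
  also have "\<dots> = (\<integral>\<^sup>+h. ennreal (imp_dens T t q h) *
      (\<integral>\<^sup>+x. ennreal (q_step t h x) * \<phi> (h(Suc t := x)) \<partial>\<mu>) \<partial>paths t)"
  proof (rule nn_integral_cong)
    fix h assume h: "h \<in> space (paths t)"
    have "(\<integral>\<^sup>+x. ennreal (imp_dens T (Suc t) q (h(Suc t := x))) * \<phi> (h(Suc t := x)) \<partial>\<mu>) =
        (\<integral>\<^sup>+x. ennreal (imp_dens T t q h) * (ennreal (q_step t h x) * \<phi> (h(Suc t := x))) \<partial>\<mu>)"
      by (rule nn_integral_cong)
         (simp add: imp_dens_upd ennreal_mult imp_dens_nonneg[OF tU h] q_step_nonneg[OF t h] mult.assoc)
    also have "\<dots> = ennreal (imp_dens T t q h) * (\<integral>\<^sup>+x. ennreal (q_step t h x) * \<phi> (h(Suc t := x)) \<partial>\<mu>)"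
      using h by (intro nn_integral_cmult) measurable
    finally show "(\<integral>\<^sup>+x. ennreal (imp_dens T (Suc t) q (h(Suc t := x))) * \<phi> (h(Suc t := x)) \<partial>\<mu>) = \<dots>" .
  qed
  also have "\<dots> = (\<integral>\<^sup>+h. (\<integral>\<^sup>+x. ennreal (q_step t h x) * \<phi> (h(Suc t := x)) \<partial>\<mu>) \<partial>law t)"
    unfolding imp_measure_def by (rule nn_integral_density[symmetric]) auto
  finally show ?thesis .
qed

lemma nn_integral_law_marginal:
  assumes "t \<le> s" "s \<le> U" and \<phi>[measurable]: "\<phi> \<in> borel_measurable (paths t)"
  shows "(\<integral>\<^sup>+x. \<phi> (restrict x {1..t}) \<partial>law s) = (\<integral>\<^sup>+x. \<phi> x \<partial>law t)"
  using assms(1,2)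
proof (induction s rule: dec_induct)
  case base
  show ?case
    by (rule nn_integral_cong) (auto simp: space_PiM PiE_restrict)
next
  case (step s)
  have res: "(\<lambda>x. restrict x {1..t}) \<in> measurable (paths s') (paths t)" if "t \<le> s'" for s'
    by (rule measurable_restrict_subset) (use that in auto)
  have "(\<integral>\<^sup>+x. \<phi> (restrict x {1..t}) \<partial>law (Suc s)) =
      (\<integral>\<^sup>+h. (\<integral>\<^sup>+x. ennreal (q_step s h x) * \<phi> (restrict (h(Suc s := x)) {1..t}) \<partial>\<mu>) \<partial>law s)"
    by (rule nn_integral_law_Suc[OF step.prems]) (intro measurable_compose[OF res \<phi>], use step in simp)
  also have "\<dots> = (\<integral>\<^sup>+h. \<phi> (restrict h {1..t}) \<partial>law s)"
  proof (rule nn_integral_cong)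
    fix h assume "h \<in> space (law s)"
    then have h: "h \<in> space (paths s)" by simp
    have "restrict (h(Suc s := x)) {1..t} = restrict h {1..t}" for x using step by auto
    then show "(\<integral>\<^sup>+x. ennreal (q_step s h x) * \<phi> (restrict (h(Suc s := x)) {1..t}) \<partial>\<mu>) =
        \<phi> (restrict h {1..t})"
      using q_step_density[OF step.prems h] q_step_mass[OF step.prems h]
      by (simp add: nn_integral_multc prob_density_def)
  qed
  also have "\<dots> = (\<integral>\<^sup>+x. \<phi> x \<partial>law t)" by (rule step.IH) (use step.prems in simp)
  finally show ?case .
qed

lemma prob_space_law: "t \<le> U \<Longrightarrow> prob_space (law t)"
proof (induction t)
  case 0
  have "emeasure (law 0) (space (law 0)) = (\<integral>\<^sup>+x. 1 \<partial>law 0)" by simp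
  also have "\<dots> = (\<integral>\<^sup>+x. 1 \<partial>paths 0)"
    unfolding imp_measure_def by (subst nn_integral_density) (auto simp: imp_dens_def)
  also have "\<dots> = 1" using prod_\<mu>.nn_integral_empty[of "\<lambda>_. 1"] by simp
  finally show ?case by (rule prob_spaceI)
next
  case (Suc t)
  then interpret prob_space "law t" by simp
  have "emeasure (law (Suc t)) (space (law (Suc t))) = (\<integral>\<^sup>+x. 1 \<partial>law (Suc t))" by simp
  also have "\<dots> = (\<integral>\<^sup>+x. 1 \<partial>law t)"
    using nn_integral_law_marginal[of t "Suc t" "\<lambda>_. 1"] Suc by simp
  also have "\<dots> = 1" using emeasure_space_1 by simp
  finally show ?case by (rule prob_spaceI)
qed

lemma distr_law:
  assumes "t \<le> s" "s \<le> U"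
  shows "distr (law s) (paths t) (\<lambda>x. restrict x {1..t}) = law t"
proof (rule measure_eqI)
  have [measurable]: "(\<lambda>x. restrict x {1..t}) \<in> measurable (law s) (paths t)"
    unfolding measurable_cong_sets[OF sets_law refl]
    by (rule measurable_restrict_subset) (use assms in auto)
  fix A assume "A \<in> sets (distr (law s) (paths t) (\<lambda>x. restrict x {1..t}))"
  then have A[measurable]: "A \<in> sets (paths t)" by simp
  have "emeasure (distr (law s) (paths t) (\<lambda>x. restrict x {1..t})) A = (\<integral>\<^sup>+x. indicator A (restrict x {1..t}) \<partial>law s)"
    by (simp add: emeasure_distr nn_integral_distr flip: nn_integral_indicator)
  also have "\<dots> = emeasure (law t) A"
    by (subst nn_integral_law_marginal[OF assms]) auto
  finally show "emeasure (distr (law s) (paths t) (\<lambda>x. restrict x {1..t})) A = emeasure (law t) A" .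
qed simp

end

section \<open>Versions of the conditional means\<close>

text \<open>Fubini for signed functions under a density on a product. It serves both the importance
  law of a path and the joint law of past and sampled state.\<close>

lemma (in pair_sigma_finite) integral_density_pair:
  fixes v :: "'a \<times> 'b \<Rightarrow> real" and c :: "'a \<times> 'b \<Rightarrow> real"
  assumes c: "c \<in> borel_measurable (M1 \<Otimes>\<^sub>M M2)" "\<And>z. z \<in> space (M1 \<Otimes>\<^sub>M M2) \<Longrightarrow> 0 \<le> c z"
    and v: "integrable (density (M1 \<Otimes>\<^sub>M M2) (\<lambda>z. ennreal (c z))) v"
  shows "AE x in M1. integrable M2 (\<lambda>y. c (x, y) * v (x, y))"
    and "integrable M1 (\<lambda>x. \<integral>y. c (x, y) * v (x, y) \<partial>M2)"
    and "(\<integral>z. v z \<partial>density (M1 \<Otimes>\<^sub>M M2) (\<lambda>z. ennreal (c z))) =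
      (\<integral>x. (\<integral>y. c (x, y) * v (x, y) \<partial>M2) \<partial>M1)"
proof -
  have vm: "v \<in> borel_measurable (M1 \<Otimes>\<^sub>M M2)"
    using borel_measurable_integrable[OF v] by simp
  have i: "integrable (M1 \<Otimes>\<^sub>M M2) (\<lambda>z. c z * v z)"
    using v by (subst (asm) integrable_density) (use c vm in auto)
  show "AE x in M1. integrable M2 (\<lambda>y. c (x, y) * v (x, y))"
    using AE_integrable_fst'[OF i] by simp
  show "integrable M1 (\<lambda>x. \<integral>y. c (x, y) * v (x, y) \<partial>M2)"
    using integrable_fst'[OF i] by simp
  have "(\<integral>z. v z \<partial>density (M1 \<Otimes>\<^sub>M M2) (\<lambda>z. ennreal (c z))) = (\<integral>z. c z * v z \<partial>(M1 \<Otimes>\<^sub>M M2))"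
    by (subst integral_density) (use c vm in auto)
  then show "(\<integral>z. v z \<partial>density (M1 \<Otimes>\<^sub>M M2) (\<lambda>z. ennreal (c z))) =
      (\<integral>x. (\<integral>y. c (x, y) * v (x, y) \<partial>M2) \<partial>M1)"
    using integral_fst'[OF i] by simp
qed

context hmm_importance
begin

text \<open>Presents one step as the image of a density on a product space, the form in which signed
  functions can be handled by \<open>integral_density_pair\<close>.\<close>

lemma law_Suc_eq_distr:
  assumes t: "Suc t \<le> U"
  shows "law (Suc t) = distr (density (law t \<Otimes>\<^sub>M \<mu>) (\<lambda>(h, x). ennreal (q_step t h x)))
    (paths (Suc t)) (\<lambda>(h, x). h(Suc t := x))"
    (is "_ = distr ?D _ ?f")
proof (rule measure_eqI)
  note [measurable] = q_step_measurable[OF t]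
  have f[measurable]: "?f \<in> measurable (law t \<Otimes>\<^sub>M \<mu>) (paths (Suc t))" by measurable
  fix A assume "A \<in> sets (law (Suc t))"
  then have A[measurable]: "A \<in> sets (paths (Suc t))" by simp
  have "emeasure (law (Suc t)) A =
      (\<integral>\<^sup>+h. (\<integral>\<^sup>+x. ennreal (q_step t h x) * indicator A (h(Suc t := x)) \<partial>\<mu>) \<partial>law t)"
    by (subst nn_integral_indicator[symmetric], simp) (rule nn_integral_law_Suc[OF t], simp)
  also have "\<dots> = (\<integral>\<^sup>+z. (case z of (h, x) \<Rightarrow> ennreal (q_step t h x) * indicator A (h(Suc t := x))) \<partial>(law t \<Otimes>\<^sub>M \<mu>))"
    by (subst \<mu>.nn_integral_fst[symmetric]) auto
  also have "\<dots> = (\<integral>\<^sup>+z. (case z of (h, x) \<Rightarrow> ennreal (q_step t h x)) * indicator A (?f z) \<partial>(law t \<Otimes>\<^sub>M \<mu>))"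
    by (simp add: case_prod_beta)
  also have "\<dots> = (\<integral>\<^sup>+z. indicator A (?f z) \<partial>?D)"
    by (subst nn_integral_density) auto
  also have "\<dots> = emeasure (distr ?D (paths (Suc t)) ?f) A"
    by (subst nn_integral_indicator[symmetric], simp) (subst nn_integral_distr, auto)
  finally show "emeasure (law (Suc t)) A = emeasure (distr ?D (paths (Suc t)) ?f) A" .
qed simp

lemma integral_law_Suc:
  fixes v :: "(nat \<Rightarrow> 'a) \<Rightarrow> real"
  assumes t: "Suc t \<le> U" and v: "integrable (law (Suc t)) v"
  shows "AE h in law t. integrable \<mu> (\<lambda>x. q_step t h x * v (h(Suc t := x)))"
    and "integrable (law t) (\<lambda>h. \<integral>x. q_step t h x * v (h(Suc t := x)) \<partial>\<mu>)"
    and "(\<integral>x. v x \<partial>law (Suc t)) = (\<integral>h. (\<integral>x. q_step t h x * v (h(Suc t := x)) \<partial>\<mu>) \<partial>law t)"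
proof -
  interpret law: prob_space "law t" by (rule prob_space_law) (use t in simp)
  interpret pair_sigma_finite "law t" \<mu> by unfold_locales
  note [measurable] = q_step_measurable[OF t]
  let ?c = "\<lambda>z. q_step t (fst z) (snd z)" and ?f = "\<lambda>(h, x). h(Suc t := x)"
  have c: "?c \<in> borel_measurable (law t \<Otimes>\<^sub>M \<mu>)" "\<And>z. z \<in> space (law t \<Otimes>\<^sub>M \<mu>) \<Longrightarrow> 0 \<le> ?c z"
    by (measurable, auto simp: space_pair_measure q_step_nonneg[OF t])
  let ?D = "density (law t \<Otimes>\<^sub>M \<mu>) (\<lambda>z. ennreal (?c z))"
  have law: "law (Suc t) = distr ?D (paths (Suc t)) ?f"
    unfolding law_Suc_eq_distr[OF t] by (simp add: case_prod_beta')
  have f[measurable]: "?f \<in> measurable ?D (paths (Suc t))" by measurable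
  have vm: "v \<in> borel_measurable (paths (Suc t))" using borel_measurable_integrable[OF v] by simp
  have i: "integrable ?D (\<lambda>z. v (?f z))"
    using v unfolding law by (subst (asm) integrable_distr_eq) (use vm f in auto)
  show "AE h in law t. integrable \<mu> (\<lambda>x. q_step t h x * v (h(Suc t := x)))"
    using integral_density_pair(1)[OF c i] by simp
  show "integrable (law t) (\<lambda>h. \<integral>x. q_step t h x * v (h(Suc t := x)) \<partial>\<mu>)"
    using integral_density_pair(2)[OF c i] by simp
  have "(\<integral>x. v x \<partial>law (Suc t)) = (\<integral>z. v (?f z) \<partial>?D)"
    unfolding law by (rule integral_distr) (use vm in auto)
  then show "(\<integral>x. v x \<partial>law (Suc t)) = (\<integral>h. (\<integral>x. q_step t h x * v (h(Suc t := x)) \<partial>\<mu>) \<partial>law t)"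
    using integral_density_pair(3)[OF c i] by simp
qed

section \<open>The posterior density and the weighted function \<open>target\<close>\<close>

lemma step_dens_nonneg:
  assumes "t \<in> {1..U}" "x \<in> space (paths U)"
  shows "0 \<le> step_dens p1 p t x"
proof -
  have x: "\<And>s. s \<in> {1..U} \<Longrightarrow> x s \<in> space \<mu>" using assms by (auto simp: space_PiM)
  show ?thesis
  proof (cases "t = 1")
    case True
    then show ?thesis
      using init_density x[of 1] assms by (auto simp: step_dens_def prob_density_def)
  next
    case False
    then have "t - 1 \<in> {1..U}" using assms by auto
    then show ?thesis
      using False trans_density[OF x[of "t - 1"]] x[of t] assms
      by (auto simp: step_dens_def prob_density_def)
  qed
qed

lemma joint_dens_measurable[measurable]:
  "joint_dens p1 p g Y U \<in> borel_measurable (paths U)"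
  unfolding joint_dens_def[abs_def]
proof (intro borel_measurable_prod borel_measurable_times)
  fix t assume t: "t \<in> {1..U}"
  have [measurable]: "(\<lambda>x. x s) \<in> measurable (paths U) \<mu>" if "s \<in> {1..U}" for s
    by (rule measurable_component_singleton) (rule that)
  note [measurable] = this[OF t]
  have [measurable]: "p1 \<in> borel_measurable \<mu>" using init_density by (simp add: prob_density_def)
  note [measurable] = trans_measurable obs_measurable
  show "(\<lambda>x. g (x t) (Y t)) \<in> borel_measurable (paths U)"
  proof -
    have [measurable]: "(\<lambda>x. Y t) \<in> measurable (paths U) \<nu>" using obs_space[OF t] by simp
    show ?thesis by measurable
  qed
  show "(\<lambda>x. step_dens p1 p t x) \<in> borel_measurable (paths U)"
  proof (cases "t = 1")
    case True
    then show ?thesis using t by (simp add: step_dens_def)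
  next
    case False
    then have [measurable]: "(\<lambda>x. x (t - 1)) \<in> measurable (paths U) \<mu>"
      using t by (intro measurable_component_singleton) auto
    show ?thesis using False unfolding step_dens_def by simp
  qed
qed

lemma post_dens_measurable[measurable]:
  "post_dens \<mu> p1 p g Y U \<in> borel_measurable (paths U)"
  unfolding post_dens_def[abs_def] by measurable

text \<open>A vanishing factor of \<open>imp_dens\<close> forces, by the contrapositive of
  \<open>q_support\<close> and nonnegativity, the transition factor of the same stage to vanish, and
  with it the product.\<close>

lemma post_dens_eq_0:
  assumes x: "x \<in> space (paths U)" and "imp_dens T U q x = 0"
  shows "post_dens \<mu> p1 p g Y U x = 0"
proof -
  obtain t where t: "t \<in> {1..U}" and qt: "q t (restrict x {start T t<..<t}) (x t) = 0"
    using assms(2) by (auto simp: imp_dens_def)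
  \<comment> \<open>\<open>q_support\<close> speaks of paths that end at the stage in question, so
    \<open>x\<close> is cut off there.\<close>
  define y where "y = restrict x {1..t}"
  have y: "y \<in> space (paths t)" using x t by (auto simp: y_def space_PiM PiE_iff)
  have "restrict y {start T t<..<t} = restrict x {start T t<..<t}" "y t = x t"
    using t by (auto simp: y_def)
  then have "\<not> 0 < step_dens p1 p t y"
    using q_support[OF t y] qt by auto
  moreover have "step_dens p1 p t y = step_dens p1 p t x"
    using t by (auto simp: step_dens_def y_def)
  ultimately have "step_dens p1 p t x = 0"
    using step_dens_nonneg[OF t x] by simp
  then have "joint_dens p1 p g Y U x = 0"
    unfolding joint_dens_def using t by (intro prod_zero) auto
  then show ?thesis by (simp add: post_dens_def)
qed

text \<open>The variable whose conditional means are the \<open>f t\<close>, with the factors in the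
  order of \<open>cond_mean_versions\<close>; \<open>psi_hat\<close> has them in the opposite
  order.\<close>

definition target :: "(nat \<Rightarrow> 'a) \<Rightarrow> real" where
  "target x = \<psi> x * lik_ratio \<mu> p1 p g Y T U q x"

lemma target_measurable[measurable]: "target \<in> borel_measurable (paths U)"
  using psi_measurable imp_dens_measurable[of U] unfolding target_def[abs_def] lik_ratio_def by measurable

text \<open>Holds everywhere, not just almost everywhere: where \<open>imp_dens\<close> is zero the
  quotient is zero by convention, and \<open>post_dens_eq_0\<close> makes the right-hand side zero
  too.\<close>

lemma imp_dens_times_target:
  "x \<in> space (paths U) \<Longrightarrow> imp_dens T U q x * target x = \<psi> x * post_dens \<mu> p1 p g Y U x"
  using post_dens_eq_0[of x] by (auto simp: target_def lik_ratio_def)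

lemma integrable_target: "integrable (law U) target"
proof -
  have "integrable (paths U) (\<lambda>x. imp_dens T U q x *\<^sub>R target x)"
    using psi_integrable by (subst Bochner_Integration.integrable_cong[OF refl]) (auto simp: imp_dens_times_target)
  then show ?thesis
    unfolding imp_measure_def
    by (subst integrable_density) (auto simp: imp_dens_nonneg)
qed

lemma integral_target: "(\<integral>x. target x \<partial>law U) = post_mean \<mu> p1 p g Y U \<psi>"
proof -
  have "(\<integral>x. target x \<partial>law U) = (\<integral>x. imp_dens T U q x *\<^sub>R target x \<partial>paths U)"
    unfolding imp_measure_def by (rule integral_density) (auto simp: imp_dens_nonneg)
  also have "\<dots> = post_mean \<mu> p1 p g Y U \<psi>"
    unfolding post_mean_def by (rule Bochner_Integration.integral_cong) (auto simp: imp_dens_times_target)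
  finally show ?thesis .
qed

section \<open>Versions of the conditional means as functions of initial segments\<close>

lemma sets_path_sigma:
  "sets (path_sigma \<mu> U t) = {(\<lambda>x. restrict x {1..t}) -` S \<inter> space (paths U) | S. S \<in> sets (paths t)}"
  if "t \<le> U"
  unfolding path_sigma_def
  by (rule sets_vimage_algebra2) (use that in \<open>auto simp: space_PiM PiE_iff\<close>)

lemma restrict_measurable_law:
  "t \<le> s \<Longrightarrow> (\<lambda>x. restrict x {1..t}) \<in> measurable (law s) (paths t)"
  unfolding measurable_cong_sets[OF sets_law refl] by (rule measurable_restrict_subset) auto

lemma subalgebra_path_sigma: "t \<le> U \<Longrightarrow> subalgebra (law U) (path_sigma \<mu> U t)"
  using measurable_sets[OF restrict_measurable_law[of t U]]
  unfolding subalgebra_def by (auto simp: sets_path_sigma) (auto simp: path_sigma_def)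

context
  fixes f :: "nat \<Rightarrow> (nat \<Rightarrow> 'a) \<Rightarrow> real"
  assumes versions: "cond_mean_versions \<mu> p1 p g Y T U q \<psi> f"
begin

lemma version_0: "f 0 x = post_mean \<mu> p1 p g Y U \<psi>"
  using versions by (simp add: cond_mean_versions_def)

lemma version_measurable[measurable]: "t \<le> U \<Longrightarrow> f t \<in> borel_measurable (paths t)"
  using versions by (cases "t = 0") (auto simp: cond_mean_versions_def)

lemma version_AE:
  "t \<in> {1..U} \<Longrightarrow> AE x in law U. f t (restrict x {1..t}) = real_cond_exp (law U) (path_sigma \<mu> U t) target x"
  using versions unfolding cond_mean_versions_def target_def[abs_def] by auto

text \<open>Moves the defining property of a conditional expectation from full paths to
  \<open>law t\<close>. Integrals over cylinder sets determine \<open>f t\<close> almost everywhere,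
  and only this characterisation is used for the recursion.\<close>

lemma version_integral:
  assumes t: "t \<le> U"
  shows "integrable (law t) (f t)"
    and "S \<in> sets (paths t) \<Longrightarrow>
      (\<integral>x\<in>S. f t x \<partial>law t) = (\<integral>x. indicator S (restrict x {1..t}) * target x \<partial>law U)"
proof -
  interpret lt: prob_space "law t" by (rule prob_space_law[OF t])
  interpret lU: prob_space "law U" by (rule prob_space_law) simp
  have "integrable (law t) (f t) \<and> (\<forall>S\<in>sets (paths t).
      (\<integral>x\<in>S. f t x \<partial>law t) = (\<integral>x. indicator S (restrict x {1..t}) * target x \<partial>law U))"
  proof (cases "t = 0")
    \<comment> \<open>\<open>f 0\<close> is prescribed as a constant and not as a conditional
      expectation. The space of empty paths is a single point, so only the empty and the full set
      occur, and the latter amounts to \<open>integral_target\<close>.\<close>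
    case True
    have "(\<integral>x\<in>S. f 0 x \<partial>law 0) = (\<integral>x. indicator S (restrict x {1..0}) * target x \<partial>law U)"
      if "S \<in> sets (paths 0)" for S
    proof -
      have S: "S = {} \<or> S = space (law 0)" using that by (auto simp: PiM_empty sets_PiM_empty space_PiM_empty subset_singleton_iff)
      from S show ?thesis
      proof
        assume "S = space (law 0)"
        then have "(\<integral>x\<in>S. f 0 x \<partial>law 0) = (\<integral>x. post_mean \<mu> p1 p g Y U \<psi> \<partial>law 0)"
          unfolding set_lebesgue_integral_def version_0
          by (intro Bochner_Integration.integral_cong) auto
        also have "\<dots> = post_mean \<mu> p1 p g Y U \<psi>" using lt.prob_space True by simp
        also have "\<dots> = (\<integral>x. indicator S (restrict x {1..0}) * target x \<partial>law U)"
          using \<open>S = space (law 0)\<close> by (simp add: integral_target[symmetric] space_PiM restrict_def)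
        finally show ?thesis .
      qed (simp add: set_lebesgue_integral_def)
    qed
    moreover have "integrable (law 0) (f 0)"
      using versions lt.integrable_const True unfolding cond_mean_versions_def by simp
    ultimately show ?thesis using True by simp
  next
    case False
    then have t': "t \<in> {1..U}" using t by auto
    have [measurable]: "(\<lambda>x. restrict x {1..t}) \<in> measurable (law U) (paths t)"
      by (rule restrict_measurable_law[OF t])
    note [measurable] = version_measurable[OF t]
    interpret s: finite_measure_subalgebra "law U" "path_sigma \<mu> U t"
      by unfold_locales (rule subalgebra_path_sigma[OF t])
    note ae = version_AE[OF t']
    have "integrable (law U) (\<lambda>x. f t (restrict x {1..t})) \<longleftrightarrow>
        integrable (law U) (real_cond_exp (law U) (path_sigma \<mu> U t) target)"
      by (rule integrable_cong_AE) (use ae in auto)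
    then have iU: "integrable (law U) (\<lambda>x. f t (restrict x {1..t}))"
      using s.real_cond_exp_int(1)[OF integrable_target] by simp
    then have "integrable (distr (law U) (paths t) (\<lambda>x. restrict x {1..t})) (f t)"
      by (subst integrable_distr_eq) auto
    then have it: "integrable (law t) (f t)" by (simp only: distr_law[OF t order_refl])
    have "(\<integral>x\<in>S. f t x \<partial>law t) = (\<integral>x. indicator S (restrict x {1..t}) * target x \<partial>law U)"
      if S[measurable]: "S \<in> sets (paths t)" for S
    proof -
      define A where "A = (\<lambda>x. restrict x {1..t}) -` S \<inter> space (paths U)"
      have A: "A \<in> sets (path_sigma \<mu> U t)" using S unfolding A_def sets_path_sigma[OF t] by blast
      have "(\<integral>x\<in>S. f t x \<partial>law t) = (\<integral>x. indicator S x * f t x \<partial>distr (law U) (paths t) (\<lambda>x. restrict x {1..t}))"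
        unfolding distr_law[OF t order_refl] set_lebesgue_integral_def by simp
      also have "\<dots> = (\<integral>x. indicator S (restrict x {1..t}) * f t (restrict x {1..t}) \<partial>law U)"
        by (rule integral_distr) auto
      also have "\<dots> = (\<integral>x. indicator S (restrict x {1..t}) * real_cond_exp (law U) (path_sigma \<mu> U t) target x \<partial>law U)"
        by (rule integral_cong_AE) (use ae in auto)
      also have "\<dots> = (\<integral>x\<in>A. real_cond_exp (law U) (path_sigma \<mu> U t) target x \<partial>law U)"
        unfolding set_lebesgue_integral_def A_def
        by (intro Bochner_Integration.integral_cong) (auto simp: indicator_def)
      also have "\<dots> = (\<integral>x\<in>A. target x \<partial>law U)"
        by (rule s.real_cond_exp_intA[OF integrable_target A, symmetric])
      also have "\<dots> = (\<integral>x. indicator S (restrict x {1..t}) * target x \<partial>law U)"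
        unfolding set_lebesgue_integral_def A_def
        by (intro Bochner_Integration.integral_cong) (auto simp: indicator_def)
      finally show ?thesis .
    qed
    with it show ?thesis by blast
  qed
  then show "integrable (law t) (f t)"
    and "S \<in> sets (paths t) \<Longrightarrow>
      (\<integral>x\<in>S. f t x \<partial>law t) = (\<integral>x. indicator S (restrict x {1..t}) * target x \<partial>law U)"
    by auto
qed

text \<open>The initial segment of length \<open>U\<close> is the whole path, so conditioning on it
  changes nothing.\<close>

lemma version_final: "AE x in law U. f U x = target x"
proof (rule density_unique_real)
  show "(\<integral>x\<in>A. f U x \<partial>law U) = (\<integral>x\<in>A. target x \<partial>law U)" if "A \<in> sets (law U)" for A
  proof -
    have "(\<integral>x\<in>A. f U x \<partial>law U) = (\<integral>x. indicator A (restrict x {1..U}) * target x \<partial>law U)"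
      by (rule version_integral(2)) (use that in auto)
    also have "\<dots> = (\<integral>x\<in>A. target x \<partial>law U)"
      unfolding set_lebesgue_integral_def
      by (intro Bochner_Integration.integral_cong) (auto simp: space_PiM PiE_restrict)
    finally show ?thesis .
  qed
qed (use version_integral(1)[of U] integrable_target in auto)

text \<open>The tower property in kernel form: over every measurable set of paths of length
  \<open>t\<close> both sides have the same integral as \<open>target\<close> over the corresponding
  cylinder.\<close>

lemma version_step:
  assumes t: "Suc t \<le> U"
  shows "AE h in law t. f t h = (\<integral>x. q_step t h x * f (Suc t) (h(Suc t := x)) \<partial>\<mu>)"
proof (rule density_unique_real)
  have tU: "t \<le> U" using t by simp
  show "integrable (law t) (f t)" by (rule version_integral(1)[OF tU])
  note iS = version_integral(1)[OF t]
  show "integrable (law t) (\<lambda>h. \<integral>x. q_step t h x * f (Suc t) (h(Suc t := x)) \<partial>\<mu>)"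
    by (rule integral_law_Suc(2)[OF t iS])
  fix A assume "A \<in> sets (law t)"
  then have A: "A \<in> sets (paths t)" by simp
  \<comment> \<open>The same event seen one stage later, so that \<open>version_integral\<close> for
    \<open>t\<close> and for \<open>Suc t\<close> leads to one and the same integral of
    \<open>target\<close>.\<close>
  define A' where "A' = (\<lambda>x. restrict x {1..t}) -` A \<inter> space (paths (Suc t))"
  have A': "A' \<in> sets (law (Suc t))"
    using measurable_sets[OF restrict_measurable_law[of t "Suc t"] A] by (simp add: A'_def)
  have "(\<integral>x\<in>A. f t x \<partial>law t) = (\<integral>x. indicator A (restrict x {1..t}) * target x \<partial>law U)"
    by (rule version_integral(2)[OF tU A])
  also have "\<dots> = (\<integral>x. indicator A' (restrict x {1..Suc t}) * target x \<partial>law U)"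
  proof (rule Bochner_Integration.integral_cong[OF refl])
    fix x assume "x \<in> space (law U)"
    then have "restrict x {1..Suc t} \<in> space (paths (Suc t))" using t by (auto simp: space_PiM PiE_iff)
    moreover have "restrict (restrict x {1..Suc t}) {1..t} = restrict x {1..t}" by auto
    ultimately have "indicator A' (restrict x {1..Suc t}) = (indicator A (restrict x {1..t}) :: real)"
      by (simp only: A'_def indicator_def) simp
    then show "indicator A (restrict x {1..t}) * target x = indicator A' (restrict x {1..Suc t}) * target x"
      by simp
  qed
  also have "\<dots> = (\<integral>x\<in>A'. f (Suc t) x \<partial>law (Suc t))"
    by (rule version_integral(2)[OF t, symmetric]) (use A' in simp)
  also have "\<dots> = (\<integral>h. (\<integral>x. q_step t h x * (indicator A' (h(Suc t := x)) *\<^sub>R f (Suc t) (h(Suc t := x))) \<partial>\<mu>) \<partial>law t)"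
    unfolding set_lebesgue_integral_def
    by (rule integral_law_Suc(3)[OF t]) (use integrable_mult_indicator[OF A' iS] in simp)
  also have "\<dots> = (\<integral>h\<in>A. (\<integral>x. q_step t h x * f (Suc t) (h(Suc t := x)) \<partial>\<mu>) \<partial>law t)"
    unfolding set_lebesgue_integral_def
  proof (rule Bochner_Integration.integral_cong[OF refl])
    fix h assume h: "h \<in> space (law t)"
    have "q_step t h x * (indicator A' (h(Suc t := x)) *\<^sub>R f (Suc t) (h(Suc t := x))) =
        indicator A h * (q_step t h x * f (Suc t) (h(Suc t := x)))" if x: "x \<in> space \<mu>" for x
    proof -
      have "restrict (h(Suc t := x)) {1..t} = h"
        using h by (auto simp: space_PiM PiE_iff extensional_def restrict_def fun_eq_iff)
      then have "h(Suc t := x) \<in> A' \<longleftrightarrow> h \<in> A"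
        using upd_in_paths[of h t x] h x unfolding A'_def by simp
      then show ?thesis by (simp add: indicator_def)
    qed
    then have "(\<integral>x. q_step t h x * (indicator A' (h(Suc t := x)) *\<^sub>R f (Suc t) (h(Suc t := x))) \<partial>\<mu>) =
        (\<integral>x. indicator A h * (q_step t h x * f (Suc t) (h(Suc t := x))) \<partial>\<mu>)"
      by (intro Bochner_Integration.integral_cong refl)
    then show "(\<integral>x. q_step t h x * (indicator A' (h(Suc t := x)) *\<^sub>R f (Suc t) (h(Suc t := x))) \<partial>\<mu>) =
        indicator A h *\<^sub>R (\<integral>x. q_step t h x * f (Suc t) (h(Suc t := x)) \<partial>\<mu>)"
      by simp
  qed
  finally show "(\<integral>x\<in>A. f t x \<partial>law t) = (\<integral>h\<in>A. (\<integral>x. q_step t h x * f (Suc t) (h(Suc t := x)) \<partial>\<mu>) \<partial>law t)" .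
qed

end

end

section \<open>Particles as functions of the history\<close>

lemma filt_eq:
  assumes "1 \<le> m" "(m - 1) * T < t" "t \<le> m * T"
  shows "filt T t = m"
proof -
  obtain n where m: "m = Suc n" using assms(1) by (cases m) auto
  have "(t - 1) div T = n"
    by (rule div_nat_eqI) (use assms in \<open>auto simp: m algebra_simps\<close>)
  then show ?thesis by (simp add: filt_def m)
qed

lemma start_eq: "1 \<le> m \<Longrightarrow> (m - 1) * T < t \<Longrightarrow> t \<le> m * T \<Longrightarrow> start T t = (m - 1) * T"
  by (simp add: start_def filt_eq)

lemma filt_bounds:
  assumes "1 \<le> u" "1 \<le> T"
  shows "1 \<le> filt T u" "(filt T u - 1) * T < u" "u \<le> filt T u * T"
proof -
  show "1 \<le> filt T u" by (simp add: filt_def)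
  have "(u - 1) div T * T + (u - 1) mod T = u - 1" by simp
  moreover have "(u - 1) mod T < T" using assms by simp
  ultimately show "(filt T u - 1) * T < u" "u \<le> filt T u * T"
    using assms(1) by (simp_all only: filt_def add_mult_distrib add_diff_cancel_right' mult_1)
qed

lemma filt_le:
  assumes "1 \<le> u" "1 \<le> T" "u \<le> n * T"
  shows "filt T u \<le> n"
proof -
  have "(filt T u - 1) * T < n * T" using filt_bounds[OF assms(1,2)] assms(3) by linarith
  then have "filt T u - 1 < n" by simp
  then show ?thesis by linarith
qed

section \<open>The \<sigma>-algebras of the histories\<close>

lemma space_history[simp]: "space (history P \<mu> K Xt B r u) = space P"
  by (simp add: history_def space_measure_of_conv)

lemma sets_history:
  "sets (history P \<mu> K Xt B r u) = sigma_sets (space P)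
     ({Xt s k -` S \<inter> space P | s k S. r < s \<and> 2 * s - 1 \<le> u \<and> k \<in> {1..K} \<and> S \<in> sets \<mu>} \<union>
      {B s k -` {i} \<inter> space P | s k i. r < s \<and> 2 * s \<le> u \<and> k \<in> {1..K} \<and> i \<in> {1..K}})"
  unfolding history_def by (rule sets_measure_of) auto

lemma sets_history_mono:
  assumes "r' \<le> r" "u \<le> u'"
  shows "sets (history P \<mu> K Xt B r u) \<subseteq> sets (history P \<mu> K Xt B r' u')"
  unfolding sets_history
proof (rule sigma_sets_mono', rule Un_mono, safe)
  fix s k S assume "r < s" "2 * s - 1 \<le> u" "k \<in> {1..K}" "S \<in> sets \<mu>"
  then show "\<exists>s' k' S'. Xt s k -` S \<inter> space P = Xt s' k' -` S' \<inter> space P \<and>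
      r' < s' \<and> 2 * s' - 1 \<le> u' \<and> k' \<in> {1..K} \<and> S' \<in> sets \<mu>"
    using assms by (intro exI[of _ s] exI[of _ k] exI[of _ S]) auto
next
  fix s k i assume "r < s" "2 * s \<le> u" "k \<in> {1..K}" "i \<in> {1..K}"
  then show "\<exists>s' k' i'. B s k -` {i} \<inter> space P = B s' k' -` {i'} \<inter> space P \<and>
      r' < s' \<and> 2 * s' \<le> u' \<and> k' \<in> {1..K} \<and> i' \<in> {1..K}"
    using assms by (intro exI[of _ s] exI[of _ k] exI[of _ i]) auto
qed

section \<open>Paths before, during and after a block\<close>

lemma X_res_initial: "t \<le> (m - 1) * T \<Longrightarrow> X_res T Xt B m t k \<omega> = (\<lambda>_. undefined)"
  by (cases t) auto

lemma A_res_initial: "t \<le> (m - 1) * T \<Longrightarrow> A_res T B m t k \<omega> = k"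
  by (cases t) auto

lemma H_res_initial: "t \<le> (m - 1) * T \<Longrightarrow> H_res T K w Xt B m t k \<omega> = 1"
  by (cases t) auto

text \<open>A particle path is extensional on the current block; this makes it equal to the
  restriction of a joined path in \<open>q_step_X_join\<close>.\<close>

lemma X_res_undefined: "u \<notin> {(m - 1) * T<..t} \<Longrightarrow> X_res T Xt B m t k \<omega> u = undefined"
proof (induction t arbitrary: k)
  case (Suc t)
  then show ?case by (cases "t < (m - 1) * T") (auto simp: Let_def)
qed simp

text \<open>Sampling appends one coordinate, exactly as in \<open>nn_integral_law_Suc\<close>. This
  includes the first stage of a block, where the joined path so far consists of earlier filters
  only.\<close>

lemma X_join_prop_eq_upd:
  assumes "(m - 1) * T < t"
  shows "X_join_prop T Xt B m t k \<omega> = (X_join T Xt B m (t - 1) k \<omega>)(t := Xt t (k m) \<omega>)"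
  using assms by (auto simp: X_join_prop_def X_join_def join_paths_def X_prop_def fun_eq_iff)

text \<open>On joined paths resampling is the substitution of the parent index in coordinate
  \<open>m\<close>; coordinates of earlier blocks read \<open>k\<close> only at filter numbers
  different from \<open>m\<close>.\<close>

lemma X_join_resample:
  assumes "1 \<le> m" "1 \<le> T" "(m - 1) * T < t"
  shows "X_join T Xt B m t k \<omega> = X_join_prop T Xt B m t (k(m := B t (k m) \<omega>)) \<omega>"
proof -
  have "filt T u \<noteq> m" if "1 \<le> u" "u \<le> (m - 1) * T" for u
    using filt_le[OF that(1) assms(2) that(2)] assms(1) by auto
  then show ?thesis
    by (auto simp: X_join_prop_def X_join_def join_paths_def fun_eq_iff
        res_eq_prop(1)[OF assms(3), where k = "k m"])
qed

lemma H_join_resample: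
  assumes "1 \<le> m" "(m - 1) * T < t"
  shows "H_join T K w Xt B m t k \<omega> = H_join_prop T K w Xt B m t (k(m := B t (k m) \<omega>)) \<omega>"
proof -
  have "(\<Prod>n=1..m - 1. H_res T K w Xt B n (n * T) ((k(m := B t (k m) \<omega>)) n) \<omega>) =
      (\<Prod>n=1..m - 1. H_res T K w Xt B n (n * T) (k n) \<omega>)"
    using assms(1) by (intro prod.cong) auto
  then show ?thesis
    by (simp add: H_join_def H_join_prop_def res_eq_prop(3)[OF assms(2)])
qed

text \<open>At a block boundary the last block can be read as the current one of filter
  \<open>m\<close> or as a completed one for filter \<open>Suc m\<close>.\<close>

lemma X_join_next_filter:
  assumes "1 \<le> m" "1 \<le> T"
  shows "X_join T Xt B (Suc m) (m * T) k \<omega> = X_join T Xt B m (m * T) k \<omega>"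
proof
  fix u
  show "X_join T Xt B (Suc m) (m * T) k \<omega> u = X_join T Xt B m (m * T) k \<omega> u"
  proof (cases "(m - 1) * T < u \<and> u \<le> m * T")
    case True
    then show ?thesis using filt_eq[of m T u] assms by (simp add: X_join_def join_paths_def)
  next
    case False
    then show ?thesis by (auto simp: X_join_def join_paths_def)
  qed
qed

lemma H_join_next_filter:
  assumes "1 \<le> m"
  shows "H_join T K w Xt B (Suc m) (m * T) k \<omega> = H_join T K w Xt B m (m * T) k \<omega>"
proof -
  have "{1..m} = insert m {1..m - 1}" using assms by auto
  then show ?thesis
    using assms by (simp add: H_join_def H_res_initial mult.commute)
qed

context particle_filters
begin

abbreviation Hs :: "nat \<Rightarrow> nat \<Rightarrow> 'w measure" where "Hs r u \<equiv> history P \<mu> K Xt B r u"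

section \<open>Measurability and positivity of the particle quantities\<close>

lemma block_le: "m \<in> {1..M} \<Longrightarrow> t \<le> m * T \<Longrightarrow> t \<le> U"
  by (rule order_trans[OF _ mult_le_mono1]) auto

lemma subalgebra_history:
  assumes "u \<le> 2 * U"
  shows "subalgebra P (Hs r u)"
  unfolding subalgebra_def
proof
  show "sets (Hs r u) \<subseteq> sets P"
    unfolding sets_history
    by (rule sets.sigma_sets_subset)
       (use assms in \<open>auto intro!: measurable_sets[OF Xt_measurable] measurable_sets[OF B_measurable]\<close>)
qed simp

lemma Xt_history:
  assumes "r < s" "2 * s - 1 \<le> u" "s \<le> U" "k \<in> {1..K}"
  shows "Xt s k \<in> measurable (Hs r u) \<mu>"
proof (rule measurableI)
  fix \<omega> assume "\<omega> \<in> space (Hs r u)"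
  then show "Xt s k \<omega> \<in> space \<mu>"
    using measurable_space[OF Xt_measurable[of s k]] assms by auto
next
  fix S assume "S \<in> sets \<mu>"
  then have "Xt s k -` S \<inter> space P \<in> sets (Hs r u)"
    unfolding sets_history using assms by (intro sigma_sets.Basic UnI1) blast
  then show "Xt s k -` S \<inter> space (Hs r u) \<in> sets (Hs r u)" by simp
qed

lemma B_history:
  assumes "r < s" "2 * s \<le> u" "s \<le> U" "k \<in> {1..K}"
  shows "B s k \<in> measurable (Hs r u) (count_space {1..K})"
proof (subst measurable_count_space_eq2[OF finite_atLeastAtMost], safe)
  fix \<omega> assume "\<omega> \<in> space (Hs r u)"
  then show "B s k \<omega> \<in> {1..K}"
    using measurable_space[OF B_measurable[of s k]] assms by auto
next
  fix i assume "i \<in> {1..K}"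
  then have "B s k -` {i} \<inter> space P \<in> sets (Hs r u)"
    unfolding sets_history using assms by (intro sigma_sets.Basic UnI2) blast
  then show "B s k -` {i} \<inter> space (Hs r u) \<in> sets (Hs r u)" by simp
qed

lemma B_range: "\<omega> \<in> space P \<Longrightarrow> s \<in> {1..U} \<Longrightarrow> k \<in> {1..K} \<Longrightarrow> B s k \<omega> \<in> {1..K}"
  using measurable_space[OF B_measurable[of s k]] by auto

lemma A_range:
  assumes "m \<in> {1..M}" "\<omega> \<in> space P"
  shows "t \<le> m * T \<Longrightarrow> k \<in> {1..K} \<Longrightarrow> A_res T B m t k \<omega> \<in> {1..K}"
proof (induction t arbitrary: k)
  case (Suc t)
  have "B (Suc t) k \<omega> \<in> {1..K}"
    using Suc.prems assms block_le[OF assms(1) Suc.prems(1)] by (intro B_range) auto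
  then show ?case using Suc by auto
qed simp

text \<open>The parameter \<open>r\<close> allows the filtration of the whole algorithm as well as
  the past of filter \<open>m\<close> alone.\<close>

lemma X_res_measurable:
  assumes m: "m \<in> {1..M}" and r: "r \<le> (m - 1) * T"
  shows "(m - 1) * T \<le> t \<Longrightarrow> t \<le> m * T \<Longrightarrow> 2 * t \<le> u \<Longrightarrow> k \<in> {1..K} \<Longrightarrow>
    X_res T Xt B m t k \<in> measurable (Hs r u) (path_space \<mu> {(m - 1) * T<..t})"
proof (induction t arbitrary: k rule: nat_induct_at_least)
  case base
  have "X_res T Xt B m ((m - 1) * T) k = (\<lambda>_ _. undefined)" by (simp add: fun_eq_iff X_res_initial)
  then show ?case by (auto simp: space_PiM)
next
  case (Suc t)
  have tU: "Suc t \<le> U" by (rule block_le[OF m Suc.prems(1)])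
  have "(\<lambda>\<omega>. (X_res T Xt B m t (B (Suc t) k \<omega>) \<omega>)(Suc t := Xt (Suc t) (B (Suc t) k \<omega>) \<omega>)) \<in>
      measurable (Hs r u) (path_space \<mu> {(m - 1) * T<..Suc t})"
  \<comment> \<open>The random parent index takes finitely many values, so it suffices to treat each
    fixed index \<open>j\<close>.\<close>
  proof (rule measurable_compose_countable'[where I = "{1..K}" and
        f = "\<lambda>j \<omega>. (X_res T Xt B m t j \<omega>)(Suc t := Xt (Suc t) j \<omega>)"])
    fix j assume j: "j \<in> {1..K}"
    show "(\<lambda>\<omega>. (X_res T Xt B m t j \<omega>)(Suc t := Xt (Suc t) j \<omega>)) \<in>
      measurable (Hs r u) (path_space \<mu> {(m - 1) * T<..Suc t})"
    proof (rule measurable_fun_upd)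
      show "{(m - 1) * T<..Suc t} = {(m - 1) * T<..t} \<union> {Suc t}" using Suc.hyps by auto
      show "X_res T Xt B m t j \<in> measurable (Hs r u) (path_space \<mu> {(m - 1) * T<..t})"
        by (rule Suc.IH) (use Suc.prems j in auto)
      show "Xt (Suc t) j \<in> measurable (Hs r u) \<mu>"
        by (rule Xt_history) (use Suc.prems Suc.hyps r j tU in auto)
    qed
  next
    show "B (Suc t) k \<in> measurable (Hs r u) (count_space {1..K})"
      by (rule B_history) (use Suc.prems Suc.hyps r tU in auto)
  qed simp
  moreover have "X_res T Xt B m (Suc t) k =
      (\<lambda>\<omega>. (X_res T Xt B m t (B (Suc t) k \<omega>) \<omega>)(Suc t := Xt (Suc t) (B (Suc t) k \<omega>) \<omega>))"
    using Suc.hyps by (auto simp: Let_def fun_eq_iff)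
  ultimately show ?case by (simp only:)
qed

lemma X_prop_measurable:
  assumes m: "m \<in> {1..M}" and r: "r \<le> (m - 1) * T"
    and t: "t \<in> {(m - 1) * T<..m * T}" "2 * t - 1 \<le> u" and k: "k \<in> {1..K}"
  shows "X_prop T Xt B m t k \<in> measurable (Hs r u) (path_space \<mu> {(m - 1) * T<..t})"
  unfolding X_prop_def[abs_def]
proof (rule measurable_fun_upd)
  show "{(m - 1) * T<..t} = {(m - 1) * T<..t - 1} \<union> {t}" using t by auto
  show "X_res T Xt B m (t - 1) k \<in> measurable (Hs r u) (path_space \<mu> {(m - 1) * T<..t - 1})"
    by (rule X_res_measurable) (use assms in auto)
  show "Xt t k \<in> measurable (Hs r u) \<mu>"
    by (rule Xt_history) (use assms block_le[of m t] in auto)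
qed

lemma w_X_prop_measurable:
  assumes m: "m \<in> {1..M}" and r: "r \<le> (m - 1) * T"
    and t: "t \<in> {(m - 1) * T<..m * T}" "2 * t - 1 \<le> u" and k: "k \<in> {1..K}"
  shows "(\<lambda>\<omega>. w t (X_prop T Xt B m t k \<omega>)) \<in> borel_measurable (Hs r u)"
proof (rule measurable_compose[OF X_prop_measurable[OF assms]])
  have "start T t = (m - 1) * T" by (rule start_eq) (use assms in auto)
  moreover have "t \<in> {1..U}" using t m block_le[of m t] by auto
  ultimately show "w t \<in> borel_measurable (path_space \<mu> {(m - 1) * T<..t})"
    using w_measurable[of t] by simp
qed

lemma w_X_prop_pos:
  assumes m: "m \<in> {1..M}" and t: "t \<in> {(m - 1) * T<..m * T}" and k: "k \<in> {1..K}" and \<omega>: "\<omega> \<in> space P"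
  shows "0 < w t (X_prop T Xt B m t k \<omega>)"
proof -
  have "start T t = (m - 1) * T" by (rule start_eq) (use assms in auto)
  moreover have "t \<in> {1..U}" using t m block_le[of m t] by auto
  moreover have "X_prop T Xt B m t k \<omega> \<in> space (path_space \<mu> {(m - 1) * T<..t})"
    using measurable_space[OF X_prop_measurable[OF m order_refl t order_refl k]] \<omega> by simp
  ultimately show ?thesis using w_pos[of t] by simp
qed

lemma W_norm_measurable:
  assumes "m \<in> {1..M}" "r \<le> (m - 1) * T" "t \<in> {(m - 1) * T<..m * T}" "2 * t - 1 \<le> u" "k \<in> {1..K}"
  shows "W_norm T K w Xt B m t k \<in> borel_measurable (Hs r u)"
  unfolding W_norm_def[abs_def] w_bar_def
  by (intro borel_measurable_divide borel_measurable_times borel_measurable_sum borel_measurable_const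
      w_X_prop_measurable) (use assms in auto)

lemma W_norm_eq: "W_norm T K w Xt B m t k \<omega> = w t (X_prop T Xt B m t k \<omega>) / (\<Sum>i=1..K. w t (X_prop T Xt B m t i \<omega>))"
  using K_pos by (simp add: W_norm_def w_bar_def)

lemma w_sum_pos:
  assumes "m \<in> {1..M}" "t \<in> {(m - 1) * T<..m * T}" "\<omega> \<in> space P"
  shows "0 < (\<Sum>i=1..K. w t (X_prop T Xt B m t i \<omega>))"
  by (rule sum_pos) (use K_pos w_X_prop_pos[OF assms(1,2) _ assms(3)] in auto)

lemma W_norm_pos:
  assumes "m \<in> {1..M}" "t \<in> {(m - 1) * T<..m * T}" "k \<in> {1..K}" "\<omega> \<in> space P"
  shows "0 < W_norm T K w Xt B m t k \<omega>"
  unfolding W_norm_eq using w_sum_pos[OF assms(1,2,4)] w_X_prop_pos[OF assms] by simp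

lemma W_norm_sum:
  assumes "m \<in> {1..M}" "t \<in> {(m - 1) * T<..m * T}" "\<omega> \<in> space P"
  shows "(\<Sum>k=1..K. W_norm T K w Xt B m t k \<omega>) = 1"
  unfolding W_norm_eq using w_sum_pos[OF assms] by (simp flip: sum_divide_distrib)

lemma H_res_measurable:
  assumes m: "m \<in> {1..M}" and r: "r \<le> (m - 1) * T"
  shows "(m - 1) * T \<le> t \<Longrightarrow> t \<le> m * T \<Longrightarrow> 2 * t \<le> u \<Longrightarrow> k \<in> {1..K} \<Longrightarrow>
    H_res T K w Xt B m t k \<in> borel_measurable (Hs r u)"
proof (induction t arbitrary: k rule: nat_induct_at_least)
  case base
  have "H_res T K w Xt B m ((m - 1) * T) k = (\<lambda>_. 1)" by (simp add: fun_eq_iff H_res_initial)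
  then show ?case by simp
next
  case (Suc t)
  have tU: "Suc t \<le> U" by (rule block_le[OF m Suc.prems(1)])
  have "(\<lambda>\<omega>. H_res T K w Xt B m t (B (Suc t) k \<omega>) \<omega> / (real K * W_norm T K w Xt B m (Suc t) (B (Suc t) k \<omega>) \<omega>))
      \<in> borel_measurable (Hs r u)"
  proof (rule measurable_compose_countable'[where I = "{1..K}" and
        f = "\<lambda>j \<omega>. H_res T K w Xt B m t j \<omega> / (real K * W_norm T K w Xt B m (Suc t) j \<omega>)"])
    fix j assume j: "j \<in> {1..K}"
    show "(\<lambda>\<omega>. H_res T K w Xt B m t j \<omega> / (real K * W_norm T K w Xt B m (Suc t) j \<omega>)) \<in> borel_measurable (Hs r u)"
      by (intro borel_measurable_divide borel_measurable_times borel_measurable_const Suc.IH W_norm_measurable m r)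
         (use Suc.prems Suc.hyps r j in auto)
  next
    show "B (Suc t) k \<in> measurable (Hs r u) (count_space {1..K})"
      by (rule B_history) (use Suc.prems Suc.hyps r tU in auto)
  qed simp
  moreover have "H_res T K w Xt B m (Suc t) k =
     (\<lambda>\<omega>. H_res T K w Xt B m t (B (Suc t) k \<omega>) \<omega> / (real K * W_norm T K w Xt B m (Suc t) (B (Suc t) k \<omega>) \<omega>))"
    using Suc.hyps by (auto simp: Let_def fun_eq_iff)
  ultimately show ?case by (simp only:)
qed

lemma H_res_pos:
  assumes m: "m \<in> {1..M}" and \<omega>: "\<omega> \<in> space P"
  shows "t \<le> m * T \<Longrightarrow> k \<in> {1..K} \<Longrightarrow> 0 < H_res T K w Xt B m t k \<omega>"
proof (induction t arbitrary: k)
  case (Suc t)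
  show ?case
  proof (cases "t < (m - 1) * T")
    case False
    have "B (Suc t) k \<omega> \<in> {1..K}"
      using Suc.prems block_le[OF m Suc.prems(1)] by (intro B_range \<omega>) auto
    then show ?thesis
      using False Suc.IH[of "B (Suc t) k \<omega>"] W_norm_pos[OF m _ _ \<omega>, of "Suc t" "B (Suc t) k \<omega>"] Suc.prems K_pos
      by (simp add: Let_def)
  qed simp
qed simp

lemma H_prop_measurable:
  assumes "m \<in> {1..M}" "r \<le> (m - 1) * T" "t \<in> {(m - 1) * T<..m * T}" "2 * t - 1 \<le> u" "k \<in> {1..K}"
  shows "H_prop T K w Xt B m t k \<in> borel_measurable (Hs r u)"
  unfolding H_prop_def[abs_def]
  by (intro borel_measurable_divide borel_measurable_times borel_measurable_const W_norm_measurable H_res_measurable)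
     (use assms in auto)

lemma A_res_measurable:
  assumes m: "m \<in> {1..M}" and r: "r \<le> (m - 1) * T"
  shows "(m - 1) * T \<le> t \<Longrightarrow> t \<le> m * T \<Longrightarrow> 2 * t \<le> u \<Longrightarrow> k \<in> {1..K} \<Longrightarrow>
    A_res T B m t k \<in> measurable (Hs r u) (count_space {1..K})"
proof (induction t arbitrary: k rule: nat_induct_at_least)
  case base
  moreover have "A_res T B m ((m - 1) * T) k = (\<lambda>_. k)" by (simp add: fun_eq_iff A_res_initial)
  ultimately show ?case by simp
next
  case (Suc t)
  have tU: "Suc t \<le> U" by (rule block_le[OF m Suc.prems(1)])
  have "(\<lambda>\<omega>. A_res T B m t (B (Suc t) k \<omega>) \<omega>) \<in> measurable (Hs r u) (count_space {1..K})"
  proof (rule measurable_compose_countable'[where I = "{1..K}" and f = "\<lambda>j \<omega>. A_res T B m t j \<omega>"])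
    show "B (Suc t) k \<in> measurable (Hs r u) (count_space {1..K})"
      by (rule B_history) (use Suc.prems Suc.hyps r tU in auto)
  qed (use Suc in auto)
  moreover have "A_res T B m (Suc t) k = (\<lambda>\<omega>. A_res T B m t (B (Suc t) k \<omega>) \<omega>)"
    using Suc.hyps by (auto simp: fun_eq_iff)
  ultimately show ?case by simp
qed

lemma previous_filter_measurable:
  assumes m: "m \<in> {1..M}" and k: "k \<in> {1..m - 1} \<rightarrow> {1..K}" and u: "2 * ((m - 1) * T) \<le> u"
  shows "n \<in> {1..m - 1} \<Longrightarrow> H_res T K w Xt B n (n * T) (k n) \<in> borel_measurable (Hs 0 u)"
    and "s \<in> {1..(m - 1) * T} \<Longrightarrow>
      (\<lambda>\<omega>. X_res T Xt B (filt T s) (filt T s * T) (k (filt T s)) \<omega> s) \<in> measurable (Hs 0 u) \<mu>"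
proof -
  have le: "2 * (n * T) \<le> u" if "n \<in> {1..m - 1}" for n
  proof -
    have "n * T \<le> (m - 1) * T" using that by (intro mult_le_mono1) simp
    then show ?thesis using u by linarith
  qed
  show "H_res T K w Xt B n (n * T) (k n) \<in> borel_measurable (Hs 0 u)" if "n \<in> {1..m - 1}"
    by (rule H_res_measurable) (use that m k le[OF that] in auto)
  assume s: "s \<in> {1..(m - 1) * T}"
  define n where "n = filt T s"
  have n: "n \<in> {1..m - 1}" "(n - 1) * T < s" "s \<le> n * T"
    using s T_pos filt_bounds[of s T] filt_le[of s T "m - 1"] by (auto simp: n_def)
  have "X_res T Xt B n (n * T) (k n) \<in> measurable (Hs 0 u) (path_space \<mu> {(n - 1) * T<..n * T})"
    by (rule X_res_measurable) (use n m k le[OF n(1)] in auto)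
  from measurable_compose[OF this measurable_component_singleton[of s]] n
  show "(\<lambda>\<omega>. X_res T Xt B (filt T s) (filt T s * T) (k (filt T s)) \<omega> s) \<in> measurable (Hs 0 u) \<mu>"
    unfolding n_def[symmetric] by simp
qed

lemma join_paths_measurable:
  assumes m: "m \<in> {1..M}" and k: "k \<in> {1..m} \<rightarrow> {1..K}" and u: "2 * ((m - 1) * T) \<le> u"
    and x: "x \<in> measurable (Hs 0 u) (path_space \<mu> {(m - 1) * T<..t})"
  shows "(\<lambda>\<omega>. join_paths T Xt B m t k \<omega> (x \<omega>)) \<in> measurable (Hs 0 u) (paths t)"
  unfolding join_paths_def
proof (rule measurable_restrict)
  fix s assume s: "s \<in> {1..t}"
  show "(\<lambda>\<omega>. if s \<le> (m - 1) * T then X_res T Xt B (filt T s) (filt T s * T) (k (filt T s)) \<omega> s else x \<omega> s)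
      \<in> measurable (Hs 0 u) \<mu>"
  proof (cases "s \<le> (m - 1) * T")
    case True
    have "k \<in> {1..m - 1} \<rightarrow> {1..K}" using k by auto
    from previous_filter_measurable(2)[OF m this u, of s] True s show ?thesis by simp
  next
    case False
    then show ?thesis
      using measurable_compose[OF x measurable_component_singleton[of s]] s by simp
  qed
qed

lemma X_join_measurable:
  assumes m: "m \<in> {1..M}" and k: "k \<in> {1..m} \<rightarrow> {1..K}" and t: "(m - 1) * T \<le> t" "t \<le> m * T" "2 * t \<le> u"
  shows "X_join T Xt B m t k \<in> measurable (Hs 0 u) (paths t)"
  unfolding X_join_def[abs_def]
  by (rule join_paths_measurable[OF m k _ X_res_measurable[OF m]]) (use m k t in auto)

lemma X_join_prop_measurable:
  assumes m: "m \<in> {1..M}" and k: "k \<in> {1..m} \<rightarrow> {1..K}" and t: "t \<in> {(m - 1) * T<..m * T}" "2 * t - 1 \<le> u"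
  shows "X_join_prop T Xt B m t k \<in> measurable (Hs 0 u) (paths t)"
  unfolding X_join_prop_def[abs_def]
  by (rule join_paths_measurable[OF m k _ X_prop_measurable[OF m]]) (use m k t in auto)

lemma H_join_measurable:
  assumes m: "m \<in> {1..M}" and k: "k \<in> {1..m} \<rightarrow> {1..K}" and t: "(m - 1) * T \<le> t" "t \<le> m * T" "2 * t \<le> u"
  shows "H_join T K w Xt B m t k \<in> borel_measurable (Hs 0 u)"
  unfolding H_join_def[abs_def]
  by (intro borel_measurable_times borel_measurable_prod H_res_measurable[OF m] previous_filter_measurable(1)[OF m])
     (use m k t in auto)

lemma H_join_prop_measurable:
  assumes m: "m \<in> {1..M}" and k: "k \<in> {1..m} \<rightarrow> {1..K}" and t: "t \<in> {(m - 1) * T<..m * T}" "2 * t - 1 \<le> u"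
  shows "H_join_prop T K w Xt B m t k \<in> borel_measurable (Hs 0 u)"
  unfolding H_join_prop_def[abs_def]
  by (intro borel_measurable_times borel_measurable_prod H_prop_measurable[OF m] previous_filter_measurable(1)[OF m])
     (use m k t in auto)

text \<open>Strict positivity is what later allows \<open>H\<close> to be cancelled from a vanishing
  integral in \<open>AE_X_join\<close>.\<close>

lemma H_join_pos:
  assumes m: "m \<in> {1..M}" and k: "k \<in> {1..m} \<rightarrow> {1..K}" and t: "t \<le> m * T" and \<omega>: "\<omega> \<in> space P"
  shows "0 < H_join T K w Xt B m t k \<omega>"
  unfolding H_join_def
  by (intro mult_pos_pos prod_pos ballI H_res_pos \<omega>) (use m k t in auto)

text \<open>The resampling weight cancels against the denominator put into \<open>H_prop\<close>;
  \<open>W_norm_pos\<close> excludes division by zero. All compensation of resampling rests on this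
  identity.\<close>

lemma W_times_H_join_prop:
  assumes m: "m \<in> {1..M}" and k: "k \<in> {1..m} \<rightarrow> {1..K}" and t: "t \<in> {(m - 1) * T<..m * T}" and \<omega>: "\<omega> \<in> space P"
  shows "real K * W_norm T K w Xt B m t (k m) \<omega> * H_join_prop T K w Xt B m t k \<omega> = H_join T K w Xt B m (t - 1) k \<omega>"
proof -
  have "k m \<in> {1..K}" using k m by auto
  from W_norm_pos[OF m t this \<omega>] K_pos show ?thesis
    by (simp add: H_join_prop_def H_join_def H_prop_def)
qed

text \<open>Identifies the kernel on whole joined paths with the density from which the algorithm
  samples: the restriction to the current block is the path of the particle itself.\<close>

lemma q_step_X_join:
  assumes m: "m \<in> {1..M}" and t: "t \<in> {(m - 1) * T<..m * T}"
  shows "q_step (t - 1) (X_join T Xt B m (t - 1) k \<omega>) x = q t (X_res T Xt B m (t - 1) (k m) \<omega>) x"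
proof -
  have "start T t = (m - 1) * T" by (rule start_eq) (use m t in auto)
  moreover have "Suc (t - 1) = t" using t by auto
  moreover have "restrict (X_join T Xt B m (t - 1) k \<omega>) {(m - 1) * T<..<t} = X_res T Xt B m (t - 1) (k m) \<omega>"
    by (auto simp: fun_eq_iff X_join_def join_paths_def restrict_def X_res_undefined)
  ultimately show ?thesis by (simp add: q_step_def)
qed

end

section \<open>Conditional laws given the past of all filters\<close>

text \<open>Turns an almost sure formula for a conditional probability into an identity between
  measures on \<open>G\<close>. The function \<open>h\<close> need only be measurable with respect
  to \<open>M\<close>.\<close>

lemma (in prob_space) emeasure_inter_eq_cond_prob:
  assumes G: "subalgebra M G" and E[measurable]: "E \<in> sets M"
    and h[measurable]: "h \<in> borel_measurable M" "\<And>x. x \<in> space M \<Longrightarrow> 0 \<le> h x"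
    and ae: "AE x in M. real_cond_exp M G (indicator E) x = h x"
    and A: "A \<in> sets G"
  shows "emeasure M (A \<inter> E) = (\<integral>\<^sup>+x. ennreal (h x) * indicator A x \<partial>M)"
proof -
  interpret s: finite_measure_subalgebra M G by unfold_locales (rule G)
  have [measurable]: "A \<in> sets M" using A G by (auto simp: subalgebra_def)
  have iE: "integrable M (indicator E :: 'a \<Rightarrow> real)"
    by (simp add: integrable_indicator_iff less_top[symmetric])
  have "integrable M (real_cond_exp M G (indicator E)) \<longleftrightarrow> integrable M h"
    by (rule integrable_cong_AE) (use ae in auto)
  then have ih: "integrable M h" using s.real_cond_exp_int(1)[OF iE] by simp
  have "(\<integral>\<^sup>+x. ennreal (h x) * indicator A x \<partial>M) = (\<integral>\<^sup>+x. ennreal (indicator A x * h x) \<partial>M)"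
    by (intro nn_integral_cong) (auto simp: indicator_def)
  also have "\<dots> = ennreal (\<integral>x. indicator A x * h x \<partial>M)"
    by (rule nn_integral_eq_integral)
       (use integrable_mult_indicator[OF _ ih, of A] h in \<open>auto intro!: AE_I2\<close>)
  also have "(\<integral>x. indicator A x * h x \<partial>M) = (\<integral>x\<in>A. real_cond_exp M G (indicator E) x \<partial>M)"
    unfolding set_lebesgue_integral_def by (rule integral_cong_AE) (use ae in auto)
  also have "\<dots> = (\<integral>x\<in>A. indicator E x \<partial>M)"
    by (rule s.real_cond_exp_intA[OF iE A, symmetric])
  also have "\<dots> = prob (A \<inter> E)"
    unfolding set_lebesgue_integral_def by (simp flip: indicator_inter_arith)
  finally show ?thesis by (simp add: emeasure_eq_measure)
qed

lemma prob_space_density: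
  assumes "prob_density \<mu> f"
  shows "prob_space (density \<mu> (\<lambda>x. ennreal (f x)))"
proof (rule prob_spaceI)
  let ?D = "density \<mu> (\<lambda>x. ennreal (f x))"
  have "emeasure ?D (space ?D) = (\<integral>\<^sup>+x. 1 \<partial>?D)" by simp
  also have "\<dots> = (\<integral>\<^sup>+x. ennreal (f x) * 1 \<partial>\<mu>)"
    by (rule nn_integral_density) (use assms in \<open>auto simp: prob_density_def\<close>)
  also have "\<dots> = 1" using assms by (simp add: prob_density_def)
  finally show "emeasure ?D (space ?D) = 1" .
qed

context particle_filters
begin

text \<open>Groups the independent histories of single filters into those before \<open>m\<close>
  and that of \<open>m\<close>; each generator at a stage \<open>s\<close> lies in the history of
  filter \<open>filt T s\<close>.\<close>

lemma past_filters_indep: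
  assumes m: "m \<in> {1..M}"
  shows "indep_set (sets (Hs 0 (2 * ((m - 1) * T)))) (sets (Hs ((m - 1) * T) (2 * m * T)))"
proof -
  define E where "E n = sets (Hs ((n - 1) * T) (2 * n * T))" for n
  \<comment> \<open>Indexed by \<open>bool\<close> to match \<open>indep_set\<close>. For
    \<open>m = 1\<close> the first group is empty and generates the trivial
    \<sigma>-algebra.\<close>
  define I where "I = case_bool {1..m - 1} {m}"
  have UI: "(\<Union>b. I b) \<subseteq> {1..M}" using m by (auto simp: I_def UNIV_bool)
  have "indep_sets (\<lambda>b. sigma_sets (space P) (\<Union>n\<in>I b. E n)) UNIV"
  proof (rule indep_sets_collect_sigma)
    show "indep_sets E (\<Union>b. I b)"
      using indep_sets_mono_index[OF UI filters_indep] unfolding E_def .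
    show "Int_stable (E n)" for n by (simp add: E_def sets.Int_stable)
    show "disjoint_family I"
      using m by (auto simp: disjoint_family_on_def I_def split: bool.split)
  qed
  moreover have "sets (Hs 0 (2 * ((m - 1) * T))) \<subseteq> sigma_sets (space P) (\<Union>n\<in>{1..m - 1}. E n)"
    unfolding sets_history[of P _ _ _ _ 0]
  proof (rule sigma_sets_mono, safe)
    fix s k S assume s: "0 < s" "2 * s - 1 \<le> 2 * ((m - 1) * T)" and k: "k \<in> {1..K}" and S: "S \<in> sets \<mu>"
    have s': "s \<le> (m - 1) * T" using s by linarith
    have n: "filt T s \<in> {1..m - 1}" "(filt T s - 1) * T < s" "s \<le> filt T s * T"
      using filt_bounds[of s T] filt_le[OF _ T_pos s'] s T_pos by auto
    have "2 * s - 1 \<le> 2 * filt T s * T" using n(3) by simp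
    with n k S have "Xt s k -` S \<inter> space P \<in> E (filt T s)"
      unfolding E_def sets_history by (intro sigma_sets.Basic UnI1) blast
    with n show "Xt s k -` S \<inter> space P \<in> sigma_sets (space P) (\<Union>n\<in>{1..m - 1}. E n)"
      by (intro sigma_sets.Basic) blast
  next
    fix s k i assume s: "0 < s" "2 * s \<le> 2 * ((m - 1) * T)" and k: "k \<in> {1..K}" "i \<in> {1..K}"
    have s': "s \<le> (m - 1) * T" using s by linarith
    have n: "filt T s \<in> {1..m - 1}" "(filt T s - 1) * T < s" "s \<le> filt T s * T"
      using filt_bounds[of s T] filt_le[OF _ T_pos s'] s T_pos by auto
    have "2 * s \<le> 2 * filt T s * T" using n(3) by simp
    with n k have "B s k -` {i} \<inter> space P \<in> E (filt T s)"
      unfolding E_def sets_history by (intro sigma_sets.Basic UnI2) blast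
    with n show "B s k -` {i} \<inter> space P \<in> sigma_sets (space P) (\<Union>n\<in>{1..m - 1}. E n)"
      by (intro sigma_sets.Basic) blast
  qed
  moreover have "E m \<subseteq> sigma_sets (space P) (\<Union>n\<in>{m}. E n)" by (auto intro: sigma_sets.Basic)
  ultimately show ?thesis
    unfolding indep_set_def E_def[symmetric]
    by (elim indep_sets_mono_sets) (auto simp: I_def split: bool.split)
qed

lemma sets_history_split:
  "sets (Hs 0 u) \<subseteq> sigma_sets (space P) (sets (Hs 0 (2 * a)) \<union> sets (Hs a u))"
  unfolding sets_history[of P \<mu> K Xt B 0 u]
proof (rule sigma_sets_mono, safe)
  fix s k S assume s: "0 < s" "2 * s - 1 \<le> u" and k: "k \<in> {1..K}" and S: "S \<in> sets \<mu>"
  show "Xt s k -` S \<inter> space P \<in> sigma_sets (space P) (sets (Hs 0 (2 * a)) \<union> sets (Hs a u))"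
  proof (cases "s \<le> a")
    case True
    then have "2 * s - 1 \<le> 2 * a" by simp
    then have "Xt s k -` S \<inter> space P \<in> sets (Hs 0 (2 * a))"
      unfolding sets_history using s k S by (intro sigma_sets.Basic UnI1) blast
    then show ?thesis by blast
  next
    case False
    then have "a < s" by simp
    then have "Xt s k -` S \<inter> space P \<in> sets (Hs a u)"
      unfolding sets_history using s k S by (intro sigma_sets.Basic UnI1) blast
    then show ?thesis by blast
  qed
next
  fix s k i assume s: "0 < s" "2 * s \<le> u" and k: "k \<in> {1..K}" "i \<in> {1..K}"
  show "B s k -` {i} \<inter> space P \<in> sigma_sets (space P) (sets (Hs 0 (2 * a)) \<union> sets (Hs a u))"
  proof (cases "s \<le> a")
    case True
    then have "2 * s \<le> 2 * a" by simp
    then have "B s k -` {i} \<inter> space P \<in> sets (Hs 0 (2 * a))"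
      unfolding sets_history using s k by (intro sigma_sets.Basic UnI2) blast
    then show ?thesis by blast
  next
    case False
    then have "a < s" by simp
    then have "B s k -` {i} \<inter> space P \<in> sets (Hs a u)"
      unfolding sets_history using s k by (intro sigma_sets.Basic UnI2) blast
    then show ?thesis by blast
  qed
qed

text \<open>Carries the hypotheses of the model, which see one filter only, over to the filtration
  of the whole algorithm.\<close>

lemma cond_prob_all_filters:
  assumes m: "m \<in> {1..M}" and u: "u \<le> 2 * m * T"
    and E: "E \<in> sets (Hs ((m - 1) * T) (2 * m * T))"
  shows "AE \<omega> in P. real_cond_exp P (Hs 0 u) (indicator E) \<omega> =
    real_cond_exp P (Hs ((m - 1) * T) u) (indicator E) \<omega>"
proof (rule real_cond_exp_indep_join)
  have "m * T \<le> U" using block_le[OF m order_refl] .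
  then show "subalgebra P (Hs 0 u)" using u by (intro subalgebra_history) linarith
  show "subalgebra (Hs 0 u) (Hs ((m - 1) * T) u)"
    using sets_history_mono[of 0 "(m - 1) * T" u u P \<mu> K Xt B] by (simp add: subalgebra_def)
  show "sets (Hs 0 u) \<subseteq> sigma_sets (space P) (sets (Hs 0 (2 * ((m - 1) * T))) \<union> sets (Hs ((m - 1) * T) u))"
    by (rule sets_history_split)
  show "sets (Hs ((m - 1) * T) u) \<subseteq> sets (Hs ((m - 1) * T) (2 * m * T))"
    by (rule sets_history_mono) (use u in auto)
qed (use past_filters_indep[OF m] E in auto)

section \<open>The sampling step given the past\<close>

lemma X_res_in_domain:
  assumes m: "m \<in> {1..M}" and t: "t \<in> {(m - 1) * T<..m * T}" and k: "k \<in> {1..K}" and \<omega>: "\<omega> \<in> space P"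
  shows "X_res T Xt B m (t - 1) k \<omega> \<in> space (path_space \<mu> {start T t<..<t})"
proof -
  have "X_res T Xt B m (t - 1) k \<in> measurable (Hs 0 (2 * (t - 1))) (path_space \<mu> {(m - 1) * T<..t - 1})"
    by (rule X_res_measurable[OF m]) (use t k in auto)
  from measurable_space[OF this] \<omega>
  have "X_res T Xt B m (t - 1) k \<omega> \<in> space (path_space \<mu> {(m - 1) * T<..t - 1})" by simp
  moreover have "{(m - 1) * T<..t - 1} = {(m - 1) * T<..<t}" using t by auto
  moreover have "start T t = (m - 1) * T" by (rule start_eq) (use m t in auto)
  ultimately show ?thesis by simp
qed

lemma sampling_density:
  assumes m: "m \<in> {1..M}" and t: "t \<in> {(m - 1) * T<..m * T}" and k: "k \<in> {1..K}" and \<omega>: "\<omega> \<in> space P"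
  shows "prob_density \<mu> (q t (X_res T Xt B m (t - 1) k \<omega>))"
proof (rule q_density[OF _ X_res_in_domain[OF assms]])
  show "t \<in> {1..U}" using block_le[OF m, of t] t by auto
qed

lemma sampling_density_measurable:
  assumes m: "m \<in> {1..M}" and t: "t \<in> {(m - 1) * T<..m * T}" and k: "k \<in> {1..K}" and u: "2 * t - 2 \<le> u"
  shows "(\<lambda>(\<omega>, x). q t (X_res T Xt B m (t - 1) k \<omega>) x) \<in> borel_measurable (Hs 0 u \<Otimes>\<^sub>M \<mu>)"
proof -
  have st: "start T t = (m - 1) * T" by (rule start_eq) (use m t in auto)
  have set: "{(m - 1) * T<..t - 1} = {(m - 1) * T<..<t}" using t by auto
  have [measurable]: "X_res T Xt B m (t - 1) k \<in> measurable (Hs 0 u) (path_space \<mu> {start T t<..<t})"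
    unfolding st set[symmetric]
    by (rule X_res_measurable[OF m]) (use t k u in auto)
  have [measurable]: "(\<lambda>(h, x). q t h x) \<in> borel_measurable (path_space \<mu> {start T t<..<t} \<Otimes>\<^sub>M \<mu>)"
    by (rule q_measurable) (use block_le[OF m, of t] t in auto)
  show ?thesis by measurable
qed

lemma sampling_one:
  assumes m: "m \<in> {1..M}" and t: "t \<in> {(m - 1) * T<..m * T}" and k: "k \<in> {1..K}" and S: "S \<in> sets \<mu>"
  shows "AE \<omega> in P. real_cond_exp P (Hs 0 (2 * t - 2)) (indicator {\<omega> \<in> space P. Xt t k \<omega> \<in> S}) \<omega> =
    measure (density \<mu> (\<lambda>x. ennreal (q t (X_res T Xt B m (t - 1) k \<omega>) x))) S"
proof -
  \<comment> \<open>Leaves the other particles free, so that their factors in the product are total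
    masses of probability densities.\<close>
  define S' where "S' i = (if i = k then S else space \<mu>)" for i
  have tU: "t \<in> {1..U}" using block_le[OF m, of t] t by auto
  have "{\<omega> \<in> space P. \<forall>i\<in>{1..K}. Xt t i \<omega> \<in> S' i} = {\<omega> \<in> space P. Xt t k \<omega> \<in> S}"
    using k measurable_space[OF Xt_measurable[OF tU]] by (auto simp: S'_def)
  moreover have "AE \<omega> in P.
        real_cond_exp P (Hs ((m - 1) * T) (2 * t - 2))
          (indicator {\<omega> \<in> space P. \<forall>k\<in>{1..K}. Xt t k \<omega> \<in> S' k}) \<omega> =
        (\<Prod>k=1..K. measure (density \<mu> (\<lambda>x. ennreal (q t (X_res T Xt B m (t - 1) k \<omega>) x))) (S' k))"
    by (rule sampling[OF m t]) (use S in \<open>auto simp: S'_def\<close>)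
  moreover have "AE \<omega> in P. (\<Prod>k=1..K. measure (density \<mu> (\<lambda>x. ennreal (q t (X_res T Xt B m (t - 1) k \<omega>) x))) (S' k)) =
     measure (density \<mu> (\<lambda>x. ennreal (q t (X_res T Xt B m (t - 1) k \<omega>) x))) S"
  proof (rule AE_I2)
    fix \<omega> assume \<omega>: "\<omega> \<in> space P"
    define D where "D i = density \<mu> (\<lambda>x. ennreal (q t (X_res T Xt B m (t - 1) i \<omega>) x))" for i
    have "measure (D i) (S' i) = 1" if "i \<in> {1..K}" "i \<noteq> k" for i
    proof -
      interpret D: prob_space "D i"
        unfolding D_def by (rule prob_space_density[OF sampling_density[OF m t that(1) \<omega>]])
      show ?thesis using D.prob_space that(2) by (simp add: S'_def D_def)
    qed
    then have "(\<Prod>i=1..K. measure (D i) (S' i)) = (\<Prod>i=1..K. if i = k then measure (D k) S else 1)"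
      by (intro prod.cong) (auto simp: S'_def)
    also have "\<dots> = measure (D k) S" using k by simp
    finally show "(\<Prod>i=1..K. measure (density \<mu> (\<lambda>x. ennreal (q t (X_res T Xt B m (t - 1) i \<omega>) x))) (S' i)) =
       measure (density \<mu> (\<lambda>x. ennreal (q t (X_res T Xt B m (t - 1) k \<omega>) x))) S"
      unfolding D_def .
  qed
  moreover have "AE \<omega> in P. real_cond_exp P (Hs 0 (2 * t - 2)) (indicator {\<omega> \<in> space P. Xt t k \<omega> \<in> S}) \<omega> =
      real_cond_exp P (Hs ((m - 1) * T) (2 * t - 2)) (indicator {\<omega> \<in> space P. Xt t k \<omega> \<in> S}) \<omega>"
  proof (rule cond_prob_all_filters[OF m])
    show "2 * t - 2 \<le> 2 * m * T" using t by auto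
    have "Xt t k \<in> measurable (Hs ((m - 1) * T) (2 * m * T)) \<mu>"
      by (rule Xt_history) (use t k tU in auto)
    from measurable_sets[OF this S]
    show "{\<omega> \<in> space P. Xt t k \<omega> \<in> S} \<in> sets (Hs ((m - 1) * T) (2 * m * T))"
      by (simp add: vimage_def Int_def conj_commute)
  qed
  ultimately show ?thesis by auto
qed

text \<open>Keeps the whole sample point \<open>\<omega>\<close> as the past, but only with the
  \<sigma>-algebra of the past. Both measures agree on rectangles by \<open>sampling_one\<close>,
  and rectangles generate the product.\<close>

lemma sampling_joint_law:
  assumes m: "m \<in> {1..M}" and t: "t \<in> {(m - 1) * T<..m * T}" and k: "k \<in> {1..K}"
  shows "distr P (Hs 0 (2 * t - 2) \<Otimes>\<^sub>M \<mu>) (\<lambda>\<omega>. (\<omega>, Xt t k \<omega>)) =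
    density (restr_to_subalg P (Hs 0 (2 * t - 2)) \<Otimes>\<^sub>M \<mu>) (\<lambda>(\<omega>, x). ennreal (q t (X_res T Xt B m (t - 1) k \<omega>) x))"
    (is "?L = ?R")
proof -
  define G where "G = Hs 0 (2 * t - 2)"
  \<comment> \<open>\<open>P\<close> on the coarser \<sigma>-algebra \<open>G\<close>, so that
    functions on the product depend on \<open>\<omega>\<close> through the past only.\<close>
  define N where "N = restr_to_subalg P G"
  define c where "c \<omega> x = q t (X_res T Xt B m (t - 1) k \<omega>) x" for \<omega> x
  have tU: "t \<in> {1..U}" using block_le[OF m, of t] t by auto
  have G: "subalgebra P G" unfolding G_def by (rule subalgebra_history) (use tU in auto)
  have spG[simp]: "space G = space P" by (simp add: G_def)
  have sN[measurable_cong]: "sets N = sets G" unfolding N_def by (rule sets_restr_to_subalg[OF G])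
  have spN[simp]: "space N = space P" by (simp add: N_def space_restr_to_subalg)
  have c[measurable]: "(\<lambda>(\<omega>, x). c \<omega> x) \<in> borel_measurable (G \<Otimes>\<^sub>M \<mu>)"
    unfolding c_def G_def by (rule sampling_density_measurable[OF m t k order_refl])
  have X[measurable]: "Xt t k \<in> measurable P \<mu>" by (rule Xt_measurable[OF tU k])
  have idG: "(\<lambda>\<omega>. \<omega>) \<in> measurable P G"
    using G by (auto simp: measurable_def subalgebra_def)
  have L[measurable]: "(\<lambda>\<omega>. (\<omega>, Xt t k \<omega>)) \<in> measurable P (G \<Otimes>\<^sub>M \<mu>)" by (rule measurable_Pair[OF idG X])
  define C where "C = {a \<times> b | a b. a \<in> sets G \<and> b \<in> sets \<mu>}"
  define \<Omega> where "\<Omega> = space P \<times> space \<mu>"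
  have "distr P (G \<Otimes>\<^sub>M \<mu>) (\<lambda>\<omega>. (\<omega>, Xt t k \<omega>)) = density (N \<Otimes>\<^sub>M \<mu>) (\<lambda>(\<omega>, x). ennreal (c \<omega> x))"
    (is "?L = ?R")
  proof (rule measure_eqI_generator_eq[where E = C and \<Omega> = \<Omega> and A = "\<lambda>_. \<Omega>"])
    show "Int_stable C" unfolding C_def by (rule Int_stable_pair_measure_generator)
    show "C \<subseteq> Pow \<Omega>"
    proof
      fix Z assume "Z \<in> C"
      then obtain a b where Z: "Z = a \<times> b" and "a \<in> sets G" "b \<in> sets \<mu>" unfolding C_def by auto
      then have "a \<subseteq> space G" "b \<subseteq> space \<mu>" by (simp_all only: sets.sets_into_space)
      then show "Z \<in> Pow \<Omega>" unfolding Z \<Omega>_def by auto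
    qed
    show "sets ?L = sigma_sets \<Omega> C" by (simp add: sets_pair_measure C_def \<Omega>_def)
    show "sets ?R = sigma_sets \<Omega> C" by (simp add: sets_pair_measure C_def \<Omega>_def sN)
    have "space P \<in> sets G" using sets.top[of G] by simp
    then show "range (\<lambda>_. \<Omega>) \<subseteq> C" unfolding C_def \<Omega>_def by auto
    show "emeasure ?L \<Omega> \<noteq> \<infinity>"
      using finite_measure.emeasure_finite[OF finite_measure_distr[OF L], of \<Omega>] by simp
    fix Z assume "Z \<in> C"
    then obtain A S where Z: "Z = A \<times> S" and A: "A \<in> sets G" and S: "S \<in> sets \<mu>" unfolding C_def by auto
    note [measurable] = A S
    define h where "h \<omega> = (\<integral>\<^sup>+x. ennreal (c \<omega> x) * indicator S x \<partial>\<mu>)" for \<omega>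
    have h[measurable]: "h \<in> borel_measurable G" 
      unfolding h_def by measurable
    have hm: "h \<omega> = ennreal (measure (density \<mu> (\<lambda>x. ennreal (c \<omega> x))) S)" if \<omega>: "\<omega> \<in> space P" for \<omega>
    proof -
      have pd: "prob_density \<mu> (c \<omega>)"
        unfolding c_def[abs_def] by (rule sampling_density[OF m t k \<omega>])
      interpret D: prob_space "density \<mu> (\<lambda>x. ennreal (c \<omega> x))" by (rule prob_space_density[OF pd])
      have "emeasure (density \<mu> (\<lambda>x. ennreal (c \<omega> x))) S = h \<omega>"
        unfolding h_def
      proof (rule emeasure_density[OF _ S])
        have "c \<omega> \<in> borel_measurable \<mu>" using pd by (simp only: prob_density_def)
        then show "(\<lambda>x. ennreal (c \<omega> x)) \<in> borel_measurable \<mu>"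
          by (rule measurable_compose[OF _ measurable_ennreal])
      qed
      then show ?thesis by (simp add: D.emeasure_eq_measure)
    qed
    have hP: "h \<in> borel_measurable P" by (rule measurable_from_subalg[OF G h])
    have "emeasure ?L Z = emeasure P (A \<inter> {\<omega> \<in> space P. Xt t k \<omega> \<in> S})"
      using sets.sets_into_space[OF A]
      by (subst emeasure_distr) (auto simp: Z intro!: arg_cong[where f = "emeasure P"])
    also have "\<dots> = (\<integral>\<^sup>+\<omega>. ennreal (enn2real (h \<omega>)) * indicator A \<omega> \<partial>P)"
    proof (rule emeasure_inter_eq_cond_prob[OF G])
      show "AE \<omega> in P. real_cond_exp P G (indicator {\<omega> \<in> space P. Xt t k \<omega> \<in> S}) \<omega> = enn2real (h \<omega>)"
        using sampling_one[OF m t k S] AE_space unfolding G_def[symmetric]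
        by eventually_elim (simp add: hm c_def)
    qed (use A hP in auto)
    also have "\<dots> = (\<integral>\<^sup>+\<omega>. h \<omega> * indicator A \<omega> \<partial>P)"
      by (rule nn_integral_cong) (simp add: hm)
    also have "\<dots> = (\<integral>\<^sup>+\<omega>. h \<omega> * indicator A \<omega> \<partial>N)"
      unfolding N_def by (rule nn_integral_subalgebra2[OF G, symmetric]) measurable
    also have "\<dots> = (\<integral>\<^sup>+\<omega>. (\<integral>\<^sup>+x. ennreal (c \<omega> x) * indicator Z (\<omega>, x) \<partial>\<mu>) \<partial>N)"
      by (rule nn_integral_cong) (auto simp: h_def Z indicator_def)
    also have "\<dots> = (\<integral>\<^sup>+z. (case z of (\<omega>, x) \<Rightarrow> ennreal (c \<omega> x)) * indicator Z z \<partial>(N \<Otimes>\<^sub>M \<mu>))"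
      by (subst \<mu>.nn_integral_fst[symmetric]) (auto simp: Z)
    also have "\<dots> = emeasure ?R Z"
      by (rule emeasure_density[symmetric]) (auto simp: Z)
    finally show "emeasure ?L Z = emeasure ?R Z" .
  qed auto
  then show ?thesis unfolding G_def N_def c_def .
qed

lemma nn_integral_sampling:
  assumes m: "m \<in> {1..M}" and t: "t \<in> {(m - 1) * T<..m * T}" and k: "k \<in> {1..K}"
    and \<Phi>[measurable]: "(\<lambda>(\<omega>, x). \<Phi> \<omega> x) \<in> borel_measurable (Hs 0 (2 * t - 2) \<Otimes>\<^sub>M \<mu>)"
  shows "(\<integral>\<^sup>+\<omega>. \<Phi> \<omega> (Xt t k \<omega>) \<partial>P) =
    (\<integral>\<^sup>+\<omega>. (\<integral>\<^sup>+x. ennreal (q t (X_res T Xt B m (t - 1) k \<omega>) x) * \<Phi> \<omega> x \<partial>\<mu>) \<partial>P)"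
proof -
  define G where "G = Hs 0 (2 * t - 2)"
  note [measurable] = \<Phi>[folded G_def]
  have tU: "t \<in> {1..U}" using block_le[OF m, of t] t by auto
  have G: "subalgebra P G" unfolding G_def by (rule subalgebra_history) (use tU in auto)
  note [measurable_cong] = sets_restr_to_subalg[OF G]
  have [measurable]: "(\<lambda>(\<omega>, x). q t (X_res T Xt B m (t - 1) k \<omega>) x) \<in> borel_measurable (G \<Otimes>\<^sub>M \<mu>)"
    unfolding G_def by (rule sampling_density_measurable[OF m t k order_refl])
  have idG: "(\<lambda>\<omega>. \<omega>) \<in> measurable P G"
    using G by (auto simp: measurable_def subalgebra_def)
  have [measurable]: "(\<lambda>\<omega>. (\<omega>, Xt t k \<omega>)) \<in> measurable P (G \<Otimes>\<^sub>M \<mu>)"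
    by (rule measurable_Pair[OF idG Xt_measurable[OF tU k]])
  have "(\<integral>\<^sup>+\<omega>. \<Phi> \<omega> (Xt t k \<omega>) \<partial>P) =
      (\<integral>\<^sup>+z. (\<lambda>(\<omega>, x). \<Phi> \<omega> x) z \<partial>distr P (G \<Otimes>\<^sub>M \<mu>) (\<lambda>\<omega>. (\<omega>, Xt t k \<omega>)))"
    by (subst nn_integral_distr) auto
  also have "\<dots> = (\<integral>\<^sup>+z. (case z of (\<omega>, x) \<Rightarrow> ennreal (q t (X_res T Xt B m (t - 1) k \<omega>) x)) *
      (case z of (\<omega>, x) \<Rightarrow> \<Phi> \<omega> x) \<partial>(restr_to_subalg P G \<Otimes>\<^sub>M \<mu>))"
    unfolding G_def sampling_joint_law[OF m t k] unfolding G_def[symmetric]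
    by (subst nn_integral_density) auto
  also have "\<dots> = (\<integral>\<^sup>+\<omega>. (\<integral>\<^sup>+x. ennreal (q t (X_res T Xt B m (t - 1) k \<omega>) x) * \<Phi> \<omega> x \<partial>\<mu>) \<partial>restr_to_subalg P G)"
    by (subst \<mu>.nn_integral_fst[symmetric]) auto
  also have "\<dots> = (\<integral>\<^sup>+\<omega>. (\<integral>\<^sup>+x. ennreal (q t (X_res T Xt B m (t - 1) k \<omega>) x) * \<Phi> \<omega> x \<partial>\<mu>) \<partial>P)"
    by (rule nn_integral_subalgebra2[OF G]) measurable
  finally show ?thesis .
qed

text \<open>The signed form of \<open>nn_integral_sampling\<close>. Integrability of the composed
  variable is a hypothesis; the change of measure supplies it.\<close>

lemma integral_sampling:
  fixes v :: "'w \<Rightarrow> 'a \<Rightarrow> real"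
  assumes m: "m \<in> {1..M}" and t: "t \<in> {(m - 1) * T<..m * T}" and k: "k \<in> {1..K}"
    and v[measurable]: "(\<lambda>(\<omega>, x). v \<omega> x) \<in> borel_measurable (Hs 0 (2 * t - 2) \<Otimes>\<^sub>M \<mu>)"
    and i: "integrable P (\<lambda>\<omega>. v \<omega> (Xt t k \<omega>))"
  shows "(\<integral>\<omega>. v \<omega> (Xt t k \<omega>) \<partial>P) =
    (\<integral>\<omega>. (\<integral>x. q t (X_res T Xt B m (t - 1) k \<omega>) x * v \<omega> x \<partial>\<mu>) \<partial>P)"
proof -
  define G where "G = Hs 0 (2 * t - 2)"
  note [measurable] = v[folded G_def]
  have tU: "t \<in> {1..U}" using block_le[OF m, of t] t by auto
  have G: "subalgebra P G" unfolding G_def by (rule subalgebra_history) (use tU in auto)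
  note [measurable_cong] = sets_restr_to_subalg[OF G]
  interpret N: prob_space "restr_to_subalg P G"
    by (rule prob_space_restr_to_subalg[OF G]) unfold_locales
  interpret pair_sigma_finite "restr_to_subalg P G" \<mu> by unfold_locales
  have c[measurable]: "(\<lambda>(\<omega>, x). q t (X_res T Xt B m (t - 1) k \<omega>) x) \<in> borel_measurable (G \<Otimes>\<^sub>M \<mu>)"
    unfolding G_def by (rule sampling_density_measurable[OF m t k order_refl])
  have idG: "(\<lambda>\<omega>. \<omega>) \<in> measurable P G"
    using G by (auto simp: measurable_def subalgebra_def)
  have [measurable]: "(\<lambda>\<omega>. (\<omega>, Xt t k \<omega>)) \<in> measurable P (G \<Otimes>\<^sub>M \<mu>)"
    by (rule measurable_Pair[OF idG Xt_measurable[OF tU k]])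
  let ?c = "\<lambda>z. q t (X_res T Xt B m (t - 1) k (fst z)) (snd z)" and ?v = "\<lambda>z. v (fst z) (snd z)"
  let ?D = "density (restr_to_subalg P G \<Otimes>\<^sub>M \<mu>) (\<lambda>z. ennreal (?c z))"
  have c': "?c \<in> borel_measurable (restr_to_subalg P G \<Otimes>\<^sub>M \<mu>)"
      "\<And>z. z \<in> space (restr_to_subalg P G \<Otimes>\<^sub>M \<mu>) \<Longrightarrow> 0 \<le> ?c z"
    using sampling_density[OF m t k]
    by (measurable, auto simp: space_pair_measure space_restr_to_subalg prob_density_def)
  have D: "distr P (G \<Otimes>\<^sub>M \<mu>) (\<lambda>\<omega>. (\<omega>, Xt t k \<omega>)) = ?D"
    using sampling_joint_law[OF m t k] unfolding G_def by (simp add: case_prod_beta')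
  have iD: "integrable ?D ?v"
    unfolding D[symmetric] using i by (subst integrable_distr_eq) auto
  have "(\<integral>\<omega>. v \<omega> (Xt t k \<omega>) \<partial>P) = (\<integral>z. ?v z \<partial>?D)"
    unfolding D[symmetric] by (subst integral_distr) auto
  also have "\<dots> = (\<integral>\<omega>. (\<integral>x. q t (X_res T Xt B m (t - 1) k \<omega>) x * v \<omega> x \<partial>\<mu>) \<partial>restr_to_subalg P G)"
    using integral_density_pair(3)[OF c' iD] by simp
  also have "\<dots> = (\<integral>\<omega>. (\<integral>x. q t (X_res T Xt B m (t - 1) k \<omega>) x * v \<omega> x \<partial>\<mu>) \<partial>P)"
    by (rule integral_subalgebra2[OF G]) measurable
  finally show ?thesis .
qed

section \<open>The resampling step given the past\<close>

lemma B_event: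
  assumes "t \<in> {1..U}" "i \<in> {1..K}" "r < t" "2 * t \<le> u"
  shows "{\<omega> \<in> space P. B t i \<omega> = j} \<in> sets (Hs r u)"
proof -
  have "B t i -` ({j} \<inter> {1..K}) \<inter> space (Hs r u) \<in> sets (Hs r u)"
    by (rule measurable_sets[OF B_history]) (use assms in auto)
  moreover have "B t i -` ({j} \<inter> {1..K}) \<inter> space (Hs r u) = {\<omega> \<in> space P. B t i \<omega> = j}"
    using B_range[OF _ assms(1,2)] by auto
  ultimately show ?thesis by simp
qed

text \<open>A marginal of the joint law of all indices: the event is the disjoint union of the joint
  outcomes \<open>b\<close> with \<open>b i = j\<close>, and in the sum of products every coordinate
  other than \<open>i\<close> contributes the total weight one.\<close>

lemma resampling_one:
  assumes m: "m \<in> {1..M}" and t: "t \<in> {(m - 1) * T<..m * T}" and i: "i \<in> {1..K}" and j: "j \<in> {1..K}"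
  shows "AE \<omega> in P. real_cond_exp P (Hs 0 (2 * t - 1)) (indicator {\<omega> \<in> space P. B t i \<omega> = j}) \<omega> =
    W_norm T K w Xt B m t j \<omega>"
proof -
  define G where "G = Hs ((m - 1) * T) (2 * t - 1)"
  have tU: "t \<in> {1..U}" using block_le[OF m, of t] t by auto
  have G: "subalgebra P G" unfolding G_def by (rule subalgebra_history) (use tU in auto)
  interpret G: finite_measure_subalgebra P G by unfold_locales (rule G)
  define Z where "Z = {b \<in> {1..K} \<rightarrow>\<^sub>E {1..K}. b i = j}"
  define E where "E b = {\<omega> \<in> space P. \<forall>k\<in>{1..K}. B t k \<omega> = b k}" for b
  have finZ: "finite Z" unfolding Z_def by (rule finite_subset[OF Collect_restrict finite_PiE]) auto
  have EP[measurable]: "E b \<in> sets P" for b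
  proof -
    have "subalgebra P (Hs 0 (2 * U))" by (rule subalgebra_history) simp
    moreover have "{\<omega> \<in> space P. B t k \<omega> = b k} \<in> sets (Hs 0 (2 * U))" if "k \<in> {1..K}" for k
      by (rule B_event) (use tU that in auto)
    ultimately have "{\<omega> \<in> space P. B t k \<omega> = b k} \<in> sets P" if "k \<in> {1..K}" for k
      using that by (auto simp: subalgebra_def)
    then have "space P \<inter> (\<Inter>k\<in>{1..K}. {\<omega> \<in> space P. B t k \<omega> = b k}) \<in> sets P"
      using K_pos by (intro sets.Int sets.finite_INT) auto
    moreover have "space P \<inter> (\<Inter>k\<in>{1..K}. {\<omega> \<in> space P. B t k \<omega> = b k}) = E b" by (auto simp: E_def)
    ultimately show ?thesis by simp
  qed
  have iE: "integrable P (indicator (E b) :: 'w \<Rightarrow> real)" for b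
    by (simp add: integrable_indicator_iff less_top[symmetric])
  have ind: "indicator {\<omega> \<in> space P. B t i \<omega> = j} \<omega> = (\<Sum>b\<in>Z. indicator (E b) \<omega> :: real)"
    if \<omega>: "\<omega> \<in> space P" for \<omega>
  proof -
    define b0 where "b0 = (\<lambda>k\<in>{1..K}. B t k \<omega>)"
    have "indicator (E b) \<omega> = (if b = b0 then 1 else 0 :: real)" if "b \<in> Z" for b
    proof -
      have "\<omega> \<in> E b \<longleftrightarrow> (\<forall>k\<in>{1..K}. B t k \<omega> = b k)" using \<omega> by (simp add: E_def)
      also have "\<dots> \<longleftrightarrow> b = b0"
        using that unfolding Z_def b0_def by (auto simp: PiE_iff extensional_def fun_eq_iff)
      finally show ?thesis by (simp add: indicator_def)
    qed
    then have "(\<Sum>b\<in>Z. indicator (E b) \<omega> :: real) = (if b0 \<in> Z then 1 else 0)"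
      using finZ by simp
    moreover have "b0 \<in> Z \<longleftrightarrow> B t i \<omega> = j"
      using B_range[OF \<omega> tU] i unfolding Z_def b0_def by auto
    ultimately show ?thesis using \<omega> by (simp add: indicator_def)
  qed
  have "AE \<omega> in P. real_cond_exp P G (indicator {\<omega> \<in> space P. B t i \<omega> = j}) \<omega> =
      real_cond_exp P G (\<lambda>\<omega>. \<Sum>b\<in>Z. indicator (E b) \<omega>) \<omega>"
  proof (rule G.real_cond_exp_cong)
    have "subalgebra P (Hs 0 (2 * U))" by (rule subalgebra_history) simp
    moreover have "{\<omega> \<in> space P. B t i \<omega> = j} \<in> sets (Hs 0 (2 * U))"
      by (rule B_event[OF tU i]) (use tU in auto)
    ultimately have "{\<omega> \<in> space P. B t i \<omega> = j} \<in> sets P" by (auto simp: subalgebra_def)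
    then show "indicator {\<omega> \<in> space P. B t i \<omega> = j} \<in> borel_measurable P" by simp
  qed (use ind in auto)
  moreover have "AE \<omega> in P. real_cond_exp P G (\<lambda>\<omega>. \<Sum>b\<in>Z. indicator (E b) \<omega>) \<omega> =
      (\<Sum>b\<in>Z. real_cond_exp P G (indicator (E b)) \<omega>)"
    by (rule G.real_cond_exp_sum) (rule iE)
  moreover have "AE \<omega> in P. \<forall>b\<in>Z. real_cond_exp P G (indicator (E b)) \<omega> = (\<Prod>k=1..K. W_norm T K w Xt B m t (b k) \<omega>)"
    unfolding E_def G_def
    by (rule AE_finite_allI[OF finZ], rule resampling[OF m t]) (auto simp: Z_def)
  moreover have "AE \<omega> in P. (\<Sum>b\<in>Z. (\<Prod>k=1..K. W_norm T K w Xt B m t (b k) \<omega>)) = W_norm T K w Xt B m t j \<omega>"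
  proof (rule AE_I2)
    fix \<omega> assume \<omega>: "\<omega> \<in> space P"
    define W where "W k = W_norm T K w Xt B m t k \<omega>" for k
    \<comment> \<open>Encodes the constraint \<open>b i = j\<close> as zero factors, so that the sum
      runs over a full product set and becomes a product of sums.\<close>
    define F where "F k y = (if k = i \<and> y \<noteq> j then 0 else W y)" for k y
    have "(\<Sum>b\<in>{1..K} \<rightarrow>\<^sub>E {1..K}. \<Prod>k=1..K. F k (b k)) = (\<Prod>k=1..K. \<Sum>y=1..K. F k y)"
      by (rule prod_sum_PiE[symmetric]) auto
    also have "\<dots> = (\<Prod>k=1..K. if k = i then W j else 1)"
    proof (rule prod.cong[OF refl])
      fix k
      have "(\<Sum>y=1..K. if y = j then W y else 0) = W j" using j by simp
      moreover have "(\<Sum>y=1..K. if y \<noteq> j then 0 else W y) = (\<Sum>y=1..K. if y = j then W y else 0)"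
        by (intro sum.cong) auto
      ultimately show "(\<Sum>y=1..K. F k y) = (if k = i then W j else 1)"
        using W_norm_sum[OF m t \<omega>] by (simp add: F_def W_def)
    qed
    also have "\<dots> = W j" using i by simp
    finally have "(\<Sum>b\<in>{1..K} \<rightarrow>\<^sub>E {1..K}. \<Prod>k=1..K. F k (b k)) = W j" .
    moreover have "(\<Sum>b\<in>Z. \<Prod>k=1..K. W (b k)) = (\<Sum>b\<in>{1..K} \<rightarrow>\<^sub>E {1..K}. \<Prod>k=1..K. F k (b k))"
    proof (rule sum.mono_neutral_cong_left)
      show "\<forall>b\<in>({1..K} \<rightarrow>\<^sub>E {1..K}) - Z. (\<Prod>k=1..K. F k (b k)) = 0"
        using i by (auto simp: Z_def F_def intro!: bexI[of _ i])
    qed (auto simp: Z_def F_def finite_PiE intro!: prod.cong)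
    ultimately show "(\<Sum>b\<in>Z. \<Prod>k=1..K. W_norm T K w Xt B m t (b k) \<omega>) = W_norm T K w Xt B m t j \<omega>"
      by (simp add: W_def)
  qed
  moreover have "AE \<omega> in P. real_cond_exp P (Hs 0 (2 * t - 1)) (indicator {\<omega> \<in> space P. B t i \<omega> = j}) \<omega> =
      real_cond_exp P G (indicator {\<omega> \<in> space P. B t i \<omega> = j}) \<omega>"
    unfolding G_def
  proof (rule cond_prob_all_filters[OF m])
    show "2 * t - 1 \<le> 2 * m * T" using t by auto
    show "{\<omega> \<in> space P. B t i \<omega> = j} \<in> sets (Hs ((m - 1) * T) (2 * m * T))"
      by (rule B_event[OF tU i]) (use t in auto)
  qed
  ultimately show ?thesis by eventually_elim simp
qed

text \<open>Given the past, the indicator of drawing \<open>j\<close> may be replaced by its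
  conditional probability, without any integrability of \<open>\<Phi>\<close>.\<close>

lemma nn_integral_resampling:
  assumes m: "m \<in> {1..M}" and t: "t \<in> {(m - 1) * T<..m * T}" and i: "i \<in> {1..K}" and j: "j \<in> {1..K}"
    and \<Phi>[measurable]: "\<Phi> \<in> borel_measurable (Hs 0 (2 * t - 1))"
  shows "(\<integral>\<^sup>+\<omega>. indicator {\<omega> \<in> space P. B t i \<omega> = j} \<omega> * \<Phi> \<omega> \<partial>P) =
    (\<integral>\<^sup>+\<omega>. ennreal (W_norm T K w Xt B m t j \<omega>) * \<Phi> \<omega> \<partial>P)"
proof -
  define G where "G = Hs 0 (2 * t - 1)"
  have tU: "t \<in> {1..U}" using block_le[OF m, of t] t by auto
  have G: "subalgebra P G" unfolding G_def by (rule subalgebra_history) (use tU in auto)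
  define E where "E = {\<omega> \<in> space P. B t i \<omega> = j}"
  have "subalgebra P (Hs 0 (2 * t))" by (rule subalgebra_history) (use tU in auto)
  then have E[measurable]: "E \<in> sets P"
    unfolding E_def using B_event[OF tU i, of 0 "2 * t" j] tU by (auto simp: subalgebra_def)
  define W where "W = W_norm T K w Xt B m t j"
  have "W \<in> borel_measurable G"
    unfolding W_def G_def by (rule W_norm_measurable[OF m]) (use t j in auto)
  then have W[measurable]: "W \<in> borel_measurable P" by (rule measurable_from_subalg[OF G])
  have Wpos: "0 \<le> W \<omega>" if "\<omega> \<in> space P" for \<omega>
    using W_norm_pos[OF m t j that] by (simp add: W_def)
  have \<Phi>G: "\<Phi> \<in> borel_measurable G" using \<Phi> by (simp add: G_def)
  have \<Phi>P[measurable]: "\<Phi> \<in> borel_measurable P" by (rule measurable_from_subalg[OF G \<Phi>G])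
  \<comment> \<open>As measures on \<open>P\<close> these may differ, but by
    \<open>resampling_one\<close> they agree on \<open>G\<close>, and \<open>\<Phi>\<close> is
    \<open>G\<close>-measurable.\<close>
  let ?D1 = "density P (indicator E)" and ?D2 = "density P (\<lambda>\<omega>. ennreal (W \<omega>))"
  have G1: "subalgebra ?D1 G" and G2: "subalgebra ?D2 G" using G by (auto simp: subalgebra_def)
  have eq: "restr_to_subalg ?D1 G = restr_to_subalg ?D2 G"
  proof (rule measure_eqI)
    fix A assume "A \<in> sets (restr_to_subalg ?D1 G)"
    then have A: "A \<in> sets G" by (simp add: sets_restr_to_subalg[OF G1])
    have AP[measurable]: "A \<in> sets P" using A G by (auto simp: subalgebra_def)
    have "emeasure (restr_to_subalg ?D1 G) A = (\<integral>\<^sup>+\<omega>. indicator E \<omega> * indicator A \<omega> \<partial>P)"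
      by (simp add: emeasure_restr_to_subalg[OF G1 A] emeasure_density)
    also have "\<dots> = emeasure P (A \<inter> E)"
      by (simp add: Int_commute flip: indicator_inter_arith)
    also have "\<dots> = (\<integral>\<^sup>+\<omega>. ennreal (W \<omega>) * indicator A \<omega> \<partial>P)"
      by (rule emeasure_inter_eq_cond_prob[OF G E W Wpos _ A])
         (use resampling_one[OF m t i j] in \<open>simp_all add: E_def W_def G_def\<close>)
    also have "\<dots> = emeasure (restr_to_subalg ?D2 G) A"
      by (simp add: emeasure_restr_to_subalg[OF G2 A] emeasure_density)
    finally show "emeasure (restr_to_subalg ?D1 G) A = emeasure (restr_to_subalg ?D2 G) A" .
  qed (simp add: sets_restr_to_subalg[OF G1] sets_restr_to_subalg[OF G2])
  have "(\<integral>\<^sup>+\<omega>. indicator E \<omega> * \<Phi> \<omega> \<partial>P) = (\<integral>\<^sup>+\<omega>. \<Phi> \<omega> \<partial>?D1)"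
    by (rule nn_integral_density[symmetric]) auto
  also have "\<dots> = (\<integral>\<^sup>+\<omega>. \<Phi> \<omega> \<partial>restr_to_subalg ?D1 G)"
    by (rule nn_integral_subalgebra2[OF G1 \<Phi>G, symmetric])
  also have "\<dots> = (\<integral>\<^sup>+\<omega>. \<Phi> \<omega> \<partial>?D2)"
    unfolding eq by (rule nn_integral_subalgebra2[OF G2 \<Phi>G])
  also have "\<dots> = (\<integral>\<^sup>+\<omega>. ennreal (W \<omega>) * \<Phi> \<omega> \<partial>P)"
    by (rule nn_integral_density) auto
  finally show ?thesis unfolding E_def W_def .
qed

end

section \<open>Change of measure\<close>

context particle_filters
begin

definition change_of_measure :: "nat \<Rightarrow> nat \<Rightarrow> bool" where
  "change_of_measure m t \<longleftrightarrow> (\<forall>k\<in>{1..m} \<rightarrow> {1..K}. \<forall>\<phi>\<in>borel_measurable (paths t).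
     (\<integral>\<^sup>+\<omega>. \<phi> (X_join T Xt B m t k \<omega>) * ennreal (H_join T K w Xt B m t k \<omega>) \<partial>P) = (\<integral>\<^sup>+x. \<phi> x \<partial>law t))"

lemma measurable_history_imp:
  "u \<le> 2 * U \<Longrightarrow> h \<in> measurable (Hs r u) N \<Longrightarrow> h \<in> measurable P N"
  by (rule measurable_from_subalg[OF subalgebra_history])

text \<open>Sampling does not touch \<open>H\<close>, which is known before it and leaves the inner
  integral; what remains is the averaged function \<open>Q\<close> one stage earlier.\<close>

lemma change_of_measure_sampling:
  assumes m: "m \<in> {1..M}" and s: "Suc s \<in> {(m - 1) * T<..m * T}" and cm: "change_of_measure m s"
    and k: "k \<in> {1..m} \<rightarrow> {1..K}" and \<phi>: "\<phi> \<in> borel_measurable (paths (Suc s))"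
  shows "(\<integral>\<^sup>+\<omega>. \<phi> (X_join_prop T Xt B m (Suc s) k \<omega>) * ennreal (H_join T K w Xt B m s k \<omega>) \<partial>P) =
    (\<integral>\<^sup>+x. \<phi> x \<partial>law (Suc s))"
proof -
  define G where "G = Hs 0 (2 * Suc s - 2)"
  define J where "J = X_join T Xt B m s k"
  define H where "H = H_join T K w Xt B m s k"
  have sU: "Suc s \<le> U" using block_le[OF m] s by auto
  have km: "k m \<in> {1..K}" using k m by auto
  note [measurable] = \<phi> q_step_measurable[OF sU]
  have J[measurable]: "J \<in> measurable G (paths s)"
    unfolding J_def G_def by (rule X_join_measurable[OF m k]) (use s in auto)
  have H[measurable]: "H \<in> borel_measurable G"
    unfolding H_def G_def by (rule H_join_measurable[OF m k]) (use s in auto)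
  define Q where "Q h = (\<integral>\<^sup>+x. ennreal (q_step s h x) * \<phi> (h(Suc s := x)) \<partial>\<mu>)" for h
  have Q: "Q \<in> borel_measurable (paths s)" unfolding Q_def by measurable
  have G: "subalgebra P G" unfolding G_def by (rule subalgebra_history) (use sU in auto)
  have upd: "X_join_prop T Xt B m (Suc s) k \<omega> = (J \<omega>)(Suc s := Xt (Suc s) (k m) \<omega>)" for \<omega>
    using X_join_prop_eq_upd[of m T "Suc s"] s by (simp add: J_def)
  have J_space: "J \<omega> \<in> space (paths s)" if "\<omega> \<in> space P" for \<omega>
    using measurable_space[OF J] that by (simp add: G_def)
  have "(\<integral>\<^sup>+\<omega>. \<phi> ((J \<omega>)(Suc s := Xt (Suc s) (k m) \<omega>)) * ennreal (H \<omega>) \<partial>P) =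
      (\<integral>\<^sup>+\<omega>. (\<integral>\<^sup>+x. ennreal (q (Suc s) (X_res T Xt B m (Suc s - 1) (k m) \<omega>) x) *
        (\<phi> ((J \<omega>)(Suc s := x)) * ennreal (H \<omega>)) \<partial>\<mu>) \<partial>P)"
    by (rule nn_integral_sampling[OF m s km, where \<Phi> = "\<lambda>\<omega> x. \<phi> ((J \<omega>)(Suc s := x)) * ennreal (H \<omega>)"])
       (simp only: G_def[symmetric], measurable)
  also have "\<dots> = (\<integral>\<^sup>+\<omega>. Q (J \<omega>) * ennreal (H \<omega>) \<partial>P)"
  proof (rule nn_integral_cong)
    fix \<omega> assume \<omega>: "\<omega> \<in> space P"
    have "(\<lambda>x. ennreal (q_step s (J \<omega>) x) * \<phi> ((J \<omega>)(Suc s := x))) \<in> borel_measurable \<mu>"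
      using J_space[OF \<omega>] by measurable
    from nn_integral_multc[OF this, of "ennreal (H \<omega>)"]
    show "(\<integral>\<^sup>+x. ennreal (q (Suc s) (X_res T Xt B m (Suc s - 1) (k m) \<omega>) x) *
        (\<phi> ((J \<omega>)(Suc s := x)) * ennreal (H \<omega>)) \<partial>\<mu>) = Q (J \<omega>) * ennreal (H \<omega>)"
      using q_step_X_join[OF m s, of k \<omega>] by (simp add: Q_def J_def mult.assoc)
  qed
  also have "\<dots> = (\<integral>\<^sup>+x. Q x \<partial>law s)"
    using cm k Q unfolding change_of_measure_def J_def H_def by blast
  also have "\<dots> = (\<integral>\<^sup>+x. \<phi> x \<partial>law (Suc s))"
    unfolding Q_def by (rule nn_integral_law_Suc[OF sU \<phi>, symmetric])
  finally show ?thesis by (simp add: upd H_def)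
qed

text \<open>Each of the \<open>K\<close> possible parents contributes the fraction
  \<open>1 / K\<close> of the target integral, because the draw probability times
  \<open>H_prop\<close> is \<open>H / K\<close>.\<close>

lemma change_of_measure_resampling:
  assumes m: "m \<in> {1..M}" and s: "Suc s \<in> {(m - 1) * T<..m * T}" and cm: "change_of_measure m s"
  shows "change_of_measure m (Suc s)"
  unfolding change_of_measure_def
proof (intro ballI)
  fix k and \<phi> :: "(nat \<Rightarrow> 'a) \<Rightarrow> ennreal"
  assume k: "k \<in> {1..m} \<rightarrow> {1..K}" and \<phi>: "\<phi> \<in> borel_measurable (paths (Suc s))"
  define t where "t = Suc s"
  have t: "t \<in> {(m - 1) * T<..m * T}" "t - 1 = s" using s by (auto simp: t_def)
  have tU: "t \<in> {1..U}" using block_le[OF m, of t] t by auto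
  have km: "k m \<in> {1..K}" using k m by auto
  have kj: "k(m := j) \<in> {1..m} \<rightarrow> {1..K}" if "j \<in> {1..K}" for j using k that by auto
  define E where "E j = {\<omega> \<in> space P. B t (k m) \<omega> = j}" for j
  define a where "a j \<omega> = \<phi> (X_join_prop T Xt B m t (k(m := j)) \<omega>) * ennreal (H_join_prop T K w Xt B m t (k(m := j)) \<omega>)" for j \<omega>
  have a: "a j \<in> borel_measurable (Hs 0 (2 * t - 1))" if j: "j \<in> {1..K}" for j
    unfolding a_def[abs_def]
    by (intro borel_measurable_times_ennreal measurable_compose[OF X_join_prop_measurable[OF m kj[OF j] t(1)] \<phi>[folded t_def]]
        measurable_compose[OF H_join_prop_measurable[OF m kj[OF j] t(1)] measurable_ennreal]) auto
  have aP: "a j \<in> borel_measurable P" if "j \<in> {1..K}" for j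
    by (rule measurable_history_imp[OF _ a[OF that]]) (use tU in auto)
  have EP: "E j \<in> sets P" for j
    using B_event[OF tU km, of 0 "2 * t" j] subalgebra_history[of "2 * t" 0] tU
    by (auto simp: E_def subalgebra_def)
  have "(\<integral>\<^sup>+\<omega>. \<phi> (X_join T Xt B m t k \<omega>) * ennreal (H_join T K w Xt B m t k \<omega>) \<partial>P) =
      (\<integral>\<^sup>+\<omega>. (\<Sum>j=1..K. indicator (E j) \<omega> * a j \<omega>) \<partial>P)"
  proof (rule nn_integral_cong)
    fix \<omega> assume \<omega>: "\<omega> \<in> space P"
    define i where "i = B t (k m) \<omega>"
    have i: "i \<in> {1..K}" unfolding i_def by (rule B_range[OF \<omega> tU km])
    have "(\<Sum>j=1..K. indicator (E j) \<omega> * a j \<omega>) = (\<Sum>j=1..K. if j = i then a i \<omega> else 0)"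
      using \<omega> by (intro sum.cong) (auto simp: E_def i_def indicator_def)
    also have "\<dots> = a i \<omega>" using i by simp
    finally show "\<phi> (X_join T Xt B m t k \<omega>) * ennreal (H_join T K w Xt B m t k \<omega>) = (\<Sum>j=1..K. indicator (E j) \<omega> * a j \<omega>)"
      unfolding a_def i_def using m t T_pos by (simp add: X_join_resample H_join_resample)
  qed
  also have "\<dots> = (\<Sum>j=1..K. \<integral>\<^sup>+\<omega>. indicator (E j) \<omega> * a j \<omega> \<partial>P)"
    by (rule nn_integral_sum) (use aP EP in auto)
  also have "\<dots> = (\<Sum>j=1..K. ennreal (1 / real K) * (\<integral>\<^sup>+x. \<phi> x \<partial>law t))"
  proof (rule sum.cong[OF refl])
    fix j assume j: "j \<in> {1..K}"
    have "(\<integral>\<^sup>+\<omega>. indicator (E j) \<omega> * a j \<omega> \<partial>P) = (\<integral>\<^sup>+\<omega>. ennreal (W_norm T K w Xt B m t j \<omega>) * a j \<omega> \<partial>P)"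
      unfolding E_def by (rule nn_integral_resampling[OF m t(1) km j a[OF j]])
    also have "\<dots> = (\<integral>\<^sup>+\<omega>. ennreal (1 / real K) *
        (\<phi> (X_join_prop T Xt B m t (k(m := j)) \<omega>) * ennreal (H_join T K w Xt B m s (k(m := j)) \<omega>)) \<partial>P)"
    proof (rule nn_integral_cong)
      fix \<omega> assume \<omega>: "\<omega> \<in> space P"
      have "W_norm T K w Xt B m t j \<omega> * H_join_prop T K w Xt B m t (k(m := j)) \<omega> =
          1 / real K * H_join T K w Xt B m s (k(m := j)) \<omega>"
        using W_times_H_join_prop[OF m kj[OF j] t(1) \<omega>] K_pos t(2) by (simp add: field_simps)
      then have "ennreal (W_norm T K w Xt B m t j \<omega>) * ennreal (H_join_prop T K w Xt B m t (k(m := j)) \<omega>) =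
          ennreal (1 / real K) * ennreal (H_join T K w Xt B m s (k(m := j)) \<omega>)"
        using W_norm_pos[OF m t(1) j \<omega>] by (simp flip: ennreal_mult')
      then show "ennreal (W_norm T K w Xt B m t j \<omega>) * a j \<omega> = ennreal (1 / real K) *
        (\<phi> (X_join_prop T Xt B m t (k(m := j)) \<omega>) * ennreal (H_join T K w Xt B m s (k(m := j)) \<omega>))"
        unfolding a_def by (metis mult.left_commute)
    qed
    also have "\<dots> = ennreal (1 / real K) * (\<integral>\<^sup>+\<omega>. \<phi> (X_join_prop T Xt B m t (k(m := j)) \<omega>) * ennreal (H_join T K w Xt B m s (k(m := j)) \<omega>) \<partial>P)"
    proof (rule nn_integral_cmult, rule borel_measurable_times_ennreal)
      show "(\<lambda>\<omega>. \<phi> (X_join_prop T Xt B m t (k(m := j)) \<omega>)) \<in> borel_measurable P"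
        by (rule measurable_history_imp[OF _ measurable_compose[OF X_join_prop_measurable[OF m kj[OF j] t(1) order_refl] \<phi>[folded t_def]]])
           (use tU in auto)
      show "(\<lambda>\<omega>. ennreal (H_join T K w Xt B m s (k(m := j)) \<omega>)) \<in> borel_measurable P"
        by (rule measurable_history_imp[OF _ measurable_compose[OF H_join_measurable[OF m kj[OF j] _ _ order_refl] measurable_ennreal]])
           (use t tU in auto)
    qed
    also have "\<dots> = ennreal (1 / real K) * (\<integral>\<^sup>+x. \<phi> x \<partial>law t)"
      unfolding t_def by (simp only: change_of_measure_sampling[OF m s cm kj[OF j] \<phi>])
    finally show "(\<integral>\<^sup>+\<omega>. indicator (E j) \<omega> * a j \<omega> \<partial>P) = ennreal (1 / real K) * (\<integral>\<^sup>+x. \<phi> x \<partial>law t)" .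
  qed
  also have "\<dots> = of_nat K * ennreal (1 / real K) * (\<integral>\<^sup>+x. \<phi> x \<partial>law t)"
    by (simp add: mult.assoc)
  also have "of_nat K * ennreal (1 / real K) = 1"
    using K_pos by (simp add: ennreal_of_nat_eq_real_of_nat flip: ennreal_mult)
  finally show "(\<integral>\<^sup>+\<omega>. \<phi> (X_join T Xt B m (Suc s) k \<omega>) * ennreal (H_join T K w Xt B m (Suc s) k \<omega>) \<partial>P) = (\<integral>\<^sup>+x. \<phi> x \<partial>law (Suc s))"
    by (simp add: t_def)
qed

lemma change_of_measure_block:
  assumes m: "m \<in> {1..M}" and start: "change_of_measure m ((m - 1) * T)"
  shows "(m - 1) * T \<le> t \<Longrightarrow> t \<le> m * T \<Longrightarrow> change_of_measure m t"
proof (induction t rule: nat_induct_at_least)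
  case (Suc t)
  then show ?case by (intro change_of_measure_resampling[OF m]) auto
qed (rule start)

text \<open>Before the first stage there is only the empty path, with weight one, and
  \<open>law 0\<close> is a point mass.\<close>

lemma change_of_measure_start: "change_of_measure 1 0"
  unfolding change_of_measure_def
proof (intro ballI)
  fix k and \<phi> :: "(nat \<Rightarrow> 'a) \<Rightarrow> ennreal"
  interpret law: prob_space "law 0" by (rule prob_space_law) simp
  have "(\<integral>\<^sup>+x. \<phi> x \<partial>law 0) = (\<integral>\<^sup>+x. \<phi> (\<lambda>_. undefined) \<partial>law 0)"
    by (rule nn_integral_cong) (simp add: space_PiM)
  also have "\<dots> = \<phi> (\<lambda>_. undefined)" using law.emeasure_space_1 by simp
  finally show "(\<integral>\<^sup>+\<omega>. \<phi> (X_join T Xt B 1 0 k \<omega>) * ennreal (H_join T K w Xt B 1 0 k \<omega>) \<partial>P) = (\<integral>\<^sup>+x. \<phi> x \<partial>law 0)"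
    by (simp add: X_join_def join_paths_def H_join_def restrict_def emeasure_space_1)
qed

text \<open>The end of one filter is the start of the next: the new index coordinate does not yet
  enter path or weight.\<close>

lemma change_of_measure_filter: "1 \<le> m \<Longrightarrow> m \<le> M \<Longrightarrow> change_of_measure m ((m - 1) * T)"
proof (induction m rule: nat_induct_at_least)
  case base
  then show ?case using change_of_measure_start by simp
next
  case (Suc m)
  have "change_of_measure m (m * T)"
    by (rule change_of_measure_block) (use Suc in auto)
  moreover have "{1..Suc m} \<rightarrow> {1..K} \<subseteq> {1..m} \<rightarrow> {1..K}" by auto
  ultimately show ?case
    using Suc.hyps T_pos
    unfolding change_of_measure_def by (auto simp: X_join_next_filter H_join_next_filter)
qed

lemma change_of_measure:
  "m \<in> {1..M} \<Longrightarrow> (m - 1) * T \<le> t \<Longrightarrow> t \<le> m * T \<Longrightarrow> change_of_measure m t"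
  by (rule change_of_measure_block) (auto intro: change_of_measure_filter)

section \<open>Integrability and null sets along joined paths\<close>

lemma nn_integral_X_join:
  assumes "m \<in> {1..M}" "(m - 1) * T \<le> t" "t \<le> m * T" "k \<in> {1..m} \<rightarrow> {1..K}" "\<phi> \<in> borel_measurable (paths t)"
  shows "(\<integral>\<^sup>+\<omega>. \<phi> (X_join T Xt B m t k \<omega>) * ennreal (H_join T K w Xt B m t k \<omega>) \<partial>P) = (\<integral>\<^sup>+x. \<phi> x \<partial>law t)"
  using change_of_measure[OF assms(1-3)] assms(4,5) unfolding change_of_measure_def by blast

lemma nn_integral_X_join_prop:
  assumes m: "m \<in> {1..M}" and t: "t \<in> {(m - 1) * T<..m * T}" and k: "k \<in> {1..m} \<rightarrow> {1..K}"
    and \<phi>: "\<phi> \<in> borel_measurable (paths t)"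
  shows "(\<integral>\<^sup>+\<omega>. \<phi> (X_join_prop T Xt B m t k \<omega>) * ennreal (H_join T K w Xt B m (t - 1) k \<omega>) \<partial>P) = (\<integral>\<^sup>+x. \<phi> x \<partial>law t)"
proof -
  obtain s where s: "t = Suc s" using t by (cases t) auto
  have "change_of_measure m s" by (rule change_of_measure[OF m]) (use t s in auto)
  from change_of_measure_sampling[OF m t[unfolded s] this k \<phi>[unfolded s]] show ?thesis
    unfolding s diff_Suc_1 .
qed

text \<open>The change of measure is applied to the absolute value of \<open>v\<close>; no moment of
  \<open>H\<close> on its own is involved.\<close>

lemma integrable_X_join:
  fixes v :: "(nat \<Rightarrow> 'a) \<Rightarrow> real"
  assumes m: "m \<in> {1..M}" and t: "(m - 1) * T \<le> t" "t \<le> m * T" and k: "k \<in> {1..m} \<rightarrow> {1..K}" and v: "integrable (law t) v"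
  shows "integrable P (\<lambda>\<omega>. v (X_join T Xt B m t k \<omega>) * H_join T K w Xt B m t k \<omega>)"
proof (rule integrableI_bounded)
  have tU: "t \<le> U" by (rule block_le[OF m t(2)])
  have vm: "v \<in> borel_measurable (paths t)" using borel_measurable_integrable[OF v] by simp
  show "(\<lambda>\<omega>. v (X_join T Xt B m t k \<omega>) * H_join T K w Xt B m t k \<omega>) \<in> borel_measurable P"
    by (rule measurable_history_imp[of "2 * t" _ 0], use tU in simp)
       (intro borel_measurable_times measurable_compose[OF X_join_measurable[OF m k t order_refl] vm]
         H_join_measurable[OF m k t order_refl])
  have "(\<integral>\<^sup>+\<omega>. ennreal (norm (v (X_join T Xt B m t k \<omega>) * H_join T K w Xt B m t k \<omega>)) \<partial>P) =
      (\<integral>\<^sup>+\<omega>. ennreal (norm (v (X_join T Xt B m t k \<omega>))) * ennreal (H_join T K w Xt B m t k \<omega>) \<partial>P)"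
    using H_join_pos[OF m k t(2)]
    by (intro nn_integral_cong) (simp add: abs_mult ennreal_mult less_imp_le)
  also have "\<dots> = (\<integral>\<^sup>+x. ennreal (norm (v x)) \<partial>law t)"
    by (rule nn_integral_X_join[OF m t k, where \<phi> = "\<lambda>x. ennreal (norm (v x))"]) (use vm in simp)
  also have "\<dots> < \<infinity>" using v by (simp add: integrable_iff_bounded)
  finally show "(\<integral>\<^sup>+\<omega>. ennreal (norm (v (X_join T Xt B m t k \<omega>) * H_join T K w Xt B m t k \<omega>)) \<partial>P) < \<infinity>" .
qed

lemma integrable_X_join_prop:
  fixes v :: "(nat \<Rightarrow> 'a) \<Rightarrow> real"
  assumes m: "m \<in> {1..M}" and t: "t \<in> {(m - 1) * T<..m * T}" and k: "k \<in> {1..m} \<rightarrow> {1..K}" and v: "integrable (law t) v"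
  shows "integrable P (\<lambda>\<omega>. v (X_join_prop T Xt B m t k \<omega>) * H_join T K w Xt B m (t - 1) k \<omega>)"
proof (rule integrableI_bounded)
  have tU: "t \<le> U" by (rule block_le[OF m]) (use t in auto)
  have vm: "v \<in> borel_measurable (paths t)" using borel_measurable_integrable[OF v] by simp
  have t1: "(m - 1) * T \<le> t - 1" "t - 1 \<le> m * T" "2 * (t - 1) \<le> 2 * t - 1" using t by auto
  show "(\<lambda>\<omega>. v (X_join_prop T Xt B m t k \<omega>) * H_join T K w Xt B m (t - 1) k \<omega>) \<in> borel_measurable P"
    by (rule measurable_history_imp[of "2 * t - 1" _ 0], use tU in simp)
       (intro borel_measurable_times measurable_compose[OF X_join_prop_measurable[OF m k t order_refl] vm]
         H_join_measurable[OF m k t1])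
  have "(\<integral>\<^sup>+\<omega>. ennreal (norm (v (X_join_prop T Xt B m t k \<omega>) * H_join T K w Xt B m (t - 1) k \<omega>)) \<partial>P) =
      (\<integral>\<^sup>+\<omega>. ennreal (norm (v (X_join_prop T Xt B m t k \<omega>))) * ennreal (H_join T K w Xt B m (t - 1) k \<omega>) \<partial>P)"
    using H_join_pos[OF m k t1(2)]
    by (intro nn_integral_cong) (simp add: abs_mult ennreal_mult less_imp_le)
  also have "\<dots> = (\<integral>\<^sup>+x. ennreal (norm (v x)) \<partial>law t)"
    by (rule nn_integral_X_join_prop[OF m t k, where \<phi> = "\<lambda>x. ennreal (norm (v x))"]) (use vm in simp)
  also have "\<dots> < \<infinity>" using v by (simp add: integrable_iff_bounded)
  finally show "(\<integral>\<^sup>+\<omega>. ennreal (norm (v (X_join_prop T Xt B m t k \<omega>) * H_join T K w Xt B m (t - 1) k \<omega>)) \<partial>P) < \<infinity>" .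
qed

text \<open>A null set \<open>N\<close> of the importance law satisfies
  \<open>E[1_N(X) * H] = 0\<close>, and since \<open>H\<close> is strictly positive the path avoids
  \<open>N\<close> almost surely.\<close>

lemma AE_X_join:
  assumes m: "m \<in> {1..M}" and t: "(m - 1) * T \<le> t" "t \<le> m * T" and k: "k \<in> {1..m} \<rightarrow> {1..K}" and ae: "AE x in law t. R x"
  shows "AE \<omega> in P. R (X_join T Xt B m t k \<omega>)"
proof -
  have tU: "t \<le> U" by (rule block_le[OF m t(2)])
  obtain N where N: "{x \<in> space (law t). \<not> R x} \<subseteq> N" "emeasure (law t) N = 0" "N \<in> sets (law t)"
    using ae by (rule AE_E)
  have ind: "(indicator N :: _ \<Rightarrow> ennreal) \<in> borel_measurable (paths t)" using N(3) by simp
  have JP: "X_join T Xt B m t k \<in> measurable P (paths t)" "H_join T K w Xt B m t k \<in> borel_measurable P"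
    by (rule measurable_history_imp[OF _ X_join_measurable[OF m k t order_refl]], use tU in simp)
       (rule measurable_history_imp[OF _ H_join_measurable[OF m k t order_refl]], use tU in simp)
  have "(\<integral>\<^sup>+\<omega>. indicator N (X_join T Xt B m t k \<omega>) * ennreal (H_join T K w Xt B m t k \<omega>) \<partial>P) = (\<integral>\<^sup>+x. indicator N x \<partial>law t)"
    by (rule nn_integral_X_join[OF m t k ind])
  also have "\<dots> = 0" using N by simp
  finally have "AE \<omega> in P. indicator N (X_join T Xt B m t k \<omega>) * ennreal (H_join T K w Xt B m t k \<omega>) = 0"
    using measurable_compose[OF JP(1) ind] JP(2) by (subst (asm) nn_integral_0_iff_AE) auto
  then show ?thesis
    using AE_space
  proof eventually_elim
    case (elim \<omega>)
    then have "X_join T Xt B m t k \<omega> \<notin> N"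
      using H_join_pos[OF m k t(2), of \<omega>] by (auto simp: indicator_def split: if_splits)
    moreover have "X_join T Xt B m t k \<omega> \<in> space (law t)"
      using measurable_space[OF JP(1) elim(2)] by simp
    ultimately show ?case using N(1) by auto
  qed
qed

end

section \<open>Centred increments\<close>

lemma (in sigma_finite_subalgebra) real_cond_exp_sum_eq_0:
  assumes "finite I" and i: "\<And>i. i \<in> I \<Longrightarrow> integrable M (Z i)"
    and z: "\<And>i. i \<in> I \<Longrightarrow> AE x in M. real_cond_exp M F (Z i) x = 0"
  shows "integrable M (\<lambda>x. (\<Sum>i\<in>I. Z i x) / c)"
    and "AE x in M. real_cond_exp M F (\<lambda>x. (\<Sum>i\<in>I. Z i x) / c) x = 0"
proof -
  have int: "integrable M (\<lambda>x. \<Sum>i\<in>I. Z i x)" by (rule Bochner_Integration.integrable_sum[OF i])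
  then show "integrable M (\<lambda>x. (\<Sum>i\<in>I. Z i x) / c)" by simp
  \<comment> \<open>Extended by zero because \<open>real_cond_exp_sum\<close> asks for integrability
    at every index, not only those in \<open>I\<close>.\<close>
  define Z' where "Z' i = (if i \<in> I then Z i else (\<lambda>_. 0))" for i
  have "AE x in M. real_cond_exp M F (\<lambda>x. \<Sum>i\<in>I. Z' i x) x = (\<Sum>i\<in>I. real_cond_exp M F (Z' i) x)"
    by (rule real_cond_exp_sum) (simp add: Z'_def i)
  moreover have "(\<lambda>x. \<Sum>i\<in>I. Z' i x) = (\<lambda>x. \<Sum>i\<in>I. Z i x)" by (auto simp: Z'_def)
  moreover have "AE x in M. \<forall>i\<in>I. real_cond_exp M F (Z i) x = 0"
    by (rule AE_finite_allI[OF assms(1) z])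
  moreover have "AE x in M. real_cond_exp M F (\<lambda>x. (\<Sum>i\<in>I. Z i x) / c) x = real_cond_exp M F (\<lambda>x. \<Sum>i\<in>I. Z i x) x / c"
    by (rule real_cond_exp_cdiv[OF int])
  ultimately show "AE x in M. real_cond_exp M F (\<lambda>x. (\<Sum>i\<in>I. Z i x) / c) x = 0"
    by (auto simp: Z'_def)
qed

lemma finite_Z_set: "finite (Z_set K m)"
  by (intro finite_PiE) auto

context particle_filters
begin

lemma A_event:
  assumes "m \<in> {1..M}" "(m - 1) * T \<le> t" "t \<le> m * T" "2 * t \<le> u" "k \<in> {1..K}"
  shows "{\<omega> \<in> space (Hs 0 u). A_res T B m t k \<omega> = j} \<in> sets (Hs 0 u)"
proof -
  have "A_res T B m t k -` ({j} \<inter> {1..K}) \<inter> space (Hs 0 u) \<in> sets (Hs 0 u)"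
    by (rule measurable_sets[OF A_res_measurable]) (use assms in auto)
  moreover have "A_res T B m t k -` ({j} \<inter> {1..K}) \<inter> space (Hs 0 u) = {\<omega> \<in> space (Hs 0 u). A_res T B m t k \<omega> = j}"
    using A_range[OF assms(1) _ assms(3,5)] by auto
  ultimately show ?thesis by simp
qed

text \<open>Reduces the offspring number to single draws, whose conditional probabilities are known
  from \<open>resampling_one\<close>.\<close>

lemma offspring_eq:
  assumes "\<omega> \<in> space P"
  shows "real (offspring K B t k \<omega>) = (\<Sum>i=1..K. indicator {\<omega> \<in> space P. B t i \<omega> = k} \<omega>)"
  using assms by (simp add: offspring_def indicator_def sum.If_cases Int_def flip: of_nat_sum)

context
  fixes f :: "nat \<Rightarrow> (nat \<Rightarrow> 'a) \<Rightarrow> real"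
  assumes versions: "cond_mean_versions \<mu> p1 p g Y T (M * T) q \<psi> f"
begin

text \<open>Averaging over the new state produces the kernel integral of \<open>f t\<close>, which
  equals \<open>f (t - 1)\<close> only almost everywhere under the importance law;
  \<open>AE_X_join\<close> moves this identity to the random path. The weight \<open>a\<close> will
  hold a test event and \<open>H\<close>.\<close>

lemma integral_version_sampling:
  assumes m: "m \<in> {1..M}" and t: "t \<in> {(m - 1) * T<..m * T}" and k: "k \<in> {1..m} \<rightarrow> {1..K}"
    and a: "a \<in> borel_measurable (Hs 0 (2 * t - 2))"
    and i: "integrable P (\<lambda>\<omega>. a \<omega> * f t (X_join_prop T Xt B m t k \<omega>))"
  shows "(\<integral>\<omega>. a \<omega> * f t (X_join_prop T Xt B m t k \<omega>) \<partial>P) = (\<integral>\<omega>. a \<omega> * f (t - 1) (X_join T Xt B m (t - 1) k \<omega>) \<partial>P)"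
proof -
  obtain s where s: "t = Suc s" using t by (cases t) auto
  note t' = t[unfolded s]
  define G where "G = Hs 0 (2 * t - 2)"
  define J where "J = X_join T Xt B m s k"
  have sU: "Suc s \<le> U" using block_le[OF m] t s by auto
  have km: "k m \<in> {1..K}" using k m by auto
  note [measurable] = q_step_measurable[OF sU]
  have fm[measurable]: "f (Suc s) \<in> borel_measurable (paths (Suc s))" by (rule version_measurable[OF versions sU])
  have fm'[measurable]: "f s \<in> borel_measurable (paths s)" by (rule version_measurable[OF versions]) (use sU in simp)
  have J[measurable]: "J \<in> measurable G (paths s)"
    unfolding J_def G_def by (rule X_join_measurable[OF m k]) (use t s in auto)
  have aG[measurable]: "a \<in> borel_measurable G" using a by (simp add: G_def)
  have G: "subalgebra P G" unfolding G_def by (rule subalgebra_history) (use sU s in auto)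
  have upd: "X_join_prop T Xt B m t k \<omega> = (J \<omega>)(t := Xt t (k m) \<omega>)" for \<omega>
    using X_join_prop_eq_upd[of m T t] t by (simp add: J_def s)
  define Q where "Q h = (\<integral>x. q_step s h x * f (Suc s) (h(Suc s := x)) \<partial>\<mu>)" for h
  have Q[measurable]: "Q \<in> borel_measurable (paths s)" unfolding Q_def by measurable
  have v: "(\<lambda>(\<omega>, x). a \<omega> * f t ((J \<omega>)(t := x))) \<in> borel_measurable (G \<Otimes>\<^sub>M \<mu>)"
    unfolding s by measurable
  have "(\<integral>\<omega>. a \<omega> * f t (X_join_prop T Xt B m t k \<omega>) \<partial>P) =
      (\<integral>\<omega>. (\<integral>x. q t (X_res T Xt B m (t - 1) (k m) \<omega>) x * (a \<omega> * f t ((J \<omega>)(t := x))) \<partial>\<mu>) \<partial>P)"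
    unfolding upd
    by (rule integral_sampling[OF m t km v[unfolded G_def] i[unfolded upd]])
  also have "\<dots> = (\<integral>\<omega>. a \<omega> * Q (J \<omega>) \<partial>P)"
    by (rule Bochner_Integration.integral_cong[OF refl])
       (simp add: q_step_X_join[OF m t', unfolded diff_Suc_1, symmetric] Q_def J_def s mult.left_commute[of _ "a _"])
  also have "\<dots> = (\<integral>\<omega>. a \<omega> * f s (J \<omega>) \<partial>P)"
  proof (rule integral_cong_AE)
    show "(\<lambda>\<omega>. a \<omega> * Q (J \<omega>)) \<in> borel_measurable P" by (rule measurable_from_subalg[OF G]) measurable
    show "(\<lambda>\<omega>. a \<omega> * f s (J \<omega>)) \<in> borel_measurable P" by (rule measurable_from_subalg[OF G]) measurable
    have "AE \<omega> in P. f s (J \<omega>) = Q (J \<omega>)"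
      unfolding J_def by (rule AE_X_join[OF m _ _ k]) (use t s version_step[OF versions sU] in \<open>auto simp: Q_def\<close>)
    then show "AE \<omega> in P. a \<omega> * Q (J \<omega>) = a \<omega> * f s (J \<omega>)" by eventually_elim simp
  qed
  finally show ?thesis by (simp add: J_def s)
qed

text \<open>The index set in \<open>eps_sample\<close> depends on \<open>\<omega>\<close>; extending
  the summand by zero gives a sum over a fixed set.\<close>

definition sample_term :: "nat \<Rightarrow> nat \<Rightarrow> nat \<Rightarrow> (nat \<Rightarrow> nat) \<Rightarrow> 'w \<Rightarrow> real" where
  "sample_term m j t k \<omega> = (if A_res T B m (t - 1) (k m) \<omega> = j
     then (f t (X_join_prop T Xt B m t k \<omega>) - f (t - 1) (X_join T Xt B m (t - 1) k \<omega>)) * H_join T K w Xt B m (t - 1) k \<omega> else 0)"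

text \<open>Leaves out the centred factor of \<open>eps_resample\<close>; what remains is already
  known just before resampling.\<close>

definition resample_term :: "nat \<Rightarrow> nat \<Rightarrow> nat \<Rightarrow> (nat \<Rightarrow> nat) \<Rightarrow> 'w \<Rightarrow> real" where
  "resample_term m j t k \<omega> = (if A_res T B m (t - 1) (k m) \<omega> = j
     then f t (X_join_prop T Xt B m t k \<omega>) * H_join_prop T K w Xt B m t k \<omega> else 0)"

lemma eps_sample_eq: "eps_sample T K w Xt B f m j t \<omega> = (\<Sum>k\<in>Z_set K m. sample_term m j t k \<omega>) / real K ^ (m - 1)"
  unfolding eps_sample_def sample_term_def by (simp add: sum.inter_filter[OF finite_Z_set])

text \<open>The compensator \<open>K * W\<close> is distributed over the \<open>K\<close> draws, so
  that each draw is centred separately. Counting by indicators needs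
  \<open>\<omega> \<in> space P\<close>.\<close>

lemma eps_resample_eq: "\<omega> \<in> space P \<Longrightarrow> eps_resample T K w Xt B f m j t \<omega> = (\<Sum>k\<in>Z_set K m. \<Sum>i=1..K.
    resample_term m j t k \<omega> * (indicator {\<omega> \<in> space P. B t i \<omega> = k m} \<omega> - W_norm T K w Xt B m t (k m) \<omega>)) / real K ^ (m - 1)"
  unfolding eps_resample_def sum.inter_filter[OF finite_Z_set]
  by (intro arg_cong2[where f = "(/)"] sum.cong refl)
     (simp add: resample_term_def offspring_eq sum_subtractf mult_ac flip: sum_distrib_left)

lemma sample_term_measurable:
  assumes m: "m \<in> {1..M}" and t: "t \<in> {(m - 1) * T<..m * T}" and k: "k \<in> {1..m} \<rightarrow> {1..K}"
  shows "sample_term m j t k \<in> borel_measurable (Hs 0 (2 * t - 1))"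
proof -
  have t1: "(m - 1) * T \<le> t - 1" "t - 1 \<le> m * T" "2 * (t - 1) \<le> 2 * t - 1" using t by auto
  have km: "k m \<in> {1..K}" using k m by auto
  have tU: "t \<le> U" "t - 1 \<le> U" using block_le[OF m, of t] t by auto
  show ?thesis
    unfolding sample_term_def[abs_def]
    by (intro measurable_If[OF _ _ A_event[OF m t1 km]] borel_measurable_times borel_measurable_diff borel_measurable_const
        measurable_compose[OF X_join_prop_measurable[OF m k t order_refl] version_measurable[OF versions tU(1)]]
        measurable_compose[OF X_join_measurable[OF m k t1] version_measurable[OF versions tU(2)]]
        H_join_measurable[OF m k t1])
qed

lemma resample_term_measurable:
  assumes m: "m \<in> {1..M}" and t: "t \<in> {(m - 1) * T<..m * T}" and k: "k \<in> {1..m} \<rightarrow> {1..K}"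
  shows "resample_term m j t k \<in> borel_measurable (Hs 0 (2 * t - 1))"
proof -
  have t1: "(m - 1) * T \<le> t - 1" "t - 1 \<le> m * T" "2 * (t - 1) \<le> 2 * t - 1" using t by auto
  have km: "k m \<in> {1..K}" using k m by auto
  have tU: "t \<le> U" using block_le[OF m, of t] t by auto
  show ?thesis
    unfolding resample_term_def[abs_def]
    by (intro measurable_If[OF _ _ A_event[OF m t1 km]] borel_measurable_times borel_measurable_const
        measurable_compose[OF X_join_prop_measurable[OF m k t order_refl] version_measurable[OF versions tU]]
        H_join_prop_measurable[OF m k t order_refl])
qed

lemma sample_term_centred:
  assumes m: "m \<in> {1..M}" and t: "t \<in> {(m - 1) * T<..m * T}" and k: "k \<in> {1..m} \<rightarrow> {1..K}"
  shows "integrable P (sample_term m j t k)"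
    and "AE \<omega> in P. real_cond_exp P (Hs 0 (2 * t - 2)) (sample_term m j t k) \<omega> = 0"
proof -
  define G where "G = Hs 0 (2 * t - 2)"
  have t1: "(m - 1) * T \<le> t - 1" "t - 1 \<le> m * T" "2 * (t - 1) \<le> 2 * t - 2" using t by auto
  have km: "k m \<in> {1..K}" using k m by auto
  have tU: "t \<le> U" "t - 1 \<le> U" using block_le[OF m, of t] t by auto
  have G: "subalgebra P G" unfolding G_def by (rule subalgebra_history) (use tU in auto)
  interpret G: finite_measure_subalgebra P G by unfold_locales (rule G)
  have spG: "space G = space P" by (simp add: G_def)
  define D where "D = {\<omega> \<in> space G. A_res T B m (t - 1) (k m) \<omega> = j}"
  have D: "D \<in> sets G" unfolding D_def G_def by (rule A_event[OF m t1 km])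
  define H where "H = H_join T K w Xt B m (t - 1) k"
  have HG: "H \<in> borel_measurable G" unfolding H_def G_def by (rule H_join_measurable[OF m k t1])
  define x where "x \<omega> = f t (X_join_prop T Xt B m t k \<omega>)" for \<omega>
  define y where "y \<omega> = f (t - 1) (X_join T Xt B m (t - 1) k \<omega>)" for \<omega>
  have ix: "integrable P (\<lambda>\<omega>. x \<omega> * H \<omega>)" unfolding x_def H_def
    by (rule integrable_X_join_prop[OF m t k version_integral(1)[OF versions tU(1)]])
  have iy: "integrable P (\<lambda>\<omega>. y \<omega> * H \<omega>)" unfolding y_def H_def
    by (rule integrable_X_join[OF m t1(1,2) k version_integral(1)[OF versions tU(2)]])
  \<comment> \<open>The rewriting is valid on \<open>space P\<close> only: outside, \<open>D\<close>
    is empty while \<open>sample_term\<close> may be nonzero.\<close>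
  have eq: "(if \<omega> \<in> space P then sample_term m j t k \<omega> else c) =
      (if \<omega> \<in> space P then indicator D \<omega> * (x \<omega> * H \<omega>) - indicator D \<omega> * (y \<omega> * H \<omega>) else c)" for \<omega> c
    by (simp add: sample_term_def D_def spG x_def y_def H_def left_diff_distrib)
  have ind: "integrable P (\<lambda>\<omega>. indicator A \<omega> * (v \<omega>))" if "A \<in> sets G" "integrable P v" for A and v :: "'w \<Rightarrow> real"
    using integrable_mult_indicator[of A P v] that G by (auto simp: subalgebra_def)
  have "integrable P (\<lambda>\<omega>. indicator D \<omega> * (x \<omega> * H \<omega>) - indicator D \<omega> * (y \<omega> * H \<omega>))"
    by (intro Bochner_Integration.integrable_diff ind D ix iy)
  then show int: "integrable P (sample_term m j t k)"
    by (rule Bochner_Integration.integrable_cong[THEN iffD1, OF refl, rotated]) (use eq in metis)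
  show "AE \<omega> in P. real_cond_exp P (Hs 0 (2 * t - 2)) (sample_term m j t k) \<omega> = 0"
    unfolding G_def[symmetric]
  proof (rule G.real_cond_exp_charact)
    fix A assume A: "A \<in> sets G"
    have AD: "A \<inter> D \<in> sets G" using A D by auto
    \<comment> \<open>The weight for \<open>integral_version_sampling\<close>: test event, selected
      ancestor and \<open>H\<close> are all known before sampling.\<close>
    have aG: "(\<lambda>\<omega>. indicator (A \<inter> D) \<omega> * H \<omega>) \<in> borel_measurable G"
      using AD HG by (intro borel_measurable_times) auto
    have i1: "integrable P (\<lambda>\<omega>. (indicator (A \<inter> D) \<omega> * H \<omega>) * x \<omega>)"
      using ind[OF AD ix] by (simp add: mult_ac)
    have i2: "integrable P (\<lambda>\<omega>. (indicator (A \<inter> D) \<omega> * H \<omega>) * y \<omega>)"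
      using ind[OF AD iy] by (simp add: mult_ac)
    have "(\<integral>\<omega>\<in>A. sample_term m j t k \<omega> \<partial>P) =
        (\<integral>\<omega>. (indicator (A \<inter> D) \<omega> * H \<omega>) * x \<omega> - (indicator (A \<inter> D) \<omega> * H \<omega>) * y \<omega> \<partial>P)"
      unfolding set_lebesgue_integral_def
      by (rule Bochner_Integration.integral_cong[OF refl])
         (auto simp: sample_term_def D_def spG x_def y_def H_def indicator_def algebra_simps)
    also have "\<dots> = (\<integral>\<omega>. (indicator (A \<inter> D) \<omega> * H \<omega>) * x \<omega> \<partial>P) - (\<integral>\<omega>. (indicator (A \<inter> D) \<omega> * H \<omega>) * y \<omega> \<partial>P)"
      by (rule Bochner_Integration.integral_diff[OF i1 i2])
    also have "\<dots> = 0"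
      using integral_version_sampling[OF m t k aG[unfolded G_def] i1[unfolded x_def]] by (simp add: x_def y_def)
    finally show "(\<integral>\<omega>\<in>A. sample_term m j t k \<omega> \<partial>P) = (\<integral>\<omega>\<in>A. 0 \<partial>P)"
      by (simp add: set_lebesgue_integral_def)
  qed (use int in auto)
qed

lemma resample_term_centred:
  fixes j :: nat
  assumes m: "m \<in> {1..M}" and t: "t \<in> {(m - 1) * T<..m * T}" and k: "k \<in> {1..m} \<rightarrow> {1..K}" and i: "i \<in> {1..K}"
  defines "Z \<equiv> \<lambda>\<omega>. resample_term m j t k \<omega> * (indicator {\<omega> \<in> space P. B t i \<omega> = k m} \<omega> - W_norm T K w Xt B m t (k m) \<omega>)"
  shows "integrable P Z" and "AE \<omega> in P. real_cond_exp P (Hs 0 (2 * t - 1)) Z \<omega> = 0"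
proof -
  define G where "G = Hs 0 (2 * t - 1)"
  have t1: "(m - 1) * T \<le> t - 1" "t - 1 \<le> m * T" "2 * (t - 1) \<le> 2 * t - 1" using t by auto
  have km: "k m \<in> {1..K}" using k m by auto
  have tU: "t \<in> {1..U}" using block_le[OF m, of t] t by auto
  have G: "subalgebra P G" unfolding G_def by (rule subalgebra_history) (use tU in auto)
  interpret G: finite_measure_subalgebra P G by unfold_locales (rule G)
  have spG: "space G = space P" by (simp add: G_def)
  define \<Phi> where "\<Phi> = resample_term m j t k"
  have \<Phi>: "\<Phi> \<in> borel_measurable G" unfolding \<Phi>_def G_def by (rule resample_term_measurable[OF m t k])
  have \<Phi>P[measurable]: "\<Phi> \<in> borel_measurable P" by (rule measurable_from_subalg[OF G \<Phi>])
  define W where "W = W_norm T K w Xt B m t (k m)"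
  have WG: "W \<in> borel_measurable G" unfolding W_def G_def by (rule W_norm_measurable[OF m _ t order_refl km]) simp
  have WP[measurable]: "W \<in> borel_measurable P" by (rule measurable_from_subalg[OF G WG])
  have Wpos: "\<And>\<omega>. \<omega> \<in> space P \<Longrightarrow> 0 < W \<omega>" unfolding W_def by (rule W_norm_pos[OF m t km])
  define E where "E = {\<omega> \<in> space P. B t i \<omega> = k m}"
  have E[measurable]: "E \<in> sets P"
    using B_event[OF tU i, of 0 "2 * t"] subalgebra_history[of "2 * t" 0] tU by (auto simp: E_def subalgebra_def)
  define D where "D = {\<omega> \<in> space G. A_res T B m (t - 1) (k m) \<omega> = j}"
  have "D \<in> sets G" unfolding D_def G_def by (rule A_event[OF m t1 km])
  then have D: "D \<in> sets P" using G by (auto simp: subalgebra_def)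
  have "integrable P (\<lambda>\<omega>. f t (X_join_prop T Xt B m t k \<omega>) * H_join T K w Xt B m (t - 1) k \<omega>)"
    by (rule integrable_X_join_prop[OF m t k version_integral(1)[OF versions]]) (use tU in auto)
  \<comment> \<open>The factor \<open>1 / K\<close> remains when \<open>W\<close> cancels in
    \<open>H_prop\<close>; the indicator selects the ancestor \<open>j\<close>.\<close>
  then have "integrable P (\<lambda>\<omega>. indicator D \<omega> *\<^sub>R (f t (X_join_prop T Xt B m t k \<omega>) * H_join T K w Xt B m (t - 1) k \<omega>) / real K)"
    by (intro Bochner_Integration.integrable_divide integrable_mult_indicator[OF D]) 
  moreover have "indicator D \<omega> *\<^sub>R (f t (X_join_prop T Xt B m t k \<omega>) * H_join T K w Xt B m (t - 1) k \<omega>) / real K = \<Phi> \<omega> * W \<omega>"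
    if "\<omega> \<in> space P" for \<omega>
    using W_times_H_join_prop[OF m k t that, symmetric] that K_pos
    by (simp add: \<Phi>_def W_def resample_term_def D_def spG indicator_def field_simps)
  ultimately have i1: "integrable P (\<lambda>\<omega>. \<Phi> \<omega> * W \<omega>)"
    by (simp cong: Bochner_Integration.integrable_cong)
  have i2: "integrable P (\<lambda>\<omega>. \<Phi> \<omega> * indicator E \<omega>)"
  proof (rule integrableI_bounded)
    have "(\<integral>\<^sup>+\<omega>. ennreal (norm (\<Phi> \<omega> * indicator E \<omega>)) \<partial>P) = (\<integral>\<^sup>+\<omega>. indicator E \<omega> * ennreal (norm (\<Phi> \<omega>)) \<partial>P)"
      by (rule nn_integral_cong) (auto simp: indicator_def)
    also have "\<dots> = (\<integral>\<^sup>+\<omega>. ennreal (W \<omega>) * ennreal (norm (\<Phi> \<omega>)) \<partial>P)"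
      unfolding E_def W_def
      by (rule nn_integral_resampling[OF m t i km]) (use \<Phi> in \<open>simp add: G_def\<close>)
    also have "\<dots> = (\<integral>\<^sup>+\<omega>. ennreal (norm (\<Phi> \<omega> * W \<omega>)) \<partial>P)"
      using Wpos by (intro nn_integral_cong) (simp add: abs_mult less_imp_le mult.commute flip: ennreal_mult)
    also have "\<dots> < \<infinity>" using i1 by (simp add: integrable_iff_bounded)
    finally show "(\<integral>\<^sup>+\<omega>. ennreal (norm (\<Phi> \<omega> * indicator E \<omega>)) \<partial>P) < \<infinity>" .
  qed measurable
  have Z: "Z = (\<lambda>\<omega>. \<Phi> \<omega> * indicator E \<omega> - \<Phi> \<omega> * W \<omega>)"
    by (simp add: Z_def \<Phi>_def W_def E_def right_diff_distrib)
  show "integrable P Z" unfolding Z by (rule Bochner_Integration.integrable_diff[OF i2 i1])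
  have "AE \<omega> in P. real_cond_exp P G Z \<omega> = real_cond_exp P G (\<lambda>\<omega>. \<Phi> \<omega> * indicator E \<omega>) \<omega> - real_cond_exp P G (\<lambda>\<omega>. \<Phi> \<omega> * W \<omega>) \<omega>"
    unfolding Z by (rule G.real_cond_exp_diff[OF i2 i1])
  moreover have "AE \<omega> in P. real_cond_exp P G (\<lambda>\<omega>. \<Phi> \<omega> * indicator E \<omega>) \<omega> = \<Phi> \<omega> * real_cond_exp P G (indicator E) \<omega>"
    by (rule G.real_cond_exp_mult[OF \<Phi> _ i2]) measurable
  moreover have "AE \<omega> in P. real_cond_exp P G (\<lambda>\<omega>. \<Phi> \<omega> * W \<omega>) \<omega> = \<Phi> \<omega> * W \<omega>"
    by (rule G.real_cond_exp_F_meas[OF i1 borel_measurable_times[OF \<Phi> WG]])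
  moreover have "AE \<omega> in P. real_cond_exp P G (indicator E) \<omega> = W \<omega>"
    unfolding G_def E_def W_def by (rule resampling_one[OF m t i km])
  ultimately show "AE \<omega> in P. real_cond_exp P (Hs 0 (2 * t - 1)) Z \<omega> = 0"
    unfolding G_def[symmetric] by eventually_elim simp
qed

section \<open>The increments as martingale differences\<close>

lemma eps_sample_centred:
  assumes m: "m \<in> {1..M}" and t: "t \<in> {(m - 1) * T<..m * T}"
  shows "eps_sample T K w Xt B f m j t \<in> borel_measurable (Hs 0 (2 * t - 1))"
    and "integrable P (eps_sample T K w Xt B f m j t)"
    and "AE \<omega> in P. real_cond_exp P (Hs 0 (2 * t - 2)) (eps_sample T K w Xt B f m j t) \<omega> = 0"
proof -
  have Zk: "k \<in> {1..m} \<rightarrow> {1..K}" if "k \<in> Z_set K m" for k using that by auto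
  have "subalgebra P (Hs 0 (2 * t - 2))"
    by (rule subalgebra_history) (use block_le[OF m, of t] t in auto)
  then interpret G: finite_measure_subalgebra P "Hs 0 (2 * t - 2)" by unfold_locales
  have eq: "eps_sample T K w Xt B f m j t = (\<lambda>\<omega>. (\<Sum>k\<in>Z_set K m. sample_term m j t k \<omega>) / real K ^ (m - 1))"
    by (simp add: fun_eq_iff eps_sample_eq)
  show "eps_sample T K w Xt B f m j t \<in> borel_measurable (Hs 0 (2 * t - 1))"
    unfolding eq by (intro borel_measurable_divide borel_measurable_sum borel_measurable_const sample_term_measurable[OF m t Zk])
  show "integrable P (eps_sample T K w Xt B f m j t)"
    "AE \<omega> in P. real_cond_exp P (Hs 0 (2 * t - 2)) (eps_sample T K w Xt B f m j t) \<omega> = 0"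
    unfolding eq
    using G.real_cond_exp_sum_eq_0[OF finite_Z_set sample_term_centred(1)[OF m t Zk] sample_term_centred(2)[OF m t Zk]] by auto
qed

lemma eps_resample_centred:
  assumes m: "m \<in> {1..M}" and t: "t \<in> {(m - 1) * T<..m * T}"
  shows "eps_resample T K w Xt B f m j t \<in> borel_measurable (Hs 0 (2 * t))"
    and "integrable P (eps_resample T K w Xt B f m j t)"
    and "AE \<omega> in P. real_cond_exp P (Hs 0 (2 * t - 1)) (eps_resample T K w Xt B f m j t) \<omega> = 0"
proof -
  have Zk: "k \<in> {1..m} \<rightarrow> {1..K}" if "k \<in> Z_set K m" for k using that by auto
  have tU: "t \<in> {1..U}" using block_le[OF m, of t] t by auto
  have "subalgebra P (Hs 0 (2 * t - 1))" by (rule subalgebra_history) (use tU in auto)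
  then interpret G: finite_measure_subalgebra P "Hs 0 (2 * t - 1)" by unfold_locales
  define Z where "Z = (\<lambda>(k, i) \<omega>. resample_term m j t k \<omega> * (indicator {\<omega> \<in> space P. B t i \<omega> = k m} \<omega> - W_norm T K w Xt B m t (k m) \<omega>))"
  \<comment> \<open>Equal to \<open>eps_resample\<close> only on \<open>space P\<close>; the
    conclusions about \<open>e\<close> are transferred afterwards by congruence.\<close>
  define e where "e \<omega> = (\<Sum>ki\<in>Z_set K m \<times> {1..K}. Z ki \<omega>) / real K ^ (m - 1)" for \<omega>
  have eq: "eps_resample T K w Xt B f m j t \<omega> = e \<omega>" if "\<omega> \<in> space P" for \<omega>
    unfolding eps_resample_eq[OF that] e_def Z_def sum.cartesian_product by (simp add: case_prod_beta)
  have fin: "finite (Z_set K m \<times> {1..K})" using finite_Z_set by simp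
  have sub: "sets (Hs 0 (2 * t - 1)) \<subseteq> sets (Hs 0 (2 * t))" by (rule sets_history_mono) auto
  have em: "e \<in> borel_measurable (Hs 0 (2 * t))"
    unfolding e_def[abs_def]
  proof (intro borel_measurable_divide borel_measurable_sum borel_measurable_const)
    fix ki assume "ki \<in> Z_set K m \<times> {1..K}"
    then obtain k i where ki: "ki = (k, i)" and k: "k \<in> {1..m} \<rightarrow> {1..K}" and i: "i \<in> {1..K}" by (cases ki) auto
    have km: "k m \<in> {1..K}" using k m by auto
    have "resample_term m j t k \<in> borel_measurable (Hs 0 (2 * t))"
      by (rule measurable_from_subalg[OF _ resample_term_measurable[OF m t k]]) (use sub in \<open>simp add: subalgebra_def\<close>)
    moreover have "W_norm T K w Xt B m t (k m) \<in> borel_measurable (Hs 0 (2 * t))"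
      by (rule W_norm_measurable[OF m _ t _ km]) auto
    moreover have "{\<omega> \<in> space P. B t i \<omega> = k m} \<in> sets (Hs 0 (2 * t))"
      by (rule B_event[OF tU i]) (use tU in auto)
    ultimately show "Z ki \<in> borel_measurable (Hs 0 (2 * t))"
      unfolding Z_def ki prod.case by (intro borel_measurable_times borel_measurable_diff borel_measurable_indicator)
  qed
  show "eps_resample T K w Xt B f m j t \<in> borel_measurable (Hs 0 (2 * t))"
    using em by (rule measurable_cong[THEN iffD2, rotated]) (simp add: eq)
  have 1: "integrable P (Z ki)" "AE \<omega> in P. real_cond_exp P (Hs 0 (2 * t - 1)) (Z ki) \<omega> = 0"
    if kiZ: "ki \<in> Z_set K m \<times> {1..K}" for ki
  proof -
    obtain k i where ki: "ki = (k, i)" "k \<in> {1..m} \<rightarrow> {1..K}" "i \<in> {1..K}" using kiZ Zk by (cases ki) auto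
    show "integrable P (Z ki)" "AE \<omega> in P. real_cond_exp P (Hs 0 (2 * t - 1)) (Z ki) \<omega> = 0"
      using resample_term_centred[OF m t ki(2,3)] unfolding Z_def ki(1) prod.case by auto
  qed
  have e: "integrable P e" "AE \<omega> in P. real_cond_exp P (Hs 0 (2 * t - 1)) e \<omega> = 0"
    unfolding e_def[abs_def] by (rule G.real_cond_exp_sum_eq_0[OF fin 1], simp, simp)+
  show int: "integrable P (eps_resample T K w Xt B f m j t)"
    by (rule Bochner_Integration.integrable_cong[THEN iffD2, OF refl eq e(1)])
  have "AE \<omega> in P. real_cond_exp P (Hs 0 (2 * t - 1)) (eps_resample T K w Xt B f m j t) \<omega> = real_cond_exp P (Hs 0 (2 * t - 1)) e \<omega>"
    by (rule G.real_cond_exp_cong) (use eq borel_measurable_integrable[OF int] borel_measurable_integrable[OF e(1)] in auto)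
  then show "AE \<omega> in P. real_cond_exp P (Hs 0 (2 * t - 1)) (eps_resample T K w Xt B f m j t) \<omega> = 0"
    using e(2) by eventually_elim simp
qed

lemma eps_martingale_differences:
  assumes m: "m \<in> {1..M}"
  shows "martingale_differences P (filtr P \<mu> K Xt B) {2 * (m - 1) * T<..2 * m * T} (eps T K w Xt B f m j)"
  unfolding martingale_differences_def
proof (intro ballI)
  fix u assume u: "u \<in> {2 * (m - 1) * T<..2 * m * T}"
  have "m * T \<le> U" "u \<le> 2 * (m * T)" using block_le[OF m order_refl] u by (simp_all add: mult.assoc)
  then have "u \<le> 2 * U" by linarith
  then have sub: "subalgebra P (Hs 0 u)" by (rule subalgebra_history)
  have sub': "subalgebra (Hs 0 u) (Hs 0 (u - 1))"
    using sets_history_mono[of 0 0 "u - 1" u] by (simp add: subalgebra_def)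
  have "eps T K w Xt B f m j u \<in> borel_measurable (Hs 0 u) \<and> integrable P (eps T K w Xt B f m j u) \<and>
      (AE \<omega> in P. real_cond_exp P (Hs 0 (u - 1)) (eps T K w Xt B f m j u) \<omega> = 0)"
  proof (cases "odd u")
    case True
    \<comment> \<open>An odd step is the sampling of stage \<open>Suc s\<close>, and
      \<open>u - 1 = 2 * Suc s - 2\<close>. At the first step of a block this is the end of the
      previous filter.\<close>
    then obtain s where s: "u = Suc (2 * s)" by (elim oddE) simp
    have t: "Suc s \<in> {(m - 1) * T<..m * T}" using u s by (auto simp: mult.assoc)
    have "eps T K w Xt B f m j u = eps_sample T K w Xt B f m j (Suc s)"
      using True by (simp add: eps_def fun_eq_iff s)
    then show ?thesis using eps_sample_centred[OF m t, of j] by (simp add: s)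
  next
    case False
    then obtain s where s: "u = 2 * s" by auto
    have t: "s \<in> {(m - 1) * T<..m * T}" using u s by (auto simp: mult.assoc)
    have "eps T K w Xt B f m j u = eps_resample T K w Xt B f m j s"
      using False by (simp add: eps_def fun_eq_iff s)
    then show ?thesis using eps_resample_centred[OF m t, of j] by (simp add: s)
  qed
  with sub sub' show "subalgebra P (Hs 0 u) \<and> subalgebra (Hs 0 u) (Hs 0 (u - 1)) \<and>
      eps T K w Xt B f m j u \<in> borel_measurable (Hs 0 u) \<and> integrable P (eps T K w Xt B f m j u) \<and>
      (AE \<omega> in P. real_cond_exp P (Hs 0 (u - 1)) (eps T K w Xt B f m j u) \<omega> = 0)" by blast
qed

end

end

section \<open>Telescoping\<close>

text \<open>Makes coordinates beyond \<open>m\<close> irrelevant, so that the index of the next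
  filter can be summed out.\<close>

lemma X_join_cong:
  assumes "1 \<le> m" "1 \<le> T" and k: "\<And>n. n \<in> {1..m} \<Longrightarrow> k n = k' n"
  shows "X_join T Xt B m t k \<omega> = X_join T Xt B m t k' \<omega>"
proof -
  have "k (filt T u) = k' (filt T u)" if "1 \<le> u" "u \<le> (m - 1) * T" for u
    using filt_le[OF that(1) assms(2) that(2)] filt_bounds(1)[OF that(1) assms(2)]
    by (intro k) auto
  moreover have "k m = k' m" using assms by (intro k) auto
  ultimately show ?thesis by (auto simp: X_join_def join_paths_def fun_eq_iff)
qed

lemma H_join_cong:
  assumes "1 \<le> m" and k: "\<And>n. n \<in> {1..m} \<Longrightarrow> k n = k' n"
  shows "H_join T K w Xt B m t k \<omega> = H_join T K w Xt B m t k' \<omega>"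
proof -
  have "k m = k' m" using assms by (intro k) auto
  moreover have "(\<Prod>n=1..m - 1. H_res T K w Xt B n (n * T) (k n) \<omega>) = (\<Prod>n=1..m - 1. H_res T K w Xt B n (n * T) (k' n) \<omega>)"
    by (intro prod.cong refl arg_cong[where f = "\<lambda>j. H_res T K w Xt B _ _ j \<omega>"] k) auto
  ultimately show ?thesis by (simp add: H_join_def)
qed

text \<open>Steps \<open>2 * t - 1\<close> and \<open>2 * t\<close> make up stage \<open>t\<close>,
  so the range of steps consists of complete stages.\<close>

lemma sum_two_step_telescope:
  fixes e G :: "nat \<Rightarrow> real"
  shows "a \<le> b \<Longrightarrow> (\<And>t. t \<in> {a<..b} \<Longrightarrow> e (2 * t - 1) + e (2 * t) = G t - G (t - 1)) \<Longrightarrow>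
    (\<Sum>u\<in>{2 * a<..2 * b}. e u) = G b - G a"
proof (induction b rule: dec_induct)
  case (step b)
  have "{2 * a<..2 * Suc b} = insert (2 * Suc b) (insert (2 * Suc b - 1) {2 * a<..2 * b})"
    using step.hyps by auto
  then have "(\<Sum>u\<in>{2 * a<..2 * Suc b}. e u) = e (2 * Suc b) + (e (2 * Suc b - 1) + (\<Sum>u\<in>{2 * a<..2 * b}. e u))"
    by simp
  also have "(\<Sum>u\<in>{2 * a<..2 * b}. e u) = G b - G a"
    using step by auto
  also have "e (2 * Suc b) + (e (2 * Suc b - 1) + (G b - G a)) = G (Suc b) - G a"
    using step.prems[of "Suc b"] step.hyps by simp
  finally show ?case .
qed simp

context particle_filters
begin

context
  fixes f :: "nat \<Rightarrow> (nat \<Rightarrow> 'a) \<Rightarrow> real"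
  assumes versions: "cond_mean_versions \<mu> p1 p g Y T (M * T) q \<psi> f"
begin

text \<open>The telescoping quantity. There are \<open>K ^ m\<close> indices but the divisor is
  \<open>K ^ (m - 1)\<close>, which makes this \<open>K\<close> times an estimate of the posterior
  mean.\<close>

definition filter_sum :: "nat \<Rightarrow> nat \<Rightarrow> 'w \<Rightarrow> real" where
  "filter_sum m t \<omega> =
    (\<Sum>k\<in>Z_set K m. f t (X_join T Xt B m t k \<omega>) * H_join T K w Xt B m t k \<omega>) / real K ^ (m - 1)"

text \<open>The sum of \<open>f t\<close> at the proposed paths, weighted by the old
  \<open>H\<close>, enters from sampling with a plus sign and from resampling with a minus sign, and
  cancels.\<close>

lemma sum_eps_stage:
  assumes m: "m \<in> {1..M}" and t: "t \<in> {(m - 1) * T<..m * T}" and \<omega>: "\<omega> \<in> space P"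
  shows "(\<Sum>j=1..K. eps_sample T K w Xt B f m j t \<omega>) + (\<Sum>j=1..K. eps_resample T K w Xt B f m j t \<omega>) =
    filter_sum m t \<omega> - filter_sum m (t - 1) \<omega>"
proof -
  have tU: "t \<in> {1..U}" using block_le[OF m, of t] t by auto
  have Zk: "k \<in> {1..m} \<rightarrow> {1..K}" if "k \<in> Z_set K m" for k using that by auto
  have A: "A_res T B m (t - 1) (k m) \<omega> \<in> {1..K}" if "k \<in> Z_set K m" for k
    by (rule A_range[OF m \<omega>]) (use t m Zk[OF that] in auto)
  have part: "(\<Sum>j=1..K. (\<Sum>k\<in>{k \<in> Z_set K m. A_res T B m (t - 1) (k m) \<omega> = j}. h k) / c) = (\<Sum>k\<in>Z_set K m. h k) / c"
    for h :: "(nat \<Rightarrow> nat) \<Rightarrow> real" and c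
    unfolding sum_divide_distrib[symmetric]
    by (rule arg_cong[where f = "\<lambda>s. s / c"], rule sum_partition_label[OF finite_Z_set A])
  define x where "x k = f t (X_join_prop T Xt B m t k \<omega>)" for k
  define y where "y k = f (t - 1) (X_join T Xt B m (t - 1) k \<omega>)" for k
  define Hp where "Hp k = H_join_prop T K w Xt B m t k \<omega>" for k
  define H where "H k = H_join T K w Xt B m (t - 1) k \<omega>" for k
  have "(\<Sum>k\<in>Z_set K m. (real (offspring K B t (k m) \<omega>) - real K * W_norm T K w Xt B m t (k m) \<omega>) * x k * Hp k) =
      (\<Sum>k\<in>Z_set K m. real (card {i \<in> {1..K}. B t i \<omega> = k m}) * (x k * Hp k)) - (\<Sum>k\<in>Z_set K m. x k * H k)"
    unfolding sum_subtractf[symmetric]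
  proof (rule sum.cong[OF refl])
    fix k assume "k \<in> Z_set K m"
    from W_times_H_join_prop[OF m Zk[OF this] t \<omega>]
    show "(real (offspring K B t (k m) \<omega>) - real K * W_norm T K w Xt B m t (k m) \<omega>) * x k * Hp k =
        real (card {i \<in> {1..K}. B t i \<omega> = k m}) * (x k * Hp k) - x k * H k"
      by (simp add: offspring_def Hp_def H_def algebra_simps)
  qed
  \<comment> \<open>Weighting each proposed path by its offspring number is the same as summing over
    the resampled indices.\<close>
  also have "(\<Sum>k\<in>Z_set K m. real (card {i \<in> {1..K}. B t i \<omega> = k m}) * (x k * Hp k)) =
      (\<Sum>k\<in>Z_set K m. x (k(m := B t (k m) \<omega>)) * Hp (k(m := B t (k m) \<omega>)))"
    by (rule sum_Z_set_resample[where b = "\<lambda>i. B t i \<omega>" and a = "\<lambda>k. x k * Hp k", symmetric])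
       (use m B_range[OF \<omega> tU] in auto)
  also have "\<dots> = (\<Sum>k\<in>Z_set K m. f t (X_join T Xt B m t k \<omega>) * H_join T K w Xt B m t k \<omega>)"
    using m t T_pos by (simp add: x_def Hp_def X_join_resample H_join_resample)
  finally have re: "(\<Sum>k\<in>Z_set K m. (real (offspring K B t (k m) \<omega>) - real K * W_norm T K w Xt B m t (k m) \<omega>) * x k * Hp k) =
     (\<Sum>k\<in>Z_set K m. f t (X_join T Xt B m t k \<omega>) * H_join T K w Xt B m t k \<omega>) - (\<Sum>k\<in>Z_set K m. x k * H k)" .
  show ?thesis
    unfolding eps_sample_def eps_resample_def part
    unfolding x_def[symmetric] y_def[symmetric] Hp_def[symmetric] H_def[symmetric] re
    by (simp add: filter_sum_def left_diff_distrib sum_subtractf diff_divide_distrib y_def H_def)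
qed

lemma sum_eps_filter:
  assumes m: "m \<in> {1..M}" and \<omega>: "\<omega> \<in> space P"
  shows "(\<Sum>j=1..K. \<Sum>u\<in>{2 * (m - 1) * T<..2 * m * T}. eps T K w Xt B f m j u \<omega>) =
    filter_sum m (m * T) \<omega> - filter_sum m ((m - 1) * T) \<omega>"
proof -
  have "(\<Sum>u\<in>{2 * ((m - 1) * T)<..2 * (m * T)}. \<Sum>j=1..K. eps T K w Xt B f m j u \<omega>) =
      filter_sum m (m * T) \<omega> - filter_sum m ((m - 1) * T) \<omega>"
  proof (rule sum_two_step_telescope)
    fix t assume t: "t \<in> {(m - 1) * T<..m * T}"
    then obtain s where s: "t = Suc s" by (cases t) auto
    show "(\<Sum>j=1..K. eps T K w Xt B f m j (2 * t - 1) \<omega>) + (\<Sum>j=1..K. eps T K w Xt B f m j (2 * t) \<omega>) =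
        filter_sum m t \<omega> - filter_sum m (t - 1) \<omega>"
      using sum_eps_stage[OF m t \<omega>] by (simp add: eps_def s)
  qed (auto intro: mult_le_mono1)
  then show ?thesis by (subst sum.swap) (simp add: mult.assoc)
qed

text \<open>The new index is irrelevant at this moment; summing it out gives a factor
  \<open>K\<close>, which compensates for the additional \<open>K\<close> in the divisor.\<close>

lemma filter_sum_next:
  assumes "1 \<le> m"
  shows "filter_sum (Suc m) (m * T) \<omega> = filter_sum m (m * T) \<omega>"
proof -
  have "X_join T Xt B m (m * T) (k(Suc m := i)) \<omega> = X_join T Xt B m (m * T) k \<omega>"
    "H_join T K w Xt B m (m * T) (k(Suc m := i)) \<omega> = H_join T K w Xt B m (m * T) k \<omega>" for k i
    using assms T_pos by (auto intro!: X_join_cong H_join_cong)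
  moreover have "real K ^ m = real K * real K ^ (m - 1)"
    using assms by (cases m) auto
  ultimately show ?thesis
    using assms T_pos K_pos
    by (simp add: filter_sum_def sum_Z_set_Suc X_join_next_filter H_join_next_filter sum_distrib_left[symmetric])
qed

lemma filter_sum_first: "filter_sum 1 0 \<omega> = real K * post_mean \<mu> p1 p g Y U \<psi>"
proof -
  have "card (Z_set K 1) = K" by (simp add: card_PiE)
  then show ?thesis
    by (simp add: filter_sum_def version_0[OF versions] H_join_def)
qed

text \<open>\<open>f U\<close> is only a version of \<open>target\<close>, so the identity with the
  estimator holds almost surely. This is why the decomposition is an almost sure statement.\<close>

lemma filter_sum_last: "AE \<omega> in P. filter_sum M U \<omega> = real K * psi_hat \<mu> p1 p g Y M T \<psi> q w K Xt B \<omega>"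
proof -
  have "AE \<omega> in P. \<forall>k\<in>Z_set K M. f U (X_join T Xt B M U k \<omega>) = target (X_join T Xt B M U k \<omega>)"
  proof (rule AE_finite_allI[OF finite_Z_set])
    fix k assume "k \<in> Z_set K M"
    then have "k \<in> {1..M} \<rightarrow> {1..K}" by auto
    then show "AE \<omega> in P. f U (X_join T Xt B M U k \<omega>) = target (X_join T Xt B M U k \<omega>)"
      by (intro AE_X_join[OF _ _ _ _ version_final[OF versions]]) (use M_pos in auto)
  qed
  then show ?thesis
  proof eventually_elim
    case (elim \<omega>)
    have "real K ^ M = real K * real K ^ (M - 1)" using M_pos by (cases M) auto
    then show ?case
      using elim K_pos by (simp add: filter_sum_def psi_hat_def target_def mult_ac)
  qed
qed

lemma martingale_decomposition:
  "AE \<omega> in P. real K * (psi_hat \<mu> p1 p g Y M T \<psi> q w K Xt B \<omega> - post_mean \<mu> p1 p g Y U \<psi>) =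
    (\<Sum>m=1..M. \<Sum>j=1..K. \<Sum>u\<in>{2 * (m - 1) * T<..2 * m * T}. eps T K w Xt B f m j u \<omega>)"
  using filter_sum_last AE_space
proof eventually_elim
  case (elim \<omega>)
  \<comment> \<open>The value after \<open>n\<close> complete filters. \<open>D 0\<close> is set by
    hand, as there is no filter with number \<open>0\<close>.\<close>
  define D where "D n = (if n = 0 then real K * post_mean \<mu> p1 p g Y U \<psi> else filter_sum n (n * T) \<omega>)" for n
  have "filter_sum m ((m - 1) * T) \<omega> = D (m - 1)" if "1 \<le> m" for m
    using filter_sum_next[of "m - 1" \<omega>] filter_sum_first[of \<omega>] that
    by (cases "m = 1") (auto simp: D_def)
  then have "(\<Sum>m=1..M. \<Sum>j=1..K. \<Sum>u\<in>{2 * (m - 1) * T<..2 * m * T}. eps T K w Xt B f m j u \<omega>) =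
      (\<Sum>m=1..M. D m - D (m - 1))"
    using elim(2) by (intro sum.cong refl) (simp add: sum_eps_filter D_def)
  also have "\<dots> = D M - D 0"
    \<comment> \<open>The library sum starts at \<open>Suc 0\<close>, hence
      \<open>One_nat_def\<close> is needed here again.\<close>
    using sum_telescope''[of 0 M D] by (simp add: One_nat_def)
  also have "\<dots> = real K * (psi_hat \<mu> p1 p g Y M T \<psi> q w K Xt B \<omega> - post_mean \<mu> p1 p g Y U \<psi>)"
    using M_pos elim(1) by (simp add: D_def right_diff_distrib)
  finally show ?case by simp
qed

text \<open>Integrability comes directly from the change of measure; the mean then follows because
  every martingale difference has expectation zero.\<close>

lemma psi_hat_unbiased:
  shows "integrable P (psi_hat \<mu> p1 p g Y M T \<psi> q w K Xt B)"
    and "(\<integral>\<omega>. psi_hat \<mu> p1 p g Y M T \<psi> q w K Xt B \<omega> \<partial>P) = post_mean \<mu> p1 p g Y U \<psi>"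
proof -
  let ?hat = "psi_hat \<mu> p1 p g Y M T \<psi> q w K Xt B"
  have "integrable P (\<lambda>\<omega>. target (X_join T Xt B M U k \<omega>) * H_join T K w Xt B M U k \<omega>)" if "k \<in> Z_set K M" for k
    by (rule integrable_X_join[OF _ _ _ _ integrable_target]) (use M_pos that in auto)
  then show hat: "integrable P ?hat"
    unfolding psi_hat_def[abs_def] target_def
    by (intro Bochner_Integration.integrable_divide Bochner_Integration.integrable_sum)
       (simp add: mult.commute[of "\<psi> _"])
  have eps: "integrable P (eps T K w Xt B f m j u) \<and> (\<integral>\<omega>. eps T K w Xt B f m j u \<omega> \<partial>P) = 0"
    if m: "m \<in> {1..M}" and u: "u \<in> {2 * (m - 1) * T<..2 * m * T}" for m j u
  proof -
    have md: "subalgebra P (Hs 0 u)" "subalgebra (Hs 0 u) (Hs 0 (u - 1))" "integrable P (eps T K w Xt B f m j u)"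
      "AE \<omega> in P. real_cond_exp P (Hs 0 (u - 1)) (eps T K w Xt B f m j u) \<omega> = 0"
      using eps_martingale_differences[OF versions m, of j] u unfolding martingale_differences_def by auto
    have "subalgebra P (Hs 0 (u - 1))" using md(1,2) by (auto simp: subalgebra_def)
    then interpret s: finite_measure_subalgebra P "Hs 0 (u - 1)" by unfold_locales
    have "(\<integral>\<omega>. eps T K w Xt B f m j u \<omega> \<partial>P) = (\<integral>\<omega>. real_cond_exp P (Hs 0 (u - 1)) (eps T K w Xt B f m j u) \<omega> \<partial>P)"
      by (rule s.real_cond_exp_int(2)[OF md(3), symmetric])
    also have "\<dots> = (\<integral>\<omega>. 0 \<partial>P)" by (rule integral_cong_AE) (use md in auto)
    finally show ?thesis using md(3) by simp
  qed
  have "(\<integral>\<omega>. real K * (?hat \<omega> - post_mean \<mu> p1 p g Y U \<psi>) \<partial>P) =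
      (\<integral>\<omega>. (\<Sum>m=1..M. \<Sum>j=1..K. \<Sum>u\<in>{2 * (m - 1) * T<..2 * m * T}. eps T K w Xt B f m j u \<omega>) \<partial>P)"
    by (rule integral_cong_AE[OF _ _ martingale_decomposition])
       (use hat eps in \<open>auto intro!: borel_measurable_integrable Bochner_Integration.integrable_sum\<close>)
  also have "\<dots> = (\<Sum>m=1..M. \<Sum>j=1..K. \<Sum>u\<in>{2 * (m - 1) * T<..2 * m * T}. 0)"
    by (intro has_bochner_integral_integral_eq has_bochner_integral_sum)
       (use eps in \<open>auto simp: has_bochner_integral_iff\<close>)
  also have "\<dots> = 0" by simp
  finally have "real K * ((\<integral>\<omega>. ?hat \<omega> \<partial>P) - post_mean \<mu> p1 p g Y U \<psi>) = 0"
    using hat by (simp add: prob_space)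
  then show "(\<integral>\<omega>. ?hat \<omega> \<partial>P) = post_mean \<mu> p1 p g Y U \<psi>" using K_pos by simp
qed

end

end

text \<open>Integrability is part of the conclusion because the Bochner integral of a non-integrable
  function is zero by convention, so the final equation alone would say less than \<open>E_K\<close>
  having that value.\<close>

theorem theorem1:
  fixes \<mu> :: "'a measure" and \<nu> :: "'y measure"
    and p1 :: "'a \<Rightarrow> real" and p :: "'a \<Rightarrow> 'a \<Rightarrow> real" and g :: "'a \<Rightarrow> 'y \<Rightarrow> real"
    and Y :: "nat \<Rightarrow> 'y" and M T :: nat and \<psi> :: "(nat \<Rightarrow> 'a) \<Rightarrow> real"
    and q :: "nat \<Rightarrow> (nat \<Rightarrow> 'a) \<Rightarrow> 'a \<Rightarrow> real" and w :: "nat \<Rightarrow> (nat \<Rightarrow> 'a) \<Rightarrow> real"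
    and P :: "'w measure" and K :: nat
    and Xt :: "nat \<Rightarrow> nat \<Rightarrow> 'w \<Rightarrow> 'a" and B :: "nat \<Rightarrow> nat \<Rightarrow> 'w \<Rightarrow> nat"
    and f :: "nat \<Rightarrow> (nat \<Rightarrow> 'a) \<Rightarrow> real"
  assumes "particle_filters \<mu> \<nu> p1 p g Y M T \<psi> q w P K Xt B"
    and "cond_mean_versions \<mu> p1 p g Y T (M * T) q \<psi> f"
  shows "(\<forall>j\<in>{1..K}. \<forall>m\<in>{1..M}.
            martingale_differences P (filtr P \<mu> K Xt B) {2 * (m - 1) * T<..2 * m * T}
              (eps T K w Xt B f m j))
       \<and> (AE \<omega> in P.
            real K * (psi_hat \<mu> p1 p g Y M T \<psi> q w K Xt B \<omega> - post_mean \<mu> p1 p g Y (M * T) \<psi>) =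
            (\<Sum>m=1..M. \<Sum>j=1..K. \<Sum>u\<in>{2 * (m - 1) * T<..2 * m * T}. eps T K w Xt B f m j u \<omega>))
       \<and> integrable P (psi_hat \<mu> p1 p g Y M T \<psi> q w K Xt B)
       \<and> (\<integral>\<omega>. psi_hat \<mu> p1 p g Y M T \<psi> q w K Xt B \<omega> \<partial>P) = post_mean \<mu> p1 p g Y (M * T) \<psi>"
proof -
  interpret particle_filters \<mu> \<nu> p1 p g Y M T \<psi> q w P K Xt B by (rule assms(1))
  show ?thesis
    using eps_martingale_differences[OF assms(2)] martingale_decomposition[OF assms(2)]
      psi_hat_unbiased[OF assms(2)]
    by blast
qed

end
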